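(* Let $s_1,\rho\in\mathbb C$ and put $\sigma_1=\Re s_1$. Suppose that $\Re\rho>1$ and $2\sigma_1+\Re\rho>3$. Then the series $$\zeta_2^{[2]}(s_1,\rho)=\sum_{n=1}^{\infty}\frac{|H_{n-1}^{(s_1)}|^2}{n^{\rho}}$$ converges absolutely, and $$\zeta_2^{[2]}(s_1,\rho)=\zeta_3(s_1,\overline{s_1},\rho)+\zeta_3(\overline{s_1},s_1,\rho)+\zeta_2(2\sigma_1,\rho).$$ If $\rho=2\sigma_2$ with $\sigma_2\in\mathbb R$, the conditions $\Re\rho>1$ and $2\sigma_1+\Re\rho>3$ become $\sigma_2>1/2$ and $\sigma_1+\sigma_2>3/2$. Assume in this case, in addition, that the path $(s_1,\sigma_2+it)$, $t\ge 2$, does not pass through a pole of $\zeta_2$. Then, as $T\to\infty$, $$\int_2^T\left|\zeta_2(s_1,\sigma_2+it)\right|^2dt=\Bigl(\zeta_3(s_1,\overline{s_1},2\sigma_2)+\zeta_3(\overline{s_1},s_1,2\sigma_2)+\zeta_2(2\sigma_1,2\sigma_2)\Bigr)T+o(T).$$ In particular, if $k\ge1$ and $\ell\ge2$ are integers, then $$\zeta_2^{[2]}(k,\ell)=2\zeta_3(k,k,\ell)+\zeta_2(2k,\ell),$$ and hence $$\int_2^T\left|\zeta_2\left(k,\frac{\ell}{2}+it\right)\right|^2dt=\bigl(2\zeta_3(k,k,\ell)+\zeta_2(2k,\ell)\bigr)T+o_{k,\ell}(T)\qquad(T\to\infty),$$ so that at these points the coefficient of $T$ is a linear combination of convergent multiple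 zeta values.
   Context: For $w\in\mathbb C$ and an integer $N\ge1$, $H_N^{(w)}:=\sum_{m=1}^N m^{-w}$, and $H_0^{(w)}:=0$. The Euler--Zagier multiple zeta-function (increasing-index convention) is $$\zeta_r(s_1,\dots,s_r):=\sum_{1\le n_1<\cdots<n_r}\frac1{n_1^{s_1}\cdots n_r^{s_r}},$$ initially in its region of absolute convergence; its meromorphic continuation to $\mathbb C^r$ is denoted by the same symbol. In particular $\zeta_2(s_1,s_2)=\sum_{1\le m<n}m^{-s_1}n^{-s_2}$ converges absolutely for $\Re s_2>1$, $\Re s_1+\Re s_2>2$, and is continued meromorphically to $\mathbb C^2$. *)

theory Defs
  imports "HOL-Analysis.Analysis" "HOL-Library.Landau_Symbols"
begin

definition H :: "complex \<Rightarrow> nat \<Rightarrow> complex" where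
  "H w N = (\<Sum>m = 1..N. 1 / of_nat m powr w)"

definition zeta22_term :: "complex \<Rightarrow> complex \<Rightarrow> nat \<Rightarrow> complex" where
  "zeta22_term s \<rho> n = of_real ((cmod (H s (n - 1)))\<^sup>2) / of_nat n powr \<rho>"

definition zeta22 :: "complex \<Rightarrow> complex \<Rightarrow> complex" where
  "zeta22 s \<rho> = (\<Sum>\<^sub>\<infinity>n\<in>{1..}. zeta22_term s \<rho> n)"


section \<open>Holomorphic and meromorphic functions of several complex variables\<close>

text \<open>Holomorphic on an open set: Frechet differentiable with complex-linear derivative.\<close>

definition mholo_on :: "(complex ^ 'r \<Rightarrow> complex) \<Rightarrow> (complex ^ 'r) set \<Rightarrow> bool" where
  "mholo_on f S \<longleftrightarrow>
     (\<forall>p\<in>S. \<exists>D. (f has_derivative D) (at p) \<and> (\<forall>c v. D (c *s v) = c * D v))"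

text \<open>Every point has a ball on which \<open>f = g / h\<close> away from the zero set of \<open>h\<close>, with \<open>g\<close> and
  \<open>h\<close> holomorphic and \<open>h\<close> not identically zero. No condition is placed on the values of the total
  function \<open>f\<close> where \<open>h = 0\<close>.\<close>

definition mmero :: "(complex ^ 'r \<Rightarrow> complex) \<Rightarrow> bool" where
  "mmero f \<longleftrightarrow>
     (\<forall>p. \<exists>e>0. \<exists>g h. mholo_on g (ball p e) \<and> mholo_on h (ball p e) \<and>
        (\<exists>q\<in>ball p e. h q \<noteq> 0) \<and> (\<forall>q\<in>ball p e. h q \<noteq> 0 \<longrightarrow> f q = g q / h q))"

text \<open>A point is a pole of a meromorphic function \<open>f\<close> if \<open>f\<close> does not coincide near it, off a
  thin analytic set \<open>h = 0\<close>, with a holomorphic function; the poles are thus all the points of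
  the polar set, including points of indeterminacy.\<close>

definition mpole :: "(complex ^ 'r \<Rightarrow> complex) \<Rightarrow> complex ^ 'r \<Rightarrow> bool" where
  "mpole f p \<longleftrightarrow>
     \<not> (\<exists>e>0. \<exists>g h. mholo_on g (ball p e) \<and> mholo_on h (ball p e) \<and>
        (\<exists>q\<in>ball p e. h q \<noteq> 0) \<and> (\<forall>q\<in>ball p e. h q \<noteq> 0 \<longrightarrow> f q = g q))"

text \<open>The representative of a meromorphic function that has no removable singularities and takes
  the value 0 at the poles; compare \<open>nicely_meromorphic_on\<close> for one variable.\<close>

definition nicely_mmero :: "(complex ^ 'r \<Rightarrow> complex) \<Rightarrow> bool" where
  "nicely_mmero f \<longleftrightarrow>
     mmero f \<and> (\<forall>p. (\<exists>e>0. mholo_on f (ball p e)) \<or> (mpole f p \<and> f p = 0))"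


section \<open>The Euler--Zagier multiple zeta-function\<close>

text \<open>The depth is the size of a finite linearly ordered index type \<open>'r\<close>, so that the increasing
  tuples \<open>1 \<le> n\<^sub>1 < \<dots> < n\<^sub>r\<close> are the strictly monotone functions from \<open>'r\<close> to the positive
  integers.\<close>

definition mzeta_indices :: "('r::{finite,linorder} \<Rightarrow> nat) set" where
  "mzeta_indices = {n. strict_mono n \<and> (\<forall>i. 1 \<le> n i)}"

definition mzeta_term :: "complex ^ 'r::{finite,linorder} \<Rightarrow> ('r \<Rightarrow> nat) \<Rightarrow> complex" where
  "mzeta_term s n = 1 / (\<Prod>i\<in>UNIV. of_nat (n i) powr (s $ i))"

definition mzeta_region :: "(complex ^ 'r::{finite,linorder}) set" where
  "mzeta_region = {s. (\<lambda>n. norm (mzeta_term s n)) summable_on mzeta_indices}"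

definition mzeta_series :: "complex ^ 'r::{finite,linorder} \<Rightarrow> complex" where
  "mzeta_series s = (\<Sum>\<^sub>\<infinity>n\<in>mzeta_indices. mzeta_term s n)"

definition mzeta_continuation :: "(complex ^ 'r::{finite,linorder} \<Rightarrow> complex) \<Rightarrow> bool" where
  "mzeta_continuation Z \<longleftrightarrow> nicely_mmero Z \<and> (\<forall>s\<in>mzeta_region. Z s = mzeta_series s)"

text \<open>By the identity theorem there is at most one continuation.\<close>

definition mzeta :: "complex ^ 'r::{finite,linorder} \<Rightarrow> complex" where
  "mzeta s = (if s \<in> mzeta_region then mzeta_series s else (THE Z. mzeta_continuation Z) s)"

text \<open>In the numeral types the elements are ordered \<open>0 < 1\<close> and \<open>0 < 1 < 2\<close>, whereas \<open>2 = 0\<close> in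
  type \<open>2\<close> and \<open>3 = 0\<close> in type \<open>3\<close>. Hence coordinates are numbered from 0 here, and
  \<open>vector [a, b]\<close> would put them in the wrong order.\<close>

definition pt2 :: "complex \<Rightarrow> complex \<Rightarrow> complex ^ 2" where
  "pt2 a b = (\<chi> i. if i = 0 then a else b)"

definition pt3 :: "complex \<Rightarrow> complex \<Rightarrow> complex \<Rightarrow> complex ^ 3" where
  "pt3 a b c = (\<chi> i. if i = 0 then a else if i = 1 then b else c)"

abbreviation zeta2 :: "complex \<Rightarrow> complex \<Rightarrow> complex" where
  "zeta2 a b \<equiv> mzeta (pt2 a b)"

abbreviation zeta3 :: "complex \<Rightarrow> complex \<Rightarrow> complex \<Rightarrow> complex" where
  "zeta3 a b c \<equiv> mzeta (pt3 a b c)"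

end

theory Submission
  imports Defs "HOL-Complex_Analysis.Conformal_Mappings"
begin

text \<open>
  Expanding \<open>|H|\<^sup>2\<close> and sorting the pairs \<open>(m, m')\<close> by \<open>m < m'\<close>, \<open>m > m'\<close>, \<open>m = m'\<close> gives the formula
  for \<open>zeta22\<close>.

  The continuation of \<open>\<zeta>\<^sub>2\<close> rests on the Taylor expansion of \<open>(n + 1) powr (1 - s)\<close> in powers of \<open>1/n\<close>:
  summing it against coefficients \<open>b\<^sub>n\<close> expresses \<open>(s - 1) \<Sum> b\<^sub>n n powr (- s)\<close> by an Abel sum, the values
  at \<open>s + 1, s + 2, \<dots>\<close> and a remainder series converging further to the left. The cases \<open>b\<^sub>n = 1\<close> and
  \<open>b\<^sub>n = H s\<^sub>1 n\<close> give \<open>\<zeta>\<close> and \<open>\<zeta>\<^sub>2(s\<^sub>1, s) + \<zeta>(s\<^sub>1 + s)\<close>, and the Abel sum of the second is \<open>\<zeta>(s\<^sub>1 + s - 1)\<close>.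

  For the mean square the first order formula is cut at \<open>M = \<lfloor>T\<rfloor>\<close>. The Dirichlet polynomial
  \<open>\<Sum>\<^sub>n\<^sub>\<le>\<^sub>M\<close> contributes the main term; the only remainder that is not small pointwise is
  \<open>s \<integral>\<^sub>0\<^sup>1 (1 - \<theta>) \<Sum>\<^sub>n\<^sub>>\<^sub>M H s\<^sub>1 n (n + \<theta>) powr (- s - 1) d\<theta>\<close>, which is small in mean square by Cauchy--Schwarz in
  \<open>\<theta>\<close> and the same mean value estimate.
\<close>


section \<open>Holomorphic functions of several variables\<close>

text \<open>Off the region of convergence \<open>mzeta\<close> is a definite description, so its
  values become known only once a continuation to all of C^2 is shown to exist and to be unique.
  Meromorphic functions are total here and unconstrained on the zero set of a denominator; equality
  therefore holds at first off a thin set, and is upgraded to equality of values where both sides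
  are continuous or both have a pole.

  One translation step reaches Re s2 > 0, Re (s1 + s2) > 1, which contains the path of integration.
  The only possible polar lines there are s2 = 1 and s1 + s2 = 2. The first is avoided since t >= 2;
  the second is where the no-pole hypothesis enters.

  The mean value argument for the tail is forced. With H s1 n = O(n^beta) and beta - sigma2 <= -1/2
  - delta, the terms beyond T are bounded pointwise only by about T * T^(beta - sigma2), at most
  T^(1/2 - delta); squared and integrated this is T^(2 - 2 delta), too much for small delta.
  Averaging over t saves roughly a further factor T. All exponents leave some room, so that crude
  bounds for the off-diagonal terms suffice and no logarithms appear.\<close>

lemma norm_vector_smult: "norm (c *s v) = norm c * norm (v :: complex ^ 'r::finite)"
proof -
  have "(\<Sum>i\<in>UNIV. (norm (c * v $ i))\<^sup>2) = (norm c)\<^sup>2 * (\<Sum>i\<in>UNIV. (norm (v $ i))\<^sup>2)"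
    by (simp add: sum_distrib_left norm_mult power_mult_distrib)
  then show ?thesis
    by (simp add: norm_vec_def L2_set_def real_sqrt_mult)
qed

lemma has_derivative_vector_smult:
  "((\<lambda>t. p + t *s v) has_derivative (\<lambda>t. t *s v)) (at (t::complex))" for v :: "complex ^ 'r::finite"
proof -
  have "bounded_linear (\<lambda>t::complex. t *s v)"
  proof (rule bounded_linear_intro[where K = "norm v"])
    show "\<And>x. norm (x *s v) \<le> norm x * norm v" by (simp add: norm_vector_smult)
  qed (auto simp: vec_eq_iff algebra_simps)
  then show ?thesis
    by (auto intro!: derivative_eq_intros bounded_linear_imp_has_derivative)
qed

abbreviation mdiff_at :: "(complex ^ 'r \<Rightarrow> complex) \<Rightarrow> complex ^ 'r \<Rightarrow> bool" where
  "mdiff_at f p \<equiv> (\<exists>D. (f has_derivative D) (at p) \<and> (\<forall>c v. D (c *s v) = c * D v))"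

lemma mholo_on_subset: "mholo_on f S \<Longrightarrow> T \<subseteq> S \<Longrightarrow> mholo_on f T"
  by (auto simp: mholo_on_def)

lemma mholo_on_const: "mholo_on (\<lambda>_. c) S"
  unfolding mholo_on_def by (auto intro!: exI[of _ "\<lambda>_. 0"])

lemma mholo_on_nth: "mholo_on (\<lambda>q. q $ i) S"
  unfolding mholo_on_def
  by (auto intro!: exI[of _ "\<lambda>q. q $ i"] bounded_linear_imp_has_derivative bounded_linear_vec_nth)

lemma mholo_on_add: "mholo_on f S \<Longrightarrow> mholo_on g S \<Longrightarrow> mholo_on (\<lambda>q. f q + g q) S"
  unfolding mholo_on_def
proof
  fix p assume "\<forall>p\<in>S. mdiff_at f p"
    "\<forall>p\<in>S. mdiff_at g p" "p \<in> S"
  then obtain D E where "(f has_derivative D) (at p)" "\<forall>c v. D (c *s v) = c * D v"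
     "(g has_derivative E) (at p)" "\<forall>c v. E (c *s v) = c * E v" by blast
  then show "mdiff_at (\<lambda>q. f q + g q) p"
    by (intro exI[of _ "\<lambda>v. D v + E v"]) (auto intro: has_derivative_add simp: algebra_simps)
qed

lemma mholo_on_mult: "mholo_on f S \<Longrightarrow> mholo_on g S \<Longrightarrow> mholo_on (\<lambda>q. f q * g q) S"
  unfolding mholo_on_def
proof
  fix p assume "\<forall>p\<in>S. mdiff_at f p"
    "\<forall>p\<in>S. mdiff_at g p" "p \<in> S"
  then obtain D E where "(f has_derivative D) (at p)" "\<forall>c v. D (c *s v) = c * D v"
     "(g has_derivative E) (at p)" "\<forall>c v. E (c *s v) = c * E v" by blast
  then show "mdiff_at (\<lambda>q. f q * g q) p"
    by (intro exI[of _ "\<lambda>v. f p * E v + D v * g p"]) (auto intro!: derivative_eq_intros simp: algebra_simps)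
qed

lemma mholo_on_diff: "mholo_on f S \<Longrightarrow> mholo_on g S \<Longrightarrow> mholo_on (\<lambda>q. f q - g q) S"
  using mholo_on_add[of f S "\<lambda>q. (-1) * g q"] mholo_on_mult[OF mholo_on_const[of "-1"], of g S] by simp

lemma mholo_on_sum: "(\<And>i. i \<in> I \<Longrightarrow> mholo_on (f i) S) \<Longrightarrow> mholo_on (\<lambda>q. \<Sum>i\<in>I. f i q) S"
  by (induction I rule: infinite_finite_induct) (auto intro: mholo_on_const mholo_on_add)

lemma mholo_on_compose_holomorphic:
  assumes "f holomorphic_on T" "open T" "mholo_on l S" "l ` S \<subseteq> T"
  shows "mholo_on (\<lambda>q. f (l q)) S"
  unfolding mholo_on_def
proof
  fix p assume p: "p \<in> S"
  then obtain D where D: "(l has_derivative D) (at p)" "\<forall>c v. D (c *s v) = c * D v"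
    using assms(3) by (auto simp: mholo_on_def)
  have "(f has_field_derivative deriv f (l p)) (at (l p))"
    using assms p by (intro holomorphic_derivI[of f T]) auto
  then have "((\<lambda>q. f (l q)) has_derivative (\<lambda>v. deriv f (l p) * D v)) (at p)"
    using has_derivative_compose[OF D(1)] by (auto simp: has_field_derivative_def)
  then show "mdiff_at (\<lambda>q. f (l q)) p"
    using D(2) by (intro exI[of _ "\<lambda>v. deriv f (l p) * D v"]) auto
qed

lemma mholo_on_inverse:
  assumes "mholo_on f S" "\<And>q. q \<in> S \<Longrightarrow> f q \<noteq> 0"
  shows "mholo_on (\<lambda>q. inverse (f q)) S"
  using assms by (intro mholo_on_compose_holomorphic[of inverse "-{0}"])
     (auto intro!: holomorphic_intros open_delete)

lemma mholo_on_divide: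
  assumes "mholo_on f S" "mholo_on g S" "\<And>q. q \<in> S \<Longrightarrow> g q \<noteq> 0"
  shows "mholo_on (\<lambda>q. f q / g q) S"
  using mholo_on_mult[OF assms(1) mholo_on_inverse[OF assms(2,3)]] by (simp add: field_simps)

lemma mholo_on_translate:
  assumes "mholo_on f S" "(\<lambda>q. q + a) ` T \<subseteq> S"
  shows "mholo_on (\<lambda>q. f (q + a)) T"
  unfolding mholo_on_def
proof
  fix p assume p: "p \<in> T"
  then have "p + a \<in> S" using assms(2) by blast
  then obtain D where D: "(f has_derivative D) (at (p + a))" "\<forall>c v. D (c *s v) = c * D v"
    using assms(1) unfolding mholo_on_def by blast
  have "((\<lambda>q. q + a) has_derivative (\<lambda>v. v)) (at p)"
    by (auto intro!: derivative_eq_intros)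
  from has_derivative_compose[OF this D(1)] D(2)
  show "mdiff_at (\<lambda>q. f (q + a)) p" by auto
qed

lemma mholo_on_transform:
  assumes "mholo_on f S" "open S" "\<And>q. q \<in> S \<Longrightarrow> f q = g q"
  shows "mholo_on g S"
  unfolding mholo_on_def
proof
  fix p assume p: "p \<in> S"
  then obtain D where D: "(f has_derivative D) (at p)" "\<forall>c v. D (c *s v) = c * D v"
    using assms(1) by (auto simp: mholo_on_def)
  have "(g has_derivative D) (at p)"
    by (rule has_derivative_transform_within_open[OF D(1) assms(2) p]) (use assms in auto)
  with D show "mdiff_at g p" by blast
qed

lemma mholo_on_imp_isCont: "mholo_on f S \<Longrightarrow> p \<in> S \<Longrightarrow> isCont f p"
  unfolding mholo_on_def using has_derivative_continuous by blast

lemma mholo_on_line: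
  assumes "mholo_on f S" "(\<lambda>t. p + t *s v) ` A \<subseteq> S"
  shows "(\<lambda>t. f (p + t *s v)) holomorphic_on A"
proof (rule holomorphic_onI)
  fix t assume t: "t \<in> A"
  then have "p + t *s v \<in> S" using assms(2) by blast
  then obtain D where D: "(f has_derivative D) (at (p + t *s v))" "\<forall>c v. D (c *s v) = c * D v"
    using assms(1) unfolding mholo_on_def by blast
  have "((\<lambda>t. f (p + t *s v)) has_derivative (\<lambda>t. D (t *s v))) (at t)"
    using has_derivative_compose[OF has_derivative_vector_smult D(1)] .
  then have "((\<lambda>t. f (p + t *s v)) has_field_derivative D v) (at t)"
    using D(2) by (simp add: has_field_derivative_def mult.commute[of _ "D v"] mult_commute_abs)
  then show "(\<lambda>t. f (p + t *s v)) field_differentiable at t within A"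
    using field_differentiable_at_within field_differentiable_def by blast
qed

text \<open>Restricted to the complex line through \<open>q\<close> and \<open>q0\<close>,
  \<open>h\<close> is holomorphic in one variable on an open convex set and nonzero at parameter 1,
  so a zero at parameter 0 is isolated.\<close>

lemma mholo_on_nonzero_dense:
  assumes h: "mholo_on h S" and S: "open S" "convex S" and q: "q0 \<in> S" "h q0 \<noteq> 0" "q \<in> S" "e > 0"
  shows "\<exists>q'\<in>S \<inter> ball q e. h q' \<noteq> 0"
proof (cases "h q = 0")
  case False
  then show ?thesis using q by force
next
  case True
  define A where "A = (\<lambda>t. q + t *s (q0 - q)) -` S"
  have cont: "continuous_on UNIV (\<lambda>t::complex. q + t *s (q0 - q))"
    using has_derivative_continuous[OF has_derivative_vector_smult]
    by (intro continuous_at_imp_continuous_on ballI) blast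
  have "open A" unfolding A_def
    using S(1) cont by (simp add: open_vimage continuous_on_open_vimage)
  have "convex A"
  proof (rule convexI)
    fix x y :: complex and u v :: real assume *: "x \<in> A" "y \<in> A" "0 \<le> u" "0 \<le> v" "u + v = 1"
    have "q + (u *\<^sub>R x + v *\<^sub>R y) *s (q0 - q) = u *\<^sub>R (q + x *s (q0 - q)) + v *\<^sub>R (q + y *s (q0 - q))"
      (is "?L = ?R")
    proof -
      have "?R = (u + v) *\<^sub>R q + (u *\<^sub>R x + v *\<^sub>R y) *s (q0 - q)"
        by (simp add: vec_eq_iff scaleR_conv_of_real[where 'a = complex] algebra_simps)
      then show ?thesis using *(5) by simp
    qed
    then show "u *\<^sub>R x + v *\<^sub>R y \<in> A"
      using convexD[OF S(2), of "q + x *s (q0 - q)" "q + y *s (q0 - q)" u v] * by (simp add: A_def)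
  qed
  have hol: "(\<lambda>t. h (q + t *s (q0 - q))) holomorphic_on A"
    by (rule mholo_on_line[OF h]) (auto simp: A_def)
  have A01: "0 \<in> A" "1 \<in> A" using q by (auto simp: A_def)
  obtain r where r: "0 < r" "ball 0 r \<subseteq> A"
     "\<And>z. z \<in> ball 0 r - {0} \<Longrightarrow> h (q + z *s (q0 - q)) \<noteq> 0"
    using isolated_zeros[OF hol \<open>open A\<close> convex_connected[OF \<open>convex A\<close>] A01(1) _ A01(2)] True q(2)
    by auto
  \<comment> \<open>Small enough for the parameter to lie in the zero-free punctured disc and for
    the displacement \<open>d * norm (q0 - q)\<close> to stay below \<open>e\<close>; the summand 1
    keeps the denominator positive outright.\<close>
  define d where "d = min (r/2) (e / (2 * (1 + norm (q0 - q))))"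
  have npos: "1 + norm (q0 - q) > 0" using norm_ge_zero[of "q0 - q"] by linarith
  have d: "d > 0" "d < r" using r(1) q(4) npos by (auto simp: d_def)
  have "d * norm (q0 - q) \<le> d * (1 + norm (q0 - q))" using d by (simp add: algebra_simps)
  also have "\<dots> \<le> (e / (2 * (1 + norm (q0 - q)))) * (1 + norm (q0 - q))"
    using npos by (intro mult_right_mono) (auto simp: d_def)
  also have "\<dots> = e / 2" using npos by (simp add: field_simps)
  also have "\<dots> < e" using q(4) by simp
  finally have "d * norm (q0 - q) < e" .
  moreover have "norm (complex_of_real d) = d" using d by simp
  ultimately have "norm (complex_of_real d *s (q0 - q)) < e" by (simp only: norm_vector_smult)
  moreover have "dist q (q + v) = norm v" for v by (simp add: dist_norm)
  ultimately have "q + complex_of_real d *s (q0 - q) \<in> ball q e" by (simp only: mem_ball)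
  moreover have "of_real d \<in> ball 0 r - {0::complex}" using d by auto
  ultimately show ?thesis using r(2,3) A_def by blast
qed

lemma mholo_on_zero_on_convex:
  assumes h: "mholo_on h S" and S: "open S" "convex S" and q: "q \<in> S" "e > 0" "\<And>x. x \<in> ball q e \<Longrightarrow> h x = 0"
    and "p \<in> S"
  shows "h p = 0"
  using mholo_on_nonzero_dense[OF h S \<open>p \<in> S\<close> _ q(1,2)] q(3) by blast

text \<open>Cauchy's inequality on discs in the direction \<open>v\<close> turns uniform closeness
  of the functions into closeness of their derivatives, relative to \<open>norm v\<close>. The
  derivatives are then uniformly Cauchy on a smaller ball, \<open>has_derivative_sequence\<close>
  identifies their limit, and complex linearity survives the limit.\<close>

lemma mholo_on_uniform_limit:
  assumes S: "open S" and f: "\<And>n::nat. mholo_on (f n) S"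
    and lim: "\<And>p. p \<in> S \<Longrightarrow> \<exists>e>0. uniform_limit (ball p e) f g sequentially"
  shows "mholo_on g (S :: (complex ^ 'r::finite) set)"
  unfolding mholo_on_def
proof
  fix p assume p: "p \<in> S"
  obtain e1 where e1: "e1 > 0" "uniform_limit (ball p e1) f g sequentially" using lim[OF p] by blast
  obtain e2 where e2: "e2 > 0" "ball p e2 \<subseteq> S" using S p open_contains_ball by blast
  define e where "e = min e1 e2"
  have e: "e > 0" "ball p e \<subseteq> S" using e1 e2 by (auto simp: e_def)
  have ul: "uniform_limit (ball p e) f g sequentially"
    using e1(2) by (rule uniform_limit_on_subset) (auto simp: e_def)
  have "\<forall>n. \<forall>q\<in>S. \<exists>D. (f n has_derivative D) (at q) \<and> (\<forall>c v. D (c *s v) = c * D v)"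
    using f by (auto simp: mholo_on_def)
  then obtain D where D: "\<And>n q. q \<in> S \<Longrightarrow> (f n has_derivative D n q) (at q)"
      "\<And>n q c v. q \<in> S \<Longrightarrow> D n q (c *s v) = c * D n q v"
    by metis
  define B where "B = ball p (e/2)"
  have BS: "q \<in> S" if "q \<in> B" for q
    using that e by (auto simp: B_def subset_eq)
  have est: "norm (D n q v - D m q v) \<le> d * norm v"
    if q: "q \<in> B" and d: "d > 0" and nm: "\<And>x. x \<in> ball p e \<Longrightarrow> norm (f n x - f m x) \<le> d * (e/4)" for n m q v d
  proof (cases "v = 0")
    case True
    then show ?thesis using D(2)[OF BS[OF q], of n 0 v] D(2)[OF BS[OF q], of m 0 v] by simp
  next
    case False
    \<comment> \<open>Parameter radius for which the disc around \<open>q\<close>, which itself lies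
      within \<open>e/2\<close> of \<open>p\<close>, stays inside the ball of radius
      \<open>e\<close>.\<close>
    define r where "r = (e/4) / norm v"
    have r: "r > 0" using e False by (auto simp: r_def)
    define \<phi> where "\<phi> = (\<lambda>t. f n (q + t *s v) - f m (q + t *s v))"
    have sub: "q + t *s v \<in> ball p e" if "t \<in> cball 0 r" for t
    proof -
      have "norm (t *s v) \<le> r * norm v" using that by (simp add: norm_vector_smult mult_right_mono)
      also have "\<dots> = e/4" using False by (simp add: r_def)
      finally have "norm (t *s v) \<le> e/4" .
      moreover have "dist p q < e/2" using q by (simp add: B_def)
      moreover have "dist p (q + t *s v) \<le> dist p q + norm (t *s v)"
        using dist_triangle[of p "q + t *s v" q] by (simp add: dist_norm)
      ultimately show ?thesis using e by simp
    qed
    have hol: "\<phi> holomorphic_on cball 0 r"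
      unfolding \<phi>_def
      by (intro holomorphic_intros mholo_on_line[of _ S] f) (use sub e in blast)+
    have "((\<lambda>t. f k (q + t *s v)) has_field_derivative D k q v) (at 0)" for k
    proof -
      have "((\<lambda>t. f k (q + t *s v)) has_derivative (\<lambda>t. D k q (t *s v))) (at 0)"
        using has_derivative_compose[OF has_derivative_vector_smult[of q v 0], of "f k" "D k q"] D(1)[OF BS[OF q]] by simp
      then show ?thesis
        using D(2)[OF BS[OF q]] by (simp add: has_field_derivative_def mult.commute[of _ "D k q v"] mult_commute_abs)
    qed
    then have "deriv \<phi> 0 = D n q v - D m q v"
      unfolding \<phi>_def by (intro DERIV_imp_deriv derivative_intros)
    moreover have "norm ((deriv ^^ 1) \<phi> 0) \<le> fact 1 * (d * (e/4)) / r ^ 1"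
    proof (rule Cauchy_inequality)
      show "\<phi> holomorphic_on ball 0 r" using hol holomorphic_on_subset ball_subset_cball by blast
      show "continuous_on (cball 0 r) \<phi>" using hol holomorphic_on_imp_continuous_on by blast
      show "norm (\<phi> x) \<le> d * (e/4)" if "norm (0 - x) = r" for x
        using nm[OF sub[of x]] that by (simp add: \<phi>_def)
    qed (use r in auto)
    moreover have "(d * (e/4)) / r = d * norm v" using False e by (simp add: r_def)
    ultimately show ?thesis by simp
  qed
  have ev: "\<exists>N. \<forall>n\<ge>N. \<forall>m\<ge>N. \<forall>q\<in>B. \<forall>v. norm (D n q v - D m q v) \<le> d * norm v" if "d > 0" for d
  proof -
    have "d * (e/4) / 2 > 0" using that e by auto
    from uniform_limitD[OF ul this] obtain N where
      N: "\<And>n x. n \<ge> N \<Longrightarrow> x \<in> ball p e \<Longrightarrow> dist (f n x) (g x) < d * (e/4) / 2"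
      unfolding eventually_sequentially by blast
    have "norm (f n x - f m x) \<le> d * (e/4)" if "n \<ge> N" "m \<ge> N" "x \<in> ball p e" for n m x
      using N[OF that(1,3)] N[OF that(2,3)] dist_triangle2[of "f n x" "f m x" "g x"] by (simp add: dist_norm)
    then show ?thesis using est that by blast
  qed
  define g' where "g' = (\<lambda>q v. lim (\<lambda>n. D n q v))"
  have conv: "(\<lambda>n. D n q v) \<longlonglongrightarrow> g' q v" if q: "q \<in> B" for q v
  proof -
    have "Cauchy (\<lambda>n. D n q v)"
    proof (rule metric_CauchyI)
      fix d :: real assume d: "d > 0"
      have np: "1 + norm v > 0" using norm_ge_zero[of v] by linarith
      obtain N where N: "\<And>n m. n \<ge> N \<Longrightarrow> m \<ge> N \<Longrightarrow> norm (D n q v - D m q v) \<le> (d / (1 + norm v)) * norm v"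
        using ev[of "d / (1 + norm v)"] d np q by (meson divide_pos_pos)
      have "(d / (1 + norm v)) * norm v < d" using d np by (simp add: field_simps)
      then show "\<exists>M. \<forall>m\<ge>M. \<forall>n\<ge>M. dist (D m q v) (D n q v) < d"
        using N by (intro exI[of _ N]) (force simp: dist_norm)
    qed
    then show ?thesis
      by (simp add: g'_def Cauchy_convergent_iff convergent_LIMSEQ_iff)
  qed
  have pB: "p \<in> B" using e by (simp add: B_def)
  have "\<exists>G. \<forall>x\<in>B. (\<lambda>n. f n x) \<longlonglongrightarrow> G x \<and> (G has_derivative g' x) (at x within B)"
  proof (rule has_derivative_sequence[where f' = D])
    show "convex B" by (simp add: B_def)
    show "(f n has_derivative D n x) (at x within B)" if "x \<in> B" for n x
      using D(1)[OF BS[OF that]] has_derivative_at_withinI by blast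
    show "\<forall>\<^sub>F n in sequentially. \<forall>x\<in>B. \<forall>h. norm (D n x h - g' x h) \<le> d * norm h" if d: "d > 0" for d
    proof -
      obtain N where N: "\<And>n m q v. n \<ge> N \<Longrightarrow> m \<ge> N \<Longrightarrow> q \<in> B \<Longrightarrow> norm (D n q v - D m q v) \<le> d * norm v"
        using ev[OF d] by blast
      have "norm (D n q v - g' q v) \<le> d * norm v" if "n \<ge> N" "q \<in> B" for n q v
      proof (rule tendsto_upperbound)
        show "(\<lambda>m. norm (D n q v - D m q v)) \<longlonglongrightarrow> norm (D n q v - g' q v)"
          by (intro tendsto_intros conv that)
        show "\<forall>\<^sub>F m in sequentially. norm (D n q v - D m q v) \<le> d * norm v"
          unfolding eventually_sequentially using N that by blast
      qed auto
      then show ?thesis by (auto simp: eventually_sequentially)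
    qed
    show "p \<in> B" by fact
    show "(\<lambda>n. f n p) \<longlonglongrightarrow> g p"
      using tendsto_uniform_limitI[OF ul] e by simp
  qed
  then obtain G where G: "\<And>x. x \<in> B \<Longrightarrow> (\<lambda>n. f n x) \<longlonglongrightarrow> G x" "\<And>x. x \<in> B \<Longrightarrow> (G has_derivative g' x) (at x within B)"
    by blast
  have "G x = g x" if x: "x \<in> B" for x
  proof (rule LIMSEQ_unique[OF G(1)[OF x]])
    show "(\<lambda>n. f n x) \<longlonglongrightarrow> g x"
      using x e by (intro tendsto_uniform_limitI[OF ul]) (auto simp: B_def)
  qed
  moreover have "(G has_derivative g' p) (at p)"
    using G(2)[OF pB] at_within_open[OF pB] by (simp add: B_def)
  ultimately have "(g has_derivative g' p) (at p)"
    using has_derivative_transform_within_open[of G "g' p" p UNIV B g] pB by (simp add: B_def)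
  moreover have "g' p (c *s v) = c * g' p v" for c v
  proof (rule LIMSEQ_unique)
    show "(\<lambda>n. D n p (c *s v)) \<longlonglongrightarrow> g' p (c *s v)" by (rule conv[OF pB])
    show "(\<lambda>n. D n p (c *s v)) \<longlonglongrightarrow> c * g' p v"
      using tendsto_mult_left[OF conv[OF pB, of v], of c] D(2)[OF p] by simp
  qed
  ultimately show "mdiff_at g p" by blast
qed

section \<open>Meromorphic functions of several variables\<close>

abbreviation local_fraction ::
    "(complex ^ 'r \<Rightarrow> complex) \<Rightarrow> complex ^ 'r \<Rightarrow> real \<Rightarrow> (complex ^ 'r \<Rightarrow> complex) \<Rightarrow> (complex ^ 'r \<Rightarrow> complex) \<Rightarrow> bool" where
  "local_fraction f p e g h \<equiv> mholo_on g (ball p e) \<and> mholo_on h (ball p e) \<and>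
     (\<exists>q\<in>ball p e. h q \<noteq> 0) \<and> (\<forall>q\<in>ball p e. h q \<noteq> 0 \<longrightarrow> f q = g q / h q)"

text \<open>The relative version is needed because the continuation is built on an increasing family
  of domains before it becomes global.\<close>

definition mmero_on :: "(complex ^ 'r \<Rightarrow> complex) \<Rightarrow> (complex ^ 'r) set \<Rightarrow> bool" where
  "mmero_on f S \<longleftrightarrow>
     (\<forall>p\<in>S. \<exists>e>0. \<exists>g h. local_fraction f p e g h)"

text \<open>Equality suited to total functions whose values are free on a zero set. A holomorphic
  function that is not identically zero on a ball has a dense set of non-zeros there, which makes
  the relation transitive and stable under shrinking the ball.\<close>

definition thin_eq :: "(complex ^ 'r \<Rightarrow> complex) \<Rightarrow> (complex ^ 'r \<Rightarrow> complex) \<Rightarrow> complex ^ 'r \<Rightarrow> real \<Rightarrow> bool" where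
  "thin_eq f g p e \<longleftrightarrow> (\<exists>h. mholo_on h (ball p e) \<and> (\<exists>q\<in>ball p e. h q \<noteq> 0) \<and> (\<forall>q\<in>ball p e. h q \<noteq> 0 \<longrightarrow> f q = g q))"

definition nicely_on :: "(complex ^ 'r \<Rightarrow> complex) \<Rightarrow> (complex ^ 'r) set \<Rightarrow> bool" where
  "nicely_on f S \<longleftrightarrow> mmero_on f S \<and> (\<forall>p\<in>S. (\<exists>e>0. mholo_on f (ball p e)) \<or> (mpole f p \<and> f p = 0))"

lemma mmero_iff: "mmero f \<longleftrightarrow> mmero_on f UNIV"
  by (simp add: mmero_def mmero_on_def)

lemma nicely_mmero_iff: "nicely_mmero f \<longleftrightarrow> nicely_on f UNIV"
  by (simp add: nicely_mmero_def nicely_on_def mmero_iff)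

lemma mpole_iff: "mpole f p \<longleftrightarrow> \<not> (\<exists>e>0. \<exists>g. mholo_on g (ball p e) \<and> thin_eq f g p e)"
  unfolding mpole_def thin_eq_def by blast

lemma mholo_nonzero_shrink:
  assumes "mholo_on h (ball p e)" "\<exists>x\<in>ball p e. h x \<noteq> 0" "q \<in> ball p e" "d > 0"
  shows "\<exists>x\<in>ball p e \<inter> ball q d. h x \<noteq> 0"
  using mholo_on_nonzero_dense[OF assms(1) open_ball convex_ball _ _ assms(3,4)] assms(2) by blast

text \<open>Holomorphic functions on a ball form an integral domain: \<open>h\<close> stays nonzero
  near one of its non-zeros, and \<open>k\<close> has non-zeros arbitrarily close to that
  point.\<close>

lemma mholo_nonzero_mult:
  assumes "mholo_on h (ball p e)" "\<exists>q\<in>ball p e. h q \<noteq> 0" "mholo_on k (ball p e)" "\<exists>q\<in>ball p e. k q \<noteq> 0"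
  shows "\<exists>q\<in>ball p e. h q * k q \<noteq> 0"
proof -
  obtain q where q: "q \<in> ball p e" "h q \<noteq> 0" using assms by blast
  have "isCont h q" using assms(1) q mholo_on_imp_isCont by blast
  from continuous_at_avoid[OF this q(2)] obtain d where d: "d > 0" "\<And>y. dist q y < d \<Longrightarrow> h y \<noteq> 0"
    by auto
  obtain x where "x \<in> ball p e \<inter> ball q d" "k x \<noteq> 0"
    using mholo_nonzero_shrink[OF assms(3,4) q(1) d(1)] by blast
  then show ?thesis using d by (intro bexI[of _ x]) auto
qed

section \<open>Equality off thin sets and its invariants\<close>

lemma thin_eq_refl: "e > 0 \<Longrightarrow> (\<And>q. q \<in> ball p e \<Longrightarrow> f q = g q) \<Longrightarrow> thin_eq f g p e"
  unfolding thin_eq_def by (rule exI[of _ "\<lambda>_. 1"]) (auto simp: mholo_on_const intro!: exI[of _ p])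

lemma thin_eq_sym: "thin_eq f g p e \<Longrightarrow> thin_eq g f p e"
  unfolding thin_eq_def by metis

lemma thin_eq_trans:
  assumes "thin_eq f g p e" "thin_eq g h p e"
  shows "thin_eq f h p e"
proof -
  obtain a b where a: "mholo_on a (ball p e)" "\<exists>q\<in>ball p e. a q \<noteq> 0" "\<forall>q\<in>ball p e. a q \<noteq> 0 \<longrightarrow> f q = g q"
    and b: "mholo_on b (ball p e)" "\<exists>q\<in>ball p e. b q \<noteq> 0" "\<forall>q\<in>ball p e. b q \<noteq> 0 \<longrightarrow> g q = h q"
    using assms unfolding thin_eq_def by blast
  show ?thesis unfolding thin_eq_def
    by (rule exI[of _ "\<lambda>q. a q * b q"])
       (use mholo_nonzero_mult[OF a(1,2) b(1,2)] a b in \<open>auto intro: mholo_on_mult\<close>)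
qed

lemma thin_eq_subball:
  assumes "thin_eq f g p e" "ball q d \<subseteq> ball p e" "d > 0"
  shows "thin_eq f g q d"
proof -
  obtain a where a: "mholo_on a (ball p e)" "\<exists>q\<in>ball p e. a q \<noteq> 0" "\<forall>q\<in>ball p e. a q \<noteq> 0 \<longrightarrow> f q = g q"
    using assms unfolding thin_eq_def by blast
  have "q \<in> ball p e" using assms(2,3) centre_in_ball by blast
  from mholo_nonzero_shrink[OF a(1,2) this assms(3)] show ?thesis
    unfolding thin_eq_def using a assms mholo_on_subset[OF a(1) assms(2)]
    by (intro exI[of _ a]) blast
qed

lemma ball_subset_ball: "q \<in> ball p e \<Longrightarrow> \<exists>d>0. ball q d \<subseteq> ball p (e::real)" for p :: "'a::metric_space"
  using open_contains_ball[of "ball p e"] by auto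

text \<open>Continuity would spread a discrepancy at \<open>q\<close> over a whole ball, and every
  such ball meets the complement of the thin set.\<close>

lemma thin_eq_imp_eq:
  assumes "thin_eq f g p e" "isCont f q" "isCont g q" "q \<in> ball p e"
  shows "f q = g q"
proof (rule ccontr)
  assume "f q \<noteq> g q"
  then have "isCont (\<lambda>x. f x - g x) q" "f q - g q \<noteq> 0" using assms by (auto intro: continuous_intros)
  from continuous_at_avoid[OF this] obtain d where d: "d > 0" "\<And>y. dist q y < d \<Longrightarrow> f y - g y \<noteq> 0" by auto
  obtain a where a: "mholo_on a (ball p e)" "\<exists>q\<in>ball p e. a q \<noteq> 0" "\<forall>q\<in>ball p e. a q \<noteq> 0 \<longrightarrow> f q = g q"
    using assms unfolding thin_eq_def by blast
  from mholo_nonzero_shrink[OF a(1,2) assms(4) d(1)] obtain x where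
    "x \<in> ball p e" "x \<in> ball q d" "a x \<noteq> 0" by blast
  then show False using a(3) d(2)[of x] by auto
qed

text \<open>A holomorphic function that agrees with one of the two off a thin set also agrees with
  the other one, on the smaller of the two balls.\<close>

lemma mpole_cong: "thin_eq f g p e \<Longrightarrow> e > 0 \<Longrightarrow> mpole f p \<longleftrightarrow> mpole g p"
proof -
  have *: "mpole g p" if "thin_eq f g p e" "e > 0" "mpole f p" for f g
    unfolding mpole_iff
  proof safe
    fix d h assume d: "d > 0" "mholo_on h (ball p d)" "thin_eq g h p d"
    let ?r = "min d e"
    have "thin_eq f h p ?r"
      by (rule thin_eq_trans[where g = g]; rule thin_eq_subball) (use that d in auto)
    moreover have "mholo_on h (ball p ?r)" by (rule mholo_on_subset[OF d(2)]) auto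
    ultimately show False using that d(1) unfolding mpole_iff by (metis min_less_iff_conj)
  qed
  show "thin_eq f g p e \<Longrightarrow> e > 0 \<Longrightarrow> ?thesis" using *[of f g] *[of g f] thin_eq_sym by blast
qed

lemma mholo_imp_not_mpole: "mholo_on f (ball p e) \<Longrightarrow> e > 0 \<Longrightarrow> \<not> mpole f p"
  unfolding mpole_iff using thin_eq_refl by blast

lemma mmero_onE:
  assumes "mmero_on f S" "p \<in> S" "r > 0"
  obtains e g h where "e > 0" "e \<le> r" "mholo_on g (ball p e)" "mholo_on h (ball p e)"
     "\<exists>q\<in>ball p e. h q \<noteq> 0" "\<And>q. q \<in> ball p e \<Longrightarrow> h q \<noteq> 0 \<Longrightarrow> f q = g q / h q"
proof -
  obtain e g h where e: "e > 0" "mholo_on g (ball p e)" "mholo_on h (ball p e)"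
     "\<exists>q\<in>ball p e. h q \<noteq> 0" "\<And>q. q \<in> ball p e \<Longrightarrow> h q \<noteq> 0 \<Longrightarrow> f q = g q / h q"
    using assms unfolding mmero_on_def by blast
  let ?d = "min e r"
  have sub: "ball p ?d \<subseteq> ball p e" by auto
  have p: "p \<in> ball p e" "?d > 0" using e assms by auto
  show thesis
    by (rule that[of ?d g h])
       (use mholo_nonzero_shrink[OF e(3,4) p] e p mholo_on_subset[OF _ sub] in auto)
qed

section \<open>Sums, products, inverses and translates of meromorphic functions\<close>

lemma mmero_on_subset: "mmero_on f S \<Longrightarrow> T \<subseteq> S \<Longrightarrow> mmero_on f T"
  unfolding mmero_on_def by blast

lemma mholo_imp_mmero_on:
  assumes "mholo_on f S" "open S"
  shows "mmero_on f S"
  unfolding mmero_on_def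
proof
  fix p assume "p \<in> S"
  then obtain e where "e > 0" "ball p e \<subseteq> S" using assms(2) open_contains_ball by blast
  then show "\<exists>e>0. \<exists>g h. local_fraction f p e g h"
    using mholo_on_subset[OF assms(1)] mholo_on_const[of 1]
    by - (rule exI[of _ e], rule conjI, assumption, rule exI[of _ f], rule exI[of _ "\<lambda>_. 1"],
       auto intro!: exI[of _ p])
qed

text \<open>Serves sums, products and the identity theorem, which all compare two quotients over one
  common denominator.\<close>

lemma mmero_on_common_ball:
  assumes "mmero_on f S" "mmero_on g S" "p \<in> S" "r > 0"
  obtains e a b k h where "e > 0" "e \<le> r" "mholo_on a (ball p e)" "mholo_on b (ball p e)"
     "mholo_on k (ball p e)" "mholo_on h (ball p e)"
     "mholo_on (\<lambda>q. b q * h q) (ball p e)" "\<exists>q\<in>ball p e. b q * h q \<noteq> 0"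
     "\<forall>q\<in>ball p e. b q \<noteq> 0 \<longrightarrow> f q = a q / b q"
     "\<forall>q\<in>ball p e. h q \<noteq> 0 \<longrightarrow> g q = k q / h q"
proof -
  obtain d a b where 1: "d > 0" "d \<le> r" "mholo_on a (ball p d)" "mholo_on b (ball p d)"
     "\<exists>q\<in>ball p d. b q \<noteq> 0" "\<And>q. q \<in> ball p d \<Longrightarrow> b q \<noteq> 0 \<Longrightarrow> f q = a q / b q"
    using mmero_onE[OF assms(1,3,4)] by metis
  obtain e k h where 2: "e > 0" "e \<le> d" "mholo_on k (ball p e)" "mholo_on h (ball p e)"
     "\<exists>q\<in>ball p e. h q \<noteq> 0" "\<forall>q\<in>ball p e. h q \<noteq> 0 \<longrightarrow> g q = k q / h q"
    using mmero_onE[OF assms(2,3) 1(1)] by metis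
  have sub: "ball p e \<subseteq> ball p d" using 2 by auto
  have 3: "mholo_on a (ball p e)" "mholo_on b (ball p e)" using 1 mholo_on_subset[OF _ sub] by auto
  have "\<exists>q\<in>ball p e. b q \<noteq> 0" using mholo_nonzero_shrink[OF 1(4,5) _ 2(1), of p] 1(1) by auto
  from mholo_nonzero_mult[OF 3(2) this 2(4,5)] show thesis
    using that[of e a b k h] 1 2 3 sub mholo_on_mult[OF 3(2) 2(4)] by auto
qed

lemma mmero_on_add:
  assumes "mmero_on f S" "mmero_on g S"
  shows "mmero_on (\<lambda>q. f q + g q) S"
  unfolding mmero_on_def
proof
  fix p assume p: "p \<in> S"
  obtain e a b k h where
    *: "e > 0" "e \<le> 1" "mholo_on a (ball p e)" "mholo_on b (ball p e)" "mholo_on k (ball p e)" "mholo_on h (ball p e)"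
     "mholo_on (\<lambda>q. b q * h q) (ball p e)" "\<exists>q\<in>ball p e. b q * h q \<noteq> 0"
     "\<forall>q\<in>ball p e. b q \<noteq> 0 \<longrightarrow> f q = a q / b q"
     "\<forall>q\<in>ball p e. h q \<noteq> 0 \<longrightarrow> g q = k q / h q"
    by (rule mmero_on_common_ball[OF assms p zero_less_one])
  have "mholo_on (\<lambda>q. a q * h q + k q * b q) (ball p e)" by (intro mholo_on_add mholo_on_mult *)
  moreover have "\<forall>q\<in>ball p e. b q * h q \<noteq> 0 \<longrightarrow> f q + g q = (a q * h q + k q * b q) / (b q * h q)"
    using *(9,10) by (auto simp: add_divide_eq_iff field_simps)
  ultimately show "\<exists>e>0. \<exists>g' h. local_fraction (\<lambda>q. f q + g q) p e g' h"
    using *(1,7,8) by blast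
qed

lemma mmero_on_mult:
  assumes "mmero_on f S" "mmero_on g S"
  shows "mmero_on (\<lambda>q. f q * g q) S"
  unfolding mmero_on_def
proof
  fix p assume p: "p \<in> S"
  obtain e a b k h where
    *: "e > 0" "e \<le> 1" "mholo_on a (ball p e)" "mholo_on b (ball p e)" "mholo_on k (ball p e)" "mholo_on h (ball p e)"
     "mholo_on (\<lambda>q. b q * h q) (ball p e)" "\<exists>q\<in>ball p e. b q * h q \<noteq> 0"
     "\<forall>q\<in>ball p e. b q \<noteq> 0 \<longrightarrow> f q = a q / b q"
     "\<forall>q\<in>ball p e. h q \<noteq> 0 \<longrightarrow> g q = k q / h q"
    by (rule mmero_on_common_ball[OF assms p zero_less_one])
  have "\<forall>q\<in>ball p e. b q * h q \<noteq> 0 \<longrightarrow> f q * g q = (a q * k q) / (b q * h q)"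
    using *(9,10) by auto
  then show "\<exists>e>0. \<exists>g' h. local_fraction (\<lambda>q. f q * g q) p e g' h"
    using *(1,7,8) mholo_on_mult[OF *(3,5)] by blast
qed

lemma mmero_on_sum:
  "(\<And>i. i \<in> I \<Longrightarrow> mmero_on (f i) S) \<Longrightarrow> open S \<Longrightarrow> mmero_on (\<lambda>q. \<Sum>i\<in>I. f i q) S"
  by (induction I rule: infinite_finite_induct) (auto intro: mholo_imp_mmero_on mholo_on_const mmero_on_add)

lemma mmero_on_inverse:
  assumes "mholo_on h S" "open S" "\<And>p e. p \<in> S \<Longrightarrow> e > 0 \<Longrightarrow> \<exists>q\<in>ball p e. h q \<noteq> 0"
  shows "mmero_on (\<lambda>q. inverse (h q)) S"
  unfolding mmero_on_def
proof
  fix p assume p: "p \<in> S"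
  then obtain e where "e > 0" "ball p e \<subseteq> S" using assms(2) open_contains_ball by blast
  then show "\<exists>e>0. \<exists>g' k. local_fraction (\<lambda>q. inverse (h q)) p e g' k"
    using mholo_on_subset[OF assms(1)] mholo_on_const[of 1] assms(3)[OF p]
    by (intro exI[of _ e] conjI exI[of _ "\<lambda>_. 1"] exI[of _ h]) (auto simp: field_simps)
qed

lemma mmero_on_translate:
  assumes "mmero_on f S" "(\<lambda>q. q + a) ` T \<subseteq> S"
  shows "mmero_on (\<lambda>q. f (q + a)) T"
  unfolding mmero_on_def
proof
  fix p assume p: "p \<in> T"
  then have "p + a \<in> S" using assms by blast
  then obtain e g h where e: "e > 0" "mholo_on g (ball (p + a) e)" "mholo_on h (ball (p + a) e)"
     "\<exists>q\<in>ball (p + a) e. h q \<noteq> 0" "\<And>q. q \<in> ball (p + a) e \<Longrightarrow> h q \<noteq> 0 \<Longrightarrow> f q = g q / h q"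
    using assms(1) unfolding mmero_on_def by blast
  have im: "(\<lambda>q. q + a) ` ball p e \<subseteq> ball (p + a) e" by (auto simp: dist_norm)
  obtain q where q: "q \<in> ball (p + a) e" "h q \<noteq> 0" using e(4) by blast
  have q': "q - a \<in> ball p e" using q(1) by (auto simp: dist_norm algebra_simps)
  show "\<exists>e>0. \<exists>g h. local_fraction (\<lambda>q. f (q + a)) p e g h"
    using e(1) mholo_on_translate[OF e(2) im] mholo_on_translate[OF e(3) im] q q' im
    by (intro exI[of _ e] conjI exI[of _ "\<lambda>q. g (q + a)"] exI[of _ "\<lambda>q. h (q + a)"] bexI[of _ "q - a"])
       (auto intro!: e(5))
qed

text \<open>A connectedness argument: the points of local agreement form an open set
  \<open>A\<close>, and the other points form an open set \<open>B\<close> as well. The second fact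
  is the substantial one and comes from clearing denominators.\<close>

theorem mmero_on_identity:
  assumes f: "mmero_on f S" and g: "mmero_on g S" and S: "open S" "convex S"
    and p0: "p0 \<in> S" "e0 > 0" "\<And>q. q \<in> ball p0 e0 \<Longrightarrow> f q = g q" and p: "p \<in> S"
  shows "\<exists>e>0. thin_eq f g p e"
proof (rule ccontr)
  assume np: "\<not> ?thesis"
  define P where "P = (\<lambda>p. \<exists>e>0. thin_eq f g p e)"
  define A where "A = {p\<in>S. P p}"
  define B where "B = {p\<in>S. \<not> P p}"
  have oA: "open A"
    unfolding open_contains_ball
  proof
    fix x assume x: "x \<in> A"
    then obtain e where e: "e > 0" "thin_eq f g x e" by (auto simp: A_def P_def)
    have "x \<in> S" using x by (simp add: A_def)
    then obtain d where d: "d > 0" "ball x d \<subseteq> S" using S(1) open_contains_ball by blast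
    have "y \<in> A" if y: "y \<in> ball x (min d e)" for y
    proof -
      have "y \<in> ball x e" using y by auto
      then obtain r where "r > 0" "ball y r \<subseteq> ball x e" using ball_subset_ball by blast
      then have "P y" unfolding P_def using thin_eq_subball[OF e(2)] by blast
      then show ?thesis using y d by (auto simp: A_def)
    qed
    then show "\<exists>e>0. ball x e \<subseteq> A" using d e by (intro exI[of _ "min d e"]) auto
  qed
  have oB: "open B"
    unfolding open_contains_ball
  proof
    fix x assume x: "x \<in> B"
    then have xS: "x \<in> S" "\<not> P x" by (simp_all add: B_def)
    then obtain d where d: "d > 0" "ball x d \<subseteq> S" using S(1) open_contains_ball by blast
    obtain e a b k h where
      e: "e > 0" "e \<le> d" and ab: "mholo_on a (ball x e)" "mholo_on b (ball x e)" "mholo_on k (ball x e)" "mholo_on h (ball x e)"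
      and bh: "mholo_on (\<lambda>q. b q * h q) (ball x e)" "\<exists>q\<in>ball x e. b q * h q \<noteq> 0"
      and fg: "\<forall>q\<in>ball x e. b q \<noteq> 0 \<longrightarrow> f q = a q / b q"
        "\<forall>q\<in>ball x e. h q \<noteq> 0 \<longrightarrow> g q = k q / h q"
      by (rule mmero_on_common_ball[OF f g xS(1) d(1)])
    \<comment> \<open>The cross-multiplied difference of the two quotients is holomorphic on the
      whole ball around \<open>x\<close>. Agreement near a single \<open>y\<close> in this ball
      makes \<open>u\<close> vanish near \<open>y\<close>, hence on the entire ball, so that
      agreement would already hold at \<open>x\<close>.\<close>
    define u where "u = (\<lambda>q. a q * h q - k q * b q)"
    have u: "mholo_on u (ball x e)" unfolding u_def
      by (intro mholo_on_diff mholo_on_mult ab)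
    have "\<not> P y" if y: "y \<in> ball x e" for y
    proof
      assume "P y"
      then obtain r where r: "r > 0" "thin_eq f g y r" by (auto simp: P_def)
      obtain t where t: "t > 0" "ball y t \<subseteq> ball x e" using ball_subset_ball[OF y] by blast
      define m where "m = min r t"
      have m: "m > 0" "ball y m \<subseteq> ball x e" "ball y m \<subseteq> ball y r" using r t by (auto simp: m_def)
      have T: "thin_eq f g y m" using thin_eq_subball[OF r(2) m(3,1)] .
      have bhm: "mholo_on (\<lambda>q. b q * h q) (ball y m)" "\<exists>q\<in>ball y m. b q * h q \<noteq> 0"
        using mholo_on_subset[OF bh(1) m(2)] mholo_nonzero_shrink[OF bh y m(1)] by auto
      obtain w where w: "mholo_on w (ball y m)" "\<exists>q\<in>ball y m. w q \<noteq> 0" "\<forall>q\<in>ball y m. w q \<noteq> 0 \<longrightarrow> f q = g q"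
        using T unfolding thin_eq_def by blast
      have "thin_eq u (\<lambda>_. 0) y m"
        unfolding thin_eq_def
      proof (intro exI[of _ "\<lambda>q. w q * (b q * h q)"] conjI ballI impI)
        fix q assume q: "q \<in> ball y m" "w q * (b q * h q) \<noteq> 0"
        then have "a q / b q = k q / h q" using fg w(3) m(2) by force
        then show "u q = 0" using q(2) by (simp add: u_def field_simps)
      qed (use mholo_on_mult[OF w(1) bhm(1)] mholo_nonzero_mult[OF w(1,2) bhm] in auto)
      then have "u q = 0" if "q \<in> ball y m" for q
        using thin_eq_imp_eq[of u "\<lambda>_. 0" y m q] mholo_on_imp_isCont[OF u] that m(2) by auto
      then have u0: "u q = 0" if "q \<in> ball x e" for q
        using mholo_on_zero_on_convex[OF u open_ball convex_ball y m(1) _ that] by blast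
      have "thin_eq f g x e"
        unfolding thin_eq_def
      proof (intro exI[of _ "\<lambda>q. b q * h q"] conjI ballI impI bh)
        fix q assume q: "q \<in> ball x e" "b q * h q \<noteq> 0"
        then have "f q = a q / b q" "g q = k q / h q" using fg by auto
        moreover have "a q / b q = k q / h q"
          using u0[OF q(1)] q(2) by (auto simp: u_def frac_eq_eq)
        ultimately show "f q = g q" by simp
      qed
      then show False using xS(2) e(1) by (auto simp: P_def)
    qed
    moreover have "ball x e \<subseteq> S" using d e(2) by (auto simp: subset_eq)
    ultimately have "ball x e \<subseteq> B" by (auto simp: B_def)
    then show "\<exists>e>0. ball x e \<subseteq> B" using e(1) by blast
  qed
  have "p0 \<in> A" using p0 thin_eq_refl[of e0 p0 f g] by (auto simp: A_def P_def)
  moreover have "p \<in> B" using np p by (auto simp: B_def P_def)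
  ultimately show False
    using connectedD[OF convex_connected[OF S(2)] oA oB] p p0 by (auto simp: A_def B_def)
qed

text \<open>Whether \<open>p\<close> is a pole depends only on the class modulo
  \<open>thin_eq\<close>. At a pole both functions take the prescribed value 0; elsewhere both are
  continuous.\<close>

lemma nicely_on_unique:
  assumes f: "nicely_on f S" and g: "nicely_on g S" and p: "p \<in> S" and T: "\<exists>e>0. thin_eq f g p e"
  shows "f p = g p"
proof -
  obtain e where e: "e > 0" "thin_eq f g p e" using T by blast
  show ?thesis
  proof (cases "mpole f p")
    case True
    then have "mpole g p" using mpole_cong[OF e(2,1)] by simp
    then show ?thesis using True f g p mholo_imp_not_mpole unfolding nicely_on_def by metis
  next
    case False
    then have "\<not> mpole g p" using mpole_cong[OF e(2,1)] by simp
    then have "isCont f p" "isCont g p"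
      using False f g p mholo_on_imp_isCont centre_in_ball unfolding nicely_on_def by metis+
    then show ?thesis using thin_eq_imp_eq[OF e(2)] e(1) by simp
  qed
qed

lemma nicely_on_mono: "nicely_on f S \<Longrightarrow> T \<subseteq> S \<Longrightarrow> nicely_on f T"
  unfolding nicely_on_def using mmero_on_subset by blast

text \<open>Brings a meromorphic function into the normal form demanded by
  \<open>nicely_mmero\<close>. The choice is immaterial: two holomorphic functions that agree off a
  thin set agree at the centre.\<close>

definition nice_rep :: "(complex ^ 'r \<Rightarrow> complex) \<Rightarrow> complex ^ 'r \<Rightarrow> complex" where
  "nice_rep f p = (if mpole f p then 0 else
     (SOME c. \<exists>e>0. \<exists>g. mholo_on g (ball p e) \<and> thin_eq f g p e \<and> c = g p))"

lemma nice_rep_eq: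
  assumes "mholo_on g (ball p e)" "thin_eq f g p e" "q \<in> ball p e"
  shows "nice_rep f q = g q"
proof -
  obtain d where d: "d > 0" "ball q d \<subseteq> ball p e" using ball_subset_ball[OF assms(3)] by blast
  have 1: "mholo_on g (ball q d)" "thin_eq f g q d"
    using mholo_on_subset[OF assms(1) d(2)] thin_eq_subball[OF assms(2) d(2,1)] by auto
  then have np: "\<not> mpole f q" using d unfolding mpole_iff by blast
  have "\<exists>e>0. \<exists>g'. mholo_on g' (ball q e) \<and> thin_eq f g' q e \<and> nice_rep f q = g' q"
    using np someI[of "\<lambda>c. \<exists>e>0. \<exists>g. mholo_on g (ball q e) \<and> thin_eq f g q e \<and> c = g q" "g q"] 1 d(1)
    unfolding nice_rep_def by (simp, blast)
  then obtain r g' where r: "r > 0" "mholo_on g' (ball q r)" "thin_eq f g' q r" "nice_rep f q = g' q" by blast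
  have "thin_eq g g' q (min r d)"
    by (rule thin_eq_trans[OF thin_eq_sym]; rule thin_eq_subball) (use r 1 d in auto)
  moreover have "isCont g q" "isCont g' q"
    using mholo_on_imp_isCont 1(1) r(2) d(1) r(1) by (auto intro: mholo_on_imp_isCont centre_in_ball)
  ultimately have "g q = g' q" using thin_eq_imp_eq r(1) d(1) by (metis centre_in_ball min_less_iff_conj)
  then show ?thesis using r(4) by simp
qed

text \<open>Where the local denominator is nonzero, the quotient is itself a holomorphic
  representative; so passing to the normal form changes \<open>f\<close> only on a thin set.\<close>

lemma nice_rep_thin_eq:
  assumes "mmero_on f S" "p \<in> S"
  shows "\<exists>e>0. thin_eq (nice_rep f) f p e \<and>
    (\<exists>g h. local_fraction (\<lambda>q. nice_rep f q) p e g h)"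
proof -
  obtain e g h where e: "e > 0" "mholo_on g (ball p e)" "mholo_on h (ball p e)"
     "\<exists>q\<in>ball p e. h q \<noteq> 0" "\<And>q. q \<in> ball p e \<Longrightarrow> h q \<noteq> 0 \<Longrightarrow> f q = g q / h q"
    using assms unfolding mmero_on_def by blast
  have 1: "nice_rep f q = g q / h q" if q: "q \<in> ball p e" "h q \<noteq> 0" for q
  proof -
    have "isCont h q" using e(3) q mholo_on_imp_isCont by blast
    from continuous_at_avoid[OF this q(2)] obtain d where d: "d > 0" "\<And>y. dist q y < d \<Longrightarrow> h y \<noteq> 0"
      by auto
    obtain r where r: "r > 0" "ball q r \<subseteq> ball p e" using ball_subset_ball[OF q(1)] by blast
    let ?m = "min d r"
    have sub: "ball q ?m \<subseteq> ball p e" using r by auto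
    have "mholo_on (\<lambda>x. g x / h x) (ball q ?m)"
      using e mholo_on_subset[OF _ sub] d by (intro mholo_on_divide) auto
    moreover have "thin_eq f (\<lambda>x. g x / h x) q ?m"
      by (rule thin_eq_refl) (use d r sub e(5) in auto)
    ultimately show ?thesis using nice_rep_eq[of "\<lambda>x. g x / h x" q ?m f q] d r by auto
  qed
  then have "thin_eq (nice_rep f) f p e" unfolding thin_eq_def using e by metis
  then show ?thesis using 1 e by blast
qed

lemma nicely_on_nice_rep:
  assumes "mmero_on f S"
  shows "nicely_on (nice_rep f) S"
  unfolding nicely_on_def
proof (intro conjI ballI)
  show "mmero_on (nice_rep f) S"
    unfolding mmero_on_def using nice_rep_thin_eq[OF assms] by blast
  fix p assume p: "p \<in> S"
  show "(\<exists>e>0. mholo_on (nice_rep f) (ball p e)) \<or> mpole (nice_rep f) p \<and> nice_rep f p = 0"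
  proof (cases "mpole f p")
    case True
    then show ?thesis using nice_rep_thin_eq[OF assms p] mpole_cong by (metis nice_rep_def)
  next
    case False
    then obtain e g where e: "e > 0" "mholo_on g (ball p e)" "thin_eq f g p e" unfolding mpole_iff by blast
    have "mholo_on (nice_rep f) (ball p e)"
      by (rule mholo_on_transform[OF e(2)]) (use nice_rep_eq[OF e(2,3)] in auto)
    then show ?thesis using e by blast
  qed
qed

text \<open>Turns an explicit holomorphic formula, known only off a thin set, into the value of the
  normal form at the point itself.\<close>

lemma nicely_on_mholo_eq:
  assumes f: "nicely_on f S" and g: "mholo_on g (ball p e)" "e > 0" and p: "p \<in> S" and T: "thin_eq f g p d" "d > 0"
  shows "f p = g p" "\<not> mpole f p" "isCont f p"
proof -
  show np: "\<not> mpole f p" using mpole_cong[OF T] mholo_imp_not_mpole[OF g] by simp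
  then show c: "isCont f p"
    using f p mholo_on_imp_isCont centre_in_ball unfolding nicely_on_def by metis
  have "isCont g p" using g mholo_on_imp_isCont centre_in_ball by blast
  then show "f p = g p" using thin_eq_imp_eq[OF T(1) c] T(2) by simp
qed

section \<open>Continuation of Dirichlet series by the translation formula\<close>

lemma norm_nat_powr: "norm (of_nat n powr z :: complex) = real n powr Re z"
  by (subst norm_powr_real_powr) auto

lemma powr_between_le:
  fixes x y a :: real
  assumes "0 < x" "x \<le> y" "y \<le> 2 * x"
  shows "y powr a \<le> 2 powr \<bar>a\<bar> * x powr a"
proof (cases "a \<ge> 0")
  case True
  have "y powr a \<le> (2 * x) powr a" using True assms by (intro powr_mono2) auto
  then show ?thesis using True assms by (simp add: powr_mult)
next
  case False
  have "y powr a \<le> x powr a" using False assms by (intro powr_mono2') auto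
  moreover have "1 \<le> (2::real) powr \<bar>a\<bar>" by (intro ge_one_powr_ge_zero) auto
  ultimately show ?thesis using mult_right_mono[of 1 "2 powr \<bar>a\<bar>" "x powr a"] by simp
qed

text \<open>The Taylor remainder after order \<open>J\<close> for \<open>x powr (1 - s)\<close>
  between \<open>x = n\<close> and \<open>x = n + 1\<close>; the exponent drops by \<open>j\<close>
  because of the \<open>j\<close>-fold derivative.\<close>

definition powr_rem :: "nat \<Rightarrow> nat \<Rightarrow> complex \<Rightarrow> complex" where
  "powr_rem J n s = of_nat (Suc n) powr (1 - s) - (\<Sum>j\<le>J. ((1 - s) gchoose j) * of_nat n powr (1 - s - of_nat j))"

text \<open>The derivative of order \<open>J + 1\<close> of \<open>x powr (1 - s)\<close> is a
  product of \<open>J + 1\<close> linear factors times \<open>x powr (- s - J)\<close>, and Taylor's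
  theorem on the segment from \<open>n\<close> to \<open>n + 1\<close> asks only for a bound of it.
  Uniformity in \<open>s\<close> on discs is what local domination will use.\<close>

lemma powr_rem_bound:
  assumes "R \<ge> 0"
  shows "\<exists>C\<ge>0. \<forall>n s. n \<ge> 1 \<longrightarrow> norm s \<le> R \<longrightarrow> norm (powr_rem J n s) \<le> C * real n powr (- Re s - J)"
proof -
  \<comment> \<open>\<open>P\<close> bounds the product of the linear factors for
    \<open>norm s \<le> R\<close>; the power of 2 in \<open>C\<close> pays for replacing a point of
    the segment by \<open>n\<close>, since the two differ by a factor of at most 2.\<close>
  define P where "P = (\<Prod>i=0..<Suc J. 1 + R + real i)"
  define C where "C = P * 2 powr (R + J)"
  have P0: "P \<ge> 0" unfolding P_def by (intro prod_nonneg) (use assms in auto)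
  have "norm (powr_rem J n s) \<le> C * real n powr (- Re s - J)" if n: "n \<ge> 1" and s: "norm s \<le> R" for n s
  proof -
    define f where "f = (\<lambda>i x. (\<Prod>k=0..<i. 1 - s - of_nat k) * x powr (1 - s - of_nat i))"
    define S where "S = complex_of_real ` {real n..real n + 1}"
    have gch: "((1 - s) gchoose i) = (\<Prod>k=0..<i. 1 - s - of_nat k) / fact i" for i
      using gbinomial_mult_fact[of i "1 - s"] by (simp add: field_simps)
    have "convex S"
      unfolding S_def by (intro convex_linear_image bounded_linear.linear bounded_linear_of_real) auto
    moreover have "(f i has_field_derivative f (Suc i) x) (at x within S)" if "x \<in> S" for i x
    proof -
      have "x \<notin> \<real>\<^sub>\<le>\<^sub>0" using that n by (auto simp: S_def complex_nonpos_Reals_iff)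
      then have "((\<lambda>x. x powr (1 - s - of_nat i)) has_field_derivative
          (1 - s - of_nat i) * x powr (1 - s - of_nat i - 1)) (at x within S)"
        by (intro has_field_derivative_at_within[OF has_field_derivative_powr])
      from DERIV_cmult[OF this, of "\<Prod>k=0..<i. 1 - s - of_nat k"]
      show ?thesis unfolding f_def
        by (simp add: mult.assoc diff_diff_eq add.commute)
    qed
    moreover have "norm (f (Suc J) x) \<le> P * (2 powr (R + J) * real n powr (- Re s - J))" if x: "x \<in> S" for x
    proof -
      obtain r where r: "x = of_real r" "real n \<le> r" "r \<le> real n + 1" using x by (auto simp: S_def)
      have sR: "\<bar>Re s\<bar> \<le> R" using s abs_Re_le_cmod[of s] by linarith
      have "norm (x powr (1 - s - of_nat (Suc J))) = r powr (- Re s - J)"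
        using r by (simp add: norm_powr_real_powr)
      also have "\<dots> \<le> 2 powr \<bar>- Re s - J\<bar> * real n powr (- Re s - J)"
        using r n by (intro powr_between_le) auto
      also have "\<dots> \<le> 2 powr (R + J) * real n powr (- Re s - J)"
        using sR by (intro mult_right_mono powr_mono) auto
      finally have 1: "norm (x powr (1 - s - of_nat (Suc J))) \<le> 2 powr (R + J) * real n powr (- Re s - J)" .
      have "norm (\<Prod>k=0..<Suc J. 1 - s - of_nat k) \<le> P"
        unfolding P_def prod_norm[symmetric]
      proof (intro prod_mono conjI norm_ge_zero)
        fix i
        have "norm (1 - s - of_nat i) \<le> norm (1::complex) + norm s + norm (of_nat i :: complex)"
          using norm_triangle_ineq4[of "1 - s" "of_nat i"] norm_triangle_ineq4[of 1 s] by linarith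
        then show "norm (1 - s - of_nat i) \<le> 1 + R + real i" using s by simp
      qed
      then show ?thesis unfolding f_def norm_mult
        using 1 P0 by (intro mult_mono) auto
    qed
    moreover have "of_nat n \<in> S" "of_nat (Suc n) \<in> S"
      unfolding S_def by (rule image_eqI[of _ _ "real n"], auto) (rule image_eqI[of _ _ "real (Suc n)"], auto)
    ultimately have "cmod (f 0 (of_nat (Suc n)) - (\<Sum>i\<le>J. f i (of_nat n) * (of_nat (Suc n) - of_nat n) ^ i / fact i))
       \<le> P * (2 powr (R + J) * real n powr (- Re s - J)) * cmod (of_nat (Suc n) - of_nat n) ^ Suc J / fact J"
      by (intro complex_Taylor[where S = S]) blast+
    also have "\<dots> \<le> P * (2 powr (R + J) * real n powr (- Re s - J))"
    proof -
      have "x / fact J \<le> x" if "x \<ge> 0" for x :: real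
        using divide_left_mono[of 1 "fact J" x] that by (simp add: fact_ge_1)
      then show ?thesis using P0 by simp
    qed
    also have "f 0 (of_nat (Suc n)) - (\<Sum>i\<le>J. f i (of_nat n) * (of_nat (Suc n) - of_nat n) ^ i / fact i) = powr_rem J n s"
      unfolding powr_rem_def f_def gch by simp
    finally show ?thesis by (simp add: C_def mult.assoc)
  qed
  then show ?thesis using P0 by (intro exI[of _ C]) (auto simp: C_def)
qed

text \<open>The hypothesis of the Weierstrass M-test near each point; it yields both convergence and
  holomorphy of the sum.\<close>

definition locally_dominated :: "(nat \<Rightarrow> complex ^ 'r \<Rightarrow> complex) \<Rightarrow> (complex ^ 'r) set \<Rightarrow> bool" where
  "locally_dominated f S \<longleftrightarrow> (\<forall>p\<in>S. \<exists>e>0. \<exists>u. summable u \<and> (\<forall>n. \<forall>q\<in>ball p e. norm (f n q) \<le> u n))"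

lemma locally_dominated_summable: "locally_dominated f S \<Longrightarrow> p \<in> S \<Longrightarrow> summable (\<lambda>n. f n p)"
  unfolding locally_dominated_def by (meson summable_comparison_test' centre_in_ball)

lemma mholo_on_suminf:
  assumes "open S" "\<And>n. mholo_on (f n) S" "locally_dominated f S"
  shows "mholo_on (\<lambda>q. \<Sum>n. f n q) S"
proof (rule mholo_on_uniform_limit[where f = "\<lambda>n q. \<Sum>i<n. f i q"])
  fix p assume "p \<in> S"
  then obtain e u where "e > 0" "summable u" "\<And>n q. q \<in> ball p e \<Longrightarrow> norm (f n q) \<le> u n"
    using assms(3) unfolding locally_dominated_def by blast
  then show "\<exists>e>0. uniform_limit (ball p e) (\<lambda>n q. \<Sum>i<n. f i q) (\<lambda>q. \<Sum>n. f n q) sequentially"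
    using Weierstrass_m_test[of "ball p e" f u] by blast
qed (use assms in \<open>auto intro: mholo_on_sum\<close>)

lemma holomorphic_gbinomial: "(\<lambda>z::complex. z gchoose j) holomorphic_on A"
  unfolding gbinomial_prod_rev by (intro holomorphic_intros) auto

lemma holomorphic_powr_rem: "powr_rem J n holomorphic_on A"
proof -
  have "(\<lambda>s. (1 - s) gchoose j) holomorphic_on A" for j
    by (rule holomorphic_on_compose[of "\<lambda>s. 1 - s" A "\<lambda>z. z gchoose j", unfolded o_def])
       (intro holomorphic_intros holomorphic_gbinomial)+
  then show ?thesis
    unfolding powr_rem_def[abs_def] by (intro holomorphic_intros)
qed

text \<open>Coordinate 1 is the second variable. The coefficients are blind to it and the exponent
  \<open>v\<close> moves along with it, so translating the point by \<open>axis 1 j\<close>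
  multiplies the term of index \<open>n\<close> by \<open>n powr (- j)\<close>. The terms of the
  Taylor expansion thus become values of the same series at translated points.\<close>

locale dirichlet_family =
  fixes b :: "nat \<Rightarrow> complex ^ 2 \<Rightarrow> complex" and v :: "complex ^ 2 \<Rightarrow> complex" and S :: "(complex ^ 2) set"
  assumes open_S: "open S"
    and b_holo: "\<And>n. mholo_on (b n) UNIV"
    and v_holo: "mholo_on v UNIV"
    and b_shift: "\<And>n q c. b n (q + axis 1 c) = b n q"
    and v_shift: "\<And>q c. v (q + axis 1 c) = v q + c"
    and S_shift: "\<And>q x. q \<in> S \<Longrightarrow> x \<ge> 0 \<Longrightarrow> q + axis 1 (complex_of_real x) \<in> S"
    and dom: "locally_dominated (\<lambda>n q. b (Suc n) q * of_nat (Suc n) powr (- v q)) S"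
begin

definition dser :: "complex ^ 2 \<Rightarrow> complex" where
  "dser q = (\<Sum>n. b (Suc n) q * of_nat (Suc n) powr (- v q))"

text \<open>The domain reached after \<open>K\<close> continuation steps.\<close>

definition shifted :: "nat \<Rightarrow> (complex ^ 2) set" where
  "shifted K = {q. q + axis 1 (of_nat K) \<in> S}"

definition rem_ser :: "nat \<Rightarrow> complex ^ 2 \<Rightarrow> complex" where
  "rem_ser J q = (\<Sum>n. b (Suc n) q * powr_rem J (Suc n) (v q))"

definition abel_ser :: "complex ^ 2 \<Rightarrow> complex" where
  "abel_ser q = (\<Sum>n. b (Suc n) q * (of_nat (Suc n) powr (1 - v q) - of_nat (Suc (Suc n)) powr (1 - v q)))"

lemma open_shifted: "open (shifted K)"
proof -
  have "shifted K = (\<lambda>q. q + axis 1 (of_nat K)) -` S" by (auto simp: shifted_def)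
  then show ?thesis by (simp add: open_S continuous_open_vimage continuous_intros open_vimage)
qed

lemma axis_0: "axis 1 0 = (0 :: complex ^ 2)"
  by (simp add: vec_eq_iff axis_def)

lemma shifted_0: "shifted 0 = S"
proof -
  have "q + axis 1 (of_nat 0) = q" for q :: "complex ^ 2" by (simp only: of_nat_0 axis_0 add_0_right)
  then show ?thesis by (simp only: shifted_def Collect_mem_eq)
qed

lemma axis_add: "q + axis 1 a + axis 1 c = q + axis 1 (a + c)" for q :: "complex ^ 2"
  by (simp add: vec_eq_iff axis_def)

lemma shifted_add:
  assumes "q \<in> shifted K" "x \<ge> 0" "real K \<le> real L + x"
  shows "q + axis 1 (complex_of_real x) \<in> shifted L"
proof -
  have "q + axis 1 (of_nat K) + axis 1 (complex_of_real (real L + x - real K)) \<in> S"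
    using assms by (intro S_shift) (auto simp: shifted_def)
  then show ?thesis by (simp add: shifted_def axis_add add.commute[of "complex_of_real x"])
qed

lemma S_subset_shifted: "S \<subseteq> shifted K"
  using S_shift[of _ "real K"] by (auto simp: shifted_def)

lemma term_holo: "mholo_on (\<lambda>q. b n q * of_nat n powr (- v q)) A"
proof -
  have "mholo_on (\<lambda>q. of_nat n powr (- v q)) UNIV"
    by (rule mholo_on_compose_holomorphic[of "\<lambda>z. of_nat n powr (- z)" UNIV]) (auto intro!: holomorphic_intros v_holo)
  then show ?thesis using mholo_on_mult[OF b_holo] mholo_on_subset by blast
qed

lemma rem_term_holo: "mholo_on (\<lambda>q. b n q * powr_rem J n (v q)) A"
proof -
  have "mholo_on (\<lambda>q. powr_rem J n (v q)) UNIV"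
    by (rule mholo_on_compose_holomorphic[OF holomorphic_powr_rem open_UNIV v_holo]) auto
  then show ?thesis using mholo_on_mult[OF b_holo] mholo_on_subset by blast
qed

lemma dser_holo: "mholo_on dser S"
  unfolding dser_def[abs_def] by (rule mholo_on_suminf[OF open_S term_holo dom])

text \<open>The remainder of order \<open>K\<close> is bounded by a constant times
  \<open>n powr (- Re (v q) - K)\<close>, so the series is dominated by the original one at the
  point translated by \<open>K\<close>, which lies in \<open>S\<close>.\<close>

lemma rem_dom: "locally_dominated (\<lambda>n q. b (Suc n) q * powr_rem K (Suc n) (v q)) (shifted K)"
  unfolding locally_dominated_def
proof
  fix p assume p: "p \<in> shifted K"
  define a :: "complex ^ 2" where "a = axis 1 (of_nat K)"
  have "p + a \<in> S" using p by (simp add: shifted_def a_def)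
  then obtain e u where e: "e > 0" "summable u"
    "\<And>n q. q \<in> ball (p + a) e \<Longrightarrow> norm (b (Suc n) q * of_nat (Suc n) powr (- v q)) \<le> u n"
    using dom unfolding locally_dominated_def by blast
  \<comment> \<open>Continuity keeps \<open>norm (v q)\<close> bounded near \<open>p\<close>, which
    makes the constant of \<open>powr_rem_bound\<close> uniform there.\<close>
  have "isCont v p" using v_holo mholo_on_imp_isCont by blast
  then obtain d where d: "d > 0" "\<And>q. dist q p < d \<Longrightarrow> dist (v q) (v p) < 1"
    unfolding continuous_at_eps_delta by (metis zero_less_one)
  obtain C where C: "C \<ge> 0" "\<And>n s. n \<ge> 1 \<Longrightarrow> norm s \<le> norm (v p) + 1 \<Longrightarrow> norm (powr_rem K n s) \<le> C * real n powr (- Re s - K)"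
    using powr_rem_bound[of "norm (v p) + 1" K] by auto
  have "norm (b (Suc n) q * powr_rem K (Suc n) (v q)) \<le> C * u n" if q: "q \<in> ball p (min d e)" for n q
  proof -
    have "norm (v q) \<le> norm (v p) + 1"
      using d(2)[of q] q norm_triangle_ineq2[of "v q" "v p"] by (simp add: dist_norm norm_minus_commute)
    then have "norm (b (Suc n) q * powr_rem K (Suc n) (v q)) \<le> norm (b (Suc n) q) * (C * real (Suc n) powr (- Re (v q) - K))"
      unfolding norm_mult by (intro mult_left_mono C(2)) auto
    also have "\<dots> = C * norm (b (Suc n) (q + a) * of_nat (Suc n) powr (- v (q + a)))"
      by (simp add: a_def b_shift v_shift norm_mult norm_nat_powr del: of_nat_Suc)
    also have "\<dots> \<le> C * u n"
      using q by (intro mult_left_mono C(1) e(3)) (auto simp: dist_norm)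
    finally show ?thesis .
  qed
  then show "\<exists>e>0. \<exists>u. summable u \<and> (\<forall>n. \<forall>q\<in>ball p e. norm (b (Suc n) q * powr_rem K (Suc n) (v q)) \<le> u n)"
    using d e by (intro exI[of _ "min d e"] conjI exI[of _ "\<lambda>n. C * u n"]) (auto intro: summable_mult)
qed

lemma rem_ser_holo: "mholo_on (rem_ser K) (shifted K)"
  unfolding rem_ser_def[abs_def] by (rule mholo_on_suminf[OF open_shifted rem_term_holo rem_dom])

text \<open>In the Taylor identity multiplied by \<open>b n\<close>, the term \<open>j = 0\<close>
  joins \<open>(n + 1) powr (1 - v q)\<close> to form the Abel difference, \<open>j = 1\<close>
  gives \<open>(1 - v q) * n powr (- v q)\<close>, and each further \<open>j\<close> gives a term of
  the series translated by \<open>j - 1\<close>.\<close>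

lemma functional_equation:
  assumes q: "q \<in> S" and J: "J \<ge> 1"
  shows "(v q - 1) * dser q = abel_ser q
           + (\<Sum>j=2..J. ((1 - v q) gchoose j) * dser (q + axis 1 (of_nat (j - 1)))) + rem_ser J q"
proof -
  let ?N = "\<lambda>n. of_nat (Suc n) :: complex"
  have eq: "b (Suc n) q * (?N n powr (1 - v q) - of_nat (Suc (Suc n)) powr (1 - v q)) =
     (v q - 1) * (b (Suc n) q * ?N n powr (- v q))
      - (\<Sum>j=2..J. ((1 - v q) gchoose j) * (b (Suc n) (q + axis 1 (of_nat (j - 1))) * ?N n powr (- v (q + axis 1 (of_nat (j - 1))))))
      - b (Suc n) q * powr_rem J (Suc n) (v q)" for n
  proof -
    have "{..J} = insert 0 (insert 1 {2..J})" using J by auto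
    then have A: "(\<Sum>j\<le>J. ((1 - v q) gchoose j) * ?N n powr (1 - v q - of_nat j)) =
       ?N n powr (1 - v q) + (1 - v q) * ?N n powr (- v q) + (\<Sum>j=2..J. ((1 - v q) gchoose j) * ?N n powr (1 - v q - of_nat j))"
      by simp
    have B: "(\<Sum>j=2..J. ((1 - v q) gchoose j) * (b (Suc n) (q + axis 1 (of_nat (j - 1))) * ?N n powr (- v (q + axis 1 (of_nat (j - 1)))))) =
       b (Suc n) q * (\<Sum>j=2..J. ((1 - v q) gchoose j) * ?N n powr (1 - v q - of_nat j))"
      unfolding sum_distrib_left
    proof (intro sum.cong refl)
      fix j assume "j \<in> {2..J}"
      then have "- v (q + axis 1 (of_nat (j - 1))) = 1 - v q - of_nat j" by (simp add: v_shift of_nat_diff)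
      then show "((1 - v q) gchoose j) * (b (Suc n) (q + axis 1 (of_nat (j - 1))) * ?N n powr (- v (q + axis 1 (of_nat (j - 1))))) =
         b (Suc n) q * (((1 - v q) gchoose j) * ?N n powr (1 - v q - of_nat j))"
        by (simp only: b_shift) simp
    qed
    show ?thesis unfolding powr_rem_def A B by (simp add: ring_distribs)
  qed
  have sm: "summable (\<lambda>n. b (Suc n) q' * ?N n powr (- v q'))" if "q' \<in> S" for q'
    using locally_dominated_summable[OF dom that] .
  have sd: "(\<lambda>n. b (Suc n) q' * ?N n powr (- v q')) sums dser q'" if "q' \<in> S" for q'
    unfolding dser_def using sm[OF that] by (rule summable_sums)
  have qs: "q + axis 1 (of_nat (j - 1)) \<in> S" for j using S_shift[OF q, of "real (j - 1)"] by simp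
  have "summable (\<lambda>n. b (Suc n) q * powr_rem J (Suc n) (v q))"
    using locally_dominated_summable[OF rem_dom] q S_subset_shifted by blast
  then have sr: "(\<lambda>n. b (Suc n) q * powr_rem J (Suc n) (v q)) sums rem_ser J q"
    unfolding rem_ser_def by (rule summable_sums)
  have "(\<lambda>n. b (Suc n) q * (?N n powr (1 - v q) - of_nat (Suc (Suc n)) powr (1 - v q))) sums
     ((v q - 1) * dser q - (\<Sum>j=2..J. ((1 - v q) gchoose j) * dser (q + axis 1 (of_nat (j - 1)))) - rem_ser J q)"
    unfolding eq by (intro sums_diff sums_mult sums_sum sd sr qs q)
  then show ?thesis unfolding abel_ser_def by (simp add: sums_iff algebra_simps)
qed

lemma mmero_inverse_v: "mmero_on (\<lambda>q. inverse (v q - 1)) UNIV"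
proof (rule mmero_on_inverse)
  fix p :: "complex ^ 2" and e :: real assume e: "e > 0"
  show "\<exists>q\<in>ball p e. v q - 1 \<noteq> 0"
  proof (cases "v p = 1")
    case True
    have "norm (axis 1 (complex_of_real (e/2)) :: complex ^ 2) < e" using e
      by (simp add: norm_vec_def L2_set_def sum_2 axis_def)
    then show ?thesis using True e
      by (intro bexI[of _ "p + axis 1 (complex_of_real (e/2))"]) (auto simp: v_shift dist_norm)
  qed (use e in auto)
qed (auto intro!: mholo_on_diff v_holo mholo_on_const)

text \<open>Solving the functional equation for \<open>dser\<close> gains one unit per step. With
  order \<open>Suc K\<close> every term on the right is available on \<open>shifted (Suc K)\<close>:
  translation by \<open>j - 1 \<ge> 1\<close> leads back into \<open>shifted K\<close>, and the
  remainder series is holomorphic there. The Abel series is the one ingredient specific to the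
  family and enters as a hypothesis.\<close>

theorem dser_continuation:
  assumes a: "\<And>K. \<exists>a. mmero_on a (shifted K) \<and> (\<forall>q\<in>S. a q = abel_ser q)"
    and v1: "\<And>q. q \<in> S \<Longrightarrow> v q \<noteq> 1"
  shows "\<exists>F. mmero_on F (shifted K) \<and> (\<forall>q\<in>S. F q = dser q)"
proof (induction K)
  case 0
  show ?case using mholo_imp_mmero_on[OF dser_holo open_S] by (auto simp: shifted_0)
next
  case (Suc K)
  then obtain F where F: "mmero_on F (shifted K)" "\<And>q. q \<in> S \<Longrightarrow> F q = dser q" by blast
  obtain a where a: "mmero_on a (shifted (Suc K))" "\<And>q. q \<in> S \<Longrightarrow> a q = abel_ser q" using a by blast
  define G where "G = (\<lambda>q. (a q + (\<Sum>j=2..Suc K. ((1 - v q) gchoose j) * F (q + axis 1 (of_nat (j - 1)))) + rem_ser (Suc K) q)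
     * inverse (v q - 1))"
  have "mholo_on (\<lambda>q. (1 - v q) gchoose j) UNIV" for j
    by (rule mholo_on_compose_holomorphic[OF holomorphic_gbinomial, of UNIV "\<lambda>q. 1 - v q"])
       (auto intro!: mholo_on_diff v_holo mholo_on_const)
  then have m1: "mmero_on (\<lambda>q. (1 - v q) gchoose j) (shifted (Suc K))" for j
    using mholo_imp_mmero_on mholo_on_subset open_shifted by (metis subset_UNIV)
  have m2: "mmero_on (\<lambda>q. F (q + axis 1 (of_nat (j - 1)))) (shifted (Suc K))" if "j \<in> {2..Suc K}" for j
    by (rule mmero_on_translate[OF F(1)])
       (use shifted_add[of _ "Suc K" "real (j - 1)" K] that in \<open>force simp: of_nat_diff\<close>)
  have "mmero_on G (shifted (Suc K))"
    unfolding G_def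
    by (intro mmero_on_mult mmero_on_add a(1) mmero_on_sum m1 m2 open_shifted
          mholo_imp_mmero_on rem_ser_holo mmero_on_subset[OF mmero_inverse_v]) auto
  moreover have "G q = dser q" if q: "q \<in> S" for q
  proof -
    have "F (q + axis 1 (of_nat (j - 1))) = dser (q + axis 1 (of_nat (j - 1)))" for j
      using S_shift[OF q, of "real (j - 1)"] by (intro F(2)) simp
    then have "G q = (v q - 1) * dser q * inverse (v q - 1)"
      using functional_equation[OF q, of "Suc K"] a(2)[OF q] by (simp only: G_def)
    then show ?thesis using v1[OF q] by simp
  qed
  ultimately show ?case by blast
qed

end

section \<open>Multiple zeta series as iterated sums\<close>

lemma H_Suc: "H w (Suc N) = H w N + of_nat (Suc N) powr (- w)"
  by (simp add: H_def powr_minus_divide)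

lemma H_eq: "H w N = (\<Sum>m=1..N. of_nat m powr (- w))"
  by (simp add: H_def powr_minus_divide)

definition hsum :: "real \<Rightarrow> nat \<Rightarrow> real" where
  "hsum a N = (\<Sum>m=1..N. real m powr (- a))"

lemma hsum_nonneg: "hsum a N \<ge> 0"
  unfolding hsum_def by (intro sum_nonneg) auto

lemma norm_H_le: "norm (H w N) \<le> hsum (Re w) N"
  unfolding H_eq hsum_def by (rule order_trans[OF norm_sum]) (simp add: norm_nat_powr)

lemma hsum_antimono: "a \<le> b \<Longrightarrow> hsum b N \<le> hsum a N"
  unfolding hsum_def by (intro sum_mono powr_mono) auto

lemma hsum_mono: "M \<le> N \<Longrightarrow> hsum a M \<le> hsum a N"
  unfolding hsum_def by (intro sum_mono2) auto

text \<open>Split \<open>m powr (- a)\<close> into \<open>m powr (- (a + \<beta>))\<close>, which is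
  summable, and \<open>m powr \<beta>\<close>, which is at most \<open>N powr \<beta>\<close>.
  Allowing every \<open>\<beta> \<ge> 0\<close> above \<open>1 - a\<close> treats
  \<open>a < 1\<close>, \<open>a = 1\<close> and \<open>a > 1\<close> together, without
  logarithms.\<close>

lemma hsum_bound:
  assumes "\<beta> \<ge> 0" "a + \<beta> > 1"
  shows "\<exists>C\<ge>0. \<forall>N. hsum a N \<le> C * real N powr \<beta>"
proof -
  define C where "C = (\<Sum>m. real m powr (- (a + \<beta>)))"
  have sm: "summable (\<lambda>m. real m powr (- (a + \<beta>)))" using assms by (simp add: summable_real_powr_iff)
  have "hsum a N \<le> C * real N powr \<beta>" for N
  proof -
    have "hsum a N \<le> (\<Sum>m=1..N. real m powr (- (a + \<beta>)) * real N powr \<beta>)"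
      unfolding hsum_def
    proof (intro sum_mono)
      fix m assume m: "m \<in> {1..N}"
      have "real m powr (- a) = real m powr (- (a + \<beta>)) * real m powr \<beta>"
        using m by (simp flip: powr_add)
      also have "\<dots> \<le> real m powr (- (a + \<beta>)) * real N powr \<beta>"
        using m assms by (intro mult_left_mono powr_mono2) auto
      finally show "real m powr (- a) \<le> real m powr (- (a + \<beta>)) * real N powr \<beta>" .
    qed
    also have "\<dots> = (\<Sum>m=1..N. real m powr (- (a + \<beta>))) * real N powr \<beta>"
      by (simp add: sum_distrib_right)
    also have "\<dots> \<le> C * real N powr \<beta>"
      unfolding C_def by (intro mult_right_mono sum_le_suminf sm) auto
    finally show ?thesis .
  qed
  moreover have "C \<ge> 0" unfolding C_def by (intro suminf_nonneg sm) auto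
  ultimately show ?thesis by blast
qed

lemma summable_Suc_powr: "summable (\<lambda>n. real (Suc n) powr a) \<longleftrightarrow> a < - 1"
  using summable_Suc_iff[of "\<lambda>n. real n powr a"] summable_real_powr_iff[of a] by simp

text \<open>The power \<open>k = 1\<close> serves the double series, \<open>k = 2\<close> the series
  of squares.\<close>

lemma hsum_power_summable:
  assumes "\<beta> \<ge> 0" "a + \<beta> > 1" "real k * \<beta> - r < - 1"
  shows "summable (\<lambda>n. hsum a (Suc n) ^ k * real (Suc n) powr (- r))"
proof -
  obtain C where C: "C \<ge> 0" "\<And>N. hsum a N \<le> C * real N powr \<beta>"
    using hsum_bound[OF assms(1,2)] by auto
  show ?thesis
  proof (rule summable_comparison_test')
    show "summable (\<lambda>n. C ^ k * real (Suc n) powr (real k * \<beta> - r))"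
      using assms(3) by (intro summable_mult) (simp add: summable_Suc_powr del: of_nat_Suc)
    fix n :: nat
    have "hsum a (Suc n) ^ k \<le> (C * real (Suc n) powr \<beta>) ^ k"
      by (intro power_mono C hsum_nonneg)
    also have "\<dots> = C ^ k * real (Suc n) powr (real k * \<beta>)"
      by (simp add: power_mult_distrib powr_power mult.commute del: of_nat_Suc)
    finally have "hsum a (Suc n) ^ k * real (Suc n) powr (- r) \<le> C ^ k * real (Suc n) powr (real k * \<beta>) * real (Suc n) powr (- r)"
      by (rule mult_right_mono) simp
    also have "\<dots> = C ^ k * real (Suc n) powr (real k * \<beta> - r)"
      by (simp add: mult.assoc flip: powr_add)
    finally show "norm (hsum a (Suc n) ^ k * real (Suc n) powr (- r)) \<le> C ^ k * real (Suc n) powr (real k * \<beta> - r)"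
      using hsum_nonneg[of a "Suc n"] by (simp del: of_nat_Suc)
  qed
qed

section \<open>Unordered sums over pairs with finite fibres as ordinary series\<close>

lemma bij_betw_Suc_atLeast1: "bij_betw Suc UNIV {1..}"
  by (rule bij_betwI[where g = "\<lambda>n. n - 1"]) auto

lemma summable_on_atLeast1_iff:
  assumes "\<And>n. g n \<ge> (0::real)"
  shows "g summable_on {1..} \<longleftrightarrow> summable (\<lambda>n. g (Suc n))"
  using summable_on_reindex_bij_betw[OF bij_betw_Suc_atLeast1, of g]
    summable_on_UNIV_nonneg_real_iff[of "\<lambda>n. g (Suc n)"] assms by simp

lemma abs_summable_on_Sigma_nat_iff:
  fixes f :: "nat \<times> 'a \<Rightarrow> complex"
  assumes "\<And>n. finite (B n)"
  shows "(\<lambda>x. norm (f x)) summable_on Sigma {1..} B \<longleftrightarrow> summable (\<lambda>n. \<Sum>x\<in>B (Suc n). norm (f (Suc n, x)))"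
  using Infinite_Sum.abs_summable_on_Sigma_iff[of f "{1..}" B] assms
  by (simp add: summable_on_finite summable_on_atLeast1_iff sum_nonneg del: One_nat_def)

lemma infsum_Sigma_nat:
  fixes f :: "nat \<times> 'a \<Rightarrow> complex"
  assumes fin: "\<And>n. finite (B n)" and abs: "(\<lambda>x. norm (f x)) summable_on Sigma {1..} B"
  shows "infsum f (Sigma {1..} B) = (\<Sum>n. \<Sum>x\<in>B (Suc n). f (Suc n, x))"
    "infsum f (Sigma {1..} B) = infsum (\<lambda>n. \<Sum>x\<in>B n. f (n, x)) {1..}"
    "(\<lambda>n. norm (\<Sum>x\<in>B n. f (n, x))) summable_on {1..}"
proof -
  have sm: "summable (\<lambda>n. \<Sum>x\<in>B (Suc n). norm (f (Suc n, x)))"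
    using abs abs_summable_on_Sigma_nat_iff[of B f, OF fin] by blast
  have sm': "summable (\<lambda>n. norm (\<Sum>x\<in>B (Suc n). f (Suc n, x)))"
    by (rule summable_comparison_test'[OF sm]) (simp add: norm_sum)
  show 1: "infsum f (Sigma {1..} B) = infsum (\<lambda>n. \<Sum>x\<in>B n. f (n, x)) {1..}"
    using infsum_Sigma_banach[OF abs_summable_summable[OF abs]] fin by simp
  show "(\<lambda>n. norm (\<Sum>x\<in>B n. f (n, x))) summable_on {1..}"
    using sm' by (simp add: summable_on_atLeast1_iff del: One_nat_def)
  have "infsum (\<lambda>n. \<Sum>x\<in>B n. f (n, x)) {1..} = infsum (\<lambda>n. \<Sum>x\<in>B (Suc n). f (Suc n, x)) UNIV"
    using infsum_reindex_bij_betw[OF bij_betw_Suc_atLeast1, of "\<lambda>n. \<Sum>x\<in>B n. f (n, x)"] by simp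
  also have "\<dots> = (\<Sum>n. \<Sum>x\<in>B (Suc n). f (Suc n, x))"
    using norm_summable_imp_has_sum[OF sm' summable_sums[OF summable_norm_cancel[OF sm']]] by (rule infsumI)
  finally show "infsum f (Sigma {1..} B) = (\<Sum>n. \<Sum>x\<in>B (Suc n). f (Suc n, x))" using 1 by simp
qed

section \<open>Index tuples of depth two and three\<close>

lemma exhaust_bit2: "(i::2) = 0 \<or> i = 1"
  using exhaust_2[of i] by auto

lemma exhaust_bit3: "(i::3) = 0 \<or> i = 1 \<or> i = 2"
  using exhaust_3[of i] by auto

lemma less_2_iff: "(i::2) < j \<longleftrightarrow> i = 0 \<and> j = 1"
proof -
  have "(0::2) < 1" by (simp add: less_bit0_def bit0.Rep_0 bit0.Rep_1)
  with less_asym[OF this] show ?thesis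
    using exhaust_bit2[of i] exhaust_bit2[of j] by (elim disjE) simp_all
qed

lemma less_3_iff: "(i::3) < j \<longleftrightarrow> (i = 0 \<and> j = 1) \<or> (i = 0 \<and> j = 2) \<or> (i = 1 \<and> j = 2)"
proof -
  have "(0::3) < 1" "(1::3) < 2" "(0::3) < 2"
    by (simp_all add: less_bit1_def bit1.Rep_0 bit1.Rep_1 bit1.Rep_numeral)
  with this[THEN less_asym] show ?thesis
    using exhaust_bit3[of i] exhaust_bit3[of j] by (elim disjE) simp_all
qed

text \<open>The largest index comes first, so that the index set is a \<open>Sigma\<close> over it
  with finite fibres.\<close>

definition idx2 :: "nat \<times> nat \<Rightarrow> 2 \<Rightarrow> nat" where
  "idx2 = (\<lambda>(n, m) i. if i = 0 then m else n)"

definition idx3 :: "nat \<times> nat \<times> nat \<Rightarrow> 3 \<Rightarrow> nat" where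
  "idx3 = (\<lambda>(n, a, b) i. if i = 0 then a else if i = 1 then b else n)"

lemma bij_idx2: "bij_betw idx2 (SIGMA n:{1..}. {1..<n}) mzeta_indices"
proof (rule bij_betwI[where g = "\<lambda>f. (f 1, f 0)"])
  show "idx2 \<in> (SIGMA n:{1..}. {1..<n}) \<rightarrow> mzeta_indices"
    by (auto simp: idx2_def mzeta_indices_def strict_mono_def less_2_iff)
  show "(\<lambda>f::2 \<Rightarrow> nat. (f 1, f 0)) \<in> mzeta_indices \<rightarrow> (SIGMA n:{1..}. {1..<n})"
  proof
    fix f :: "2 \<Rightarrow> nat" assume "f \<in> mzeta_indices"
    then have f: "strict_mono f" "1 \<le> f 0" "1 \<le> f 1" by (simp_all add: mzeta_indices_def)
    have "f 0 < f 1" by (rule strict_monoD[OF f(1)]) (simp add: less_2_iff)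
    with f(2,3) show "(f 1, f 0) \<in> (SIGMA n:{1..}. {1..<n})" by auto
  qed
  show "idx2 (f 1, f 0) = f" for f
    using exhaust_bit2 by (force simp: idx2_def fun_eq_iff)
qed (auto simp: idx2_def)

lemma bij_idx3: "bij_betw idx3 (SIGMA n:{1..}. {(a, b). 1 \<le> a \<and> a < b \<and> b < n}) mzeta_indices"
proof (rule bij_betwI[where g = "\<lambda>f. (f 2, f 0, f 1)"])
  show "idx3 \<in> (SIGMA n:{1..}. {(a, b). 1 \<le> a \<and> a < b \<and> b < n}) \<rightarrow> mzeta_indices"
    by (auto simp: idx3_def mzeta_indices_def strict_mono_def less_3_iff)
  show "(\<lambda>f::3 \<Rightarrow> nat. (f 2, f 0, f 1)) \<in> mzeta_indices \<rightarrow> (SIGMA n:{1..}. {(a, b). 1 \<le> a \<and> a < b \<and> b < n})"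
  proof
    fix f :: "3 \<Rightarrow> nat" assume f: "f \<in> mzeta_indices"
    then have sm: "strict_mono f" by (simp add: mzeta_indices_def)
    have "f 0 < f 1" "f 1 < f 2" by (rule strict_monoD[OF sm], simp add: less_3_iff)+
    moreover have "1 \<le> f 0" "1 \<le> f 2" using f by (auto simp: mzeta_indices_def)
    ultimately show "(f 2, f 0, f 1) \<in> (SIGMA n:{1..}. {(a, b). 1 \<le> a \<and> a < b \<and> b < n})" by auto
  qed
  show "idx3 (f 2, f 0, f 1) = f" for f
    using exhaust_bit3 by (fastforce simp: idx3_def fun_eq_iff)
qed (auto simp: idx3_def)

lemma mzeta_term_idx2:
  "mzeta_term q (idx2 (n, m)) = of_nat m powr (- (q $ 0)) * of_nat n powr (- (q $ 1))"
proof -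
  have U: "UNIV = {0, 1::2}" using exhaust_bit2 by auto
  show ?thesis unfolding mzeta_term_def U by (simp add: idx2_def powr_minus_divide)
qed

lemma mzeta_term_idx3:
  "mzeta_term q (idx3 (n, a, b)) = of_nat a powr (- (q $ 0)) * of_nat b powr (- (q $ 1)) * of_nat n powr (- (q $ 2))"
proof -
  have U: "UNIV = {0, 1, 2::3}" using exhaust_bit3 by auto
  show ?thesis unfolding mzeta_term_def U by (simp add: idx3_def powr_minus_divide)
qed

lemma mzeta_region2_iff:
  "(q :: complex ^ 2) \<in> mzeta_region \<longleftrightarrow> summable (\<lambda>n. hsum (Re (q $ 0)) n * real (Suc n) powr (- Re (q $ 1)))"
proof -
  let ?f = "\<lambda>x. mzeta_term q (idx2 x)"
  have "q \<in> mzeta_region \<longleftrightarrow> (\<lambda>x. norm (?f x)) summable_on (SIGMA n:{1..}. {1..<n})"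
    unfolding mzeta_region_def mem_Collect_eq
    using summable_on_reindex_bij_betw[OF bij_idx2, of "\<lambda>n. norm (mzeta_term q n)"] by simp
  also have "\<dots> \<longleftrightarrow> summable (\<lambda>n. \<Sum>m\<in>{1..<Suc n}. norm (?f (Suc n, m)))"
    by (rule abs_summable_on_Sigma_nat_iff) simp
  also have "(\<lambda>n. \<Sum>m\<in>{1..<Suc n}. norm (?f (Suc n, m))) = (\<lambda>n. hsum (Re (q $ 0)) n * real (Suc n) powr (- Re (q $ 1)))"
    by (simp add: fun_eq_iff mzeta_term_idx2 norm_mult norm_nat_powr hsum_def sum_distrib_right atLeastLessThanSuc_atLeastAtMost del: of_nat_Suc)
  finally show ?thesis .
qed

lemma mzeta_series2_eq:
  assumes "(q :: complex ^ 2) \<in> mzeta_region"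
  shows "mzeta_series q = (\<Sum>n. H (q $ 0) n * of_nat (Suc n) powr (- (q $ 1)))"
proof -
  let ?f = "\<lambda>x. mzeta_term q (idx2 x)"
  have abs: "(\<lambda>x. norm (?f x)) summable_on (SIGMA n:{1..}. {1..<n})"
    using assms unfolding mzeta_region_def mem_Collect_eq
    using summable_on_reindex_bij_betw[OF bij_idx2, of "\<lambda>n. norm (mzeta_term q n)"] by simp
  have "mzeta_series q = infsum ?f (SIGMA n:{1..}. {1..<n})"
    unfolding mzeta_series_def using infsum_reindex_bij_betw[OF bij_idx2, of "mzeta_term q"] by simp
  also have "\<dots> = (\<Sum>n. \<Sum>m\<in>{1..<Suc n}. ?f (Suc n, m))"
    by (rule infsum_Sigma_nat(1)[OF _ abs]) simp
  also have "(\<lambda>n. \<Sum>m\<in>{1..<Suc n}. ?f (Suc n, m)) = (\<lambda>n. H (q $ 0) n * of_nat (Suc n) powr (- (q $ 1)))"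
    by (simp add: fun_eq_iff mzeta_term_idx2 H_eq sum_distrib_right atLeastLessThanSuc_atLeastAtMost del: of_nat_Suc)
  finally show ?thesis .
qed

definition region2 :: "(complex ^ 2) set" where
  "region2 = {q. Re (q $ 1) > 1 \<and> Re (q $ 0 + q $ 1) > 2}"

text \<open>A continuation is tied to the exact set of absolute convergence, so both inclusions
  matter. Necessity rests on two lower bounds for \<open>hsum a n\<close>: its first term 1, and the
  contribution of its upper half.\<close>

lemma mzeta_region2_eq: "mzeta_region = region2"
proof (intro set_eqI iffI)
  fix q :: "complex ^ 2"
  define a r where "a = Re (q $ 0)" and "r = Re (q $ 1)"
  {
    assume "q \<in> region2"
    then have r: "r > 1" "a + r > 2" by (auto simp: region2_def a_def r_def)
    \<comment> \<open>Midpoint of the interval from \<open>max 0 (1 - a)\<close> to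
      \<open>r - 1\<close>, which the two inequalities make nonempty.\<close>
    define \<beta> where "\<beta> = (max 0 (1 - a) + (r - 1)) / 2"
    have "\<beta> > max 0 (1 - a)" "\<beta> < r - 1" unfolding \<beta>_def using r by (auto simp: max_def)
    then have "summable (\<lambda>n. hsum a (Suc n) ^ 1 * real (Suc n) powr (- r))"
      by (intro hsum_power_summable[of \<beta>]) auto
    then have "summable (\<lambda>n. hsum a n * real (Suc n) powr (- r))"
      by (rule summable_comparison_test'[where N = 0])
         (auto simp: hsum_nonneg abs_mult simp del: of_nat_Suc intro!: mult_right_mono hsum_mono)
    then show "q \<in> mzeta_region" by (simp add: mzeta_region2_iff a_def r_def)
  }
  {
    assume "q \<in> mzeta_region"
    then have sm: "summable (\<lambda>n. hsum a n * real (Suc n) powr (- r))" by (simp add: mzeta_region2_iff a_def r_def)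
    have h1: "hsum a n \<ge> 1" if "n \<ge> 1" for n using hsum_mono[OF that, of a] by (simp add: hsum_def)
    have "summable (\<lambda>n. real (Suc n) powr (- r))"
    proof (rule summable_comparison_test'[OF sm, of 1])
      fix n :: nat assume "n \<ge> 1"
      from mult_right_mono[OF h1[OF this], of "real (Suc n) powr (- r)"]
      show "norm (real (Suc n) powr (- r)) \<le> hsum a n * real (Suc n) powr (- r)" by simp
    qed
    then have r: "r > 1" by (simp add: summable_Suc_powr del: of_nat_Suc)
    \<comment> \<open>There are more than \<open>n / 2\<close> indices between
      \<open>n - n div 2\<close> and \<open>n\<close>, and each contributes at least a constant
      times \<open>n powr (- a)\<close>.\<close>
    have h: "real n powr (1 - a) \<le> 2 * 2 powr \<bar>a\<bar> * hsum a n" for n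
    proof -
      have "real n / 2 * real n powr (- a) \<le> real (Suc (n div 2)) * real n powr (- a)"
        by (intro mult_right_mono powr_ge_zero) linarith
      also have "\<dots> = (\<Sum>m\<in>{n - n div 2..n}. real n powr (- a))" by (cases "n = 0") auto
      also have "\<dots> \<le> (\<Sum>m\<in>{n - n div 2..n}. 2 powr \<bar>a\<bar> * real m powr (- a))"
      proof (intro sum_mono)
        fix m assume m: "m \<in> {n - n div 2..n}"
        then have "n \<le> 2 * m" by auto
        then have "real n \<le> 2 * real m" by linarith
        then show "real n powr (- a) \<le> 2 powr \<bar>a\<bar> * real m powr (- a)"
          using powr_between_le[of "real m" "real n" "- a"] m by (cases "m = 0") auto
      qed
      also have "\<dots> \<le> 2 powr \<bar>a\<bar> * hsum a n"
        unfolding hsum_def sum_distrib_left[symmetric]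
        by (cases "n = 0") (auto intro!: mult_left_mono sum_mono2)
      finally show ?thesis by (cases "n = 0") (simp_all add: powr_diff powr_minus_divide hsum_nonneg)
    qed
    have "summable (\<lambda>n. 2 powr \<bar>1 - a\<bar> * (2 * 2 powr \<bar>a\<bar>) * (hsum a n * real (Suc n) powr (- r)))"
      by (intro summable_mult sm)
    then have "summable (\<lambda>n. real (Suc n) powr (1 - a - r))"
    proof (rule summable_comparison_test'[of _ 1])
      fix n :: nat assume n: "n \<ge> 1"
      have "real (Suc n) powr (1 - a) \<le> 2 powr \<bar>1 - a\<bar> * real n powr (1 - a)"
        using n by (intro powr_between_le) auto
      also have "\<dots> \<le> 2 powr \<bar>1 - a\<bar> * (2 * 2 powr \<bar>a\<bar> * hsum a n)"
        by (intro mult_left_mono h) auto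
      finally have "real (Suc n) powr (1 - a) * real (Suc n) powr (- r) \<le> 2 powr \<bar>1 - a\<bar> * (2 * 2 powr \<bar>a\<bar> * hsum a n) * real (Suc n) powr (- r)"
        by (rule mult_right_mono) simp
      then show "norm (real (Suc n) powr (1 - a - r)) \<le> 2 powr \<bar>1 - a\<bar> * (2 * 2 powr \<bar>a\<bar>) * (hsum a n * real (Suc n) powr (- r))"
        by (simp add: mult_ac flip: powr_add)
    qed
    then have "a + r > 2" by (simp add: summable_Suc_powr del: of_nat_Suc)
    then show "q \<in> region2" using r by (simp add: region2_def a_def r_def)
  }
qed

lemma mzeta_eq_series: "q \<in> mzeta_region \<Longrightarrow> mzeta q = mzeta_series q"
  by (simp add: mzeta_def)

lemma pt2_nth [simp]: "pt2 a b $ 0 = a" "pt2 a b $ 1 = b"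
  by (simp_all add: pt2_def)

lemma pt3_nth [simp]: "pt3 a b c $ 0 = a" "pt3 a b c $ 1 = b" "pt3 a b c $ 2 = c"
  by (simp_all add: pt3_def)

text \<open>The full series and its three parts are sums of a single function \<open>f\<close> on
  triples \<open>(n, (m, m'))\<close>. Absolute summability over all triples passes to each part by
  restriction, and this is also how the depth-two and depth-three points are seen to lie in
  \<open>mzeta_region\<close>.\<close>

theorem zeta22_decomposition:
  assumes \<rho>: "Re \<rho> > 1" "2 * Re s + Re \<rho> > 3"
  shows "(\<lambda>n. norm (zeta22_term s \<rho> n)) summable_on {1..}"
    and "zeta22 s \<rho> = zeta3 s (cnj s) \<rho> + zeta3 (cnj s) s \<rho> + zeta2 (of_real (2 * Re s)) \<rho>"
    and "pt3 s (cnj s) \<rho> \<in> mzeta_region"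
    and "pt2 (of_real (2 * Re s)) \<rho> \<in> mzeta_region"
    and "summable (\<lambda>n. (norm (H s n))\<^sup>2 * real (Suc n) powr (- Re \<rho>))"
    and "zeta22 s \<rho> = (\<Sum>n. of_real ((norm (H s n))\<^sup>2) * of_nat (Suc n) powr (- \<rho>))"
proof -
  define a r where "a = Re s" and "r = Re \<rho>"
  define f where "f = (\<lambda>(n, (m, m')). of_nat m powr (- s) * of_nat m' powr (- cnj s) * of_nat n powr (- \<rho>) :: complex)"
  define B where "B = (\<lambda>n::nat. {1..<n} \<times> {1..<n})"
  define B1 where "B1 = (\<lambda>n::nat. {(m, m'). (1::nat) \<le> m \<and> m < m' \<and> m' < n})"
  define B2 where "B2 = (\<lambda>n::nat. {(m, m'). (1::nat) \<le> m' \<and> m' < m \<and> m < n})"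
  define B3 where "B3 = (\<lambda>n::nat. {(m, m'). (1::nat) \<le> m' \<and> m' = m \<and> m < n})"
  have fin: "finite (B n)" for n by (simp add: B_def)
  have sub: "B1 n \<subseteq> B n" "B2 n \<subseteq> B n" "B3 n \<subseteq> B n" for n by (auto simp: B_def B1_def B2_def B3_def)
  \<comment> \<open>Midpoint of the interval from \<open>max 0 (1 - a)\<close> to
    \<open>(r - 1) / 2\<close>; the two hypotheses say that it is nonempty. The square of
    \<open>hsum\<close> doubles \<open>\<beta>\<close>, hence the halved upper end.\<close>
  define \<beta> where "\<beta> = (2 * max 0 (1 - a) + (r - 1)) / 4"
  have "\<beta> > max 0 (1 - a)" "2 * \<beta> < r - 1" unfolding \<beta>_def using \<rho> by (auto simp: max_def a_def r_def)
  then have "summable (\<lambda>n. hsum a (Suc n) ^ 2 * real (Suc n) powr (- r))"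
    by (intro hsum_power_summable[of \<beta>]) auto
  then have sm: "summable (\<lambda>n. hsum a n ^ 2 * real (Suc n) powr (- r))"
    by (rule summable_comparison_test'[where N = 0])
       (auto simp: hsum_nonneg abs_mult simp del: of_nat_Suc intro!: mult_right_mono power_mono hsum_mono)
  have "(\<Sum>x\<in>B (Suc n). norm (f (Suc n, x))) = hsum a n ^ 2 * real (Suc n) powr (- r)" for n
  proof -
    have "(\<Sum>x\<in>B (Suc n). norm (f (Suc n, x))) =
       (\<Sum>x\<in>{1..n} \<times> {1..n}. (real (fst x) powr (- a) * real (snd x) powr (- a)) * real (Suc n) powr (- r))"
      unfolding B_def f_def atLeastLessThanSuc_atLeastAtMost
      by (intro sum.cong refl) (auto simp: norm_mult norm_nat_powr a_def r_def simp del: of_nat_Suc)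
    then show ?thesis
      unfolding hsum_def power2_eq_square sum_product sum.cartesian_product
      by (simp add: sum_distrib_right split_def)
  qed
  then have abs: "(\<lambda>x. norm (f x)) summable_on Sigma {1..} B"
    using sm abs_summable_on_Sigma_nat_iff[of B f, OF fin] by simp
  have sums: "(\<Sum>x\<in>B n. f (n, x)) = zeta22_term s \<rho> n" for n
  proof (cases n)
    case (Suc k)
    have "cnj (H s k) = (\<Sum>m=1..k. of_nat m powr (- cnj s))"
      unfolding H_eq cnj_sum by (intro sum.cong refl) (simp add: cnj_powr complex_nonpos_Reals_iff)
    then have "H s k * cnj (H s k) = (\<Sum>x\<in>{1..k} \<times> {1..k}. of_nat (fst x) powr (- s) * of_nat (snd x) powr (- cnj s))"
      by (simp add: H_eq sum_product sum.cartesian_product split_def)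
    moreover have "of_real ((cmod (H s k))\<^sup>2) = H s k * cnj (H s k)" by (metis complex_norm_square)
    ultimately show ?thesis
      by (simp add: B_def f_def Suc zeta22_term_def atLeastLessThanSuc_atLeastAtMost split_def powr_minus_divide
         sum_divide_distrib del: of_nat_Suc of_real_power)
  qed (simp add: B_def zeta22_term_def H_def)
  show "(\<lambda>n. norm (zeta22_term s \<rho> n)) summable_on {1..}"
    using infsum_Sigma_nat(3)[OF fin abs] sums by simp
  have z: "zeta22 s \<rho> = infsum f (Sigma {1..} B)"
    unfolding zeta22_def using infsum_Sigma_nat(2)[OF fin abs] sums by simp
  have "zeta22 s \<rho> = (\<Sum>n. zeta22_term s \<rho> (Suc n))"
    unfolding z using infsum_Sigma_nat(1)[OF fin abs] sums by simp
  then show "zeta22 s \<rho> = (\<Sum>n. of_real ((norm (H s n))\<^sup>2) * of_nat (Suc n) powr (- \<rho>))"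
    by (simp add: zeta22_term_def powr_minus_divide del: of_nat_Suc)
  show "summable (\<lambda>n. (norm (H s n))\<^sup>2 * real (Suc n) powr (- Re \<rho>))"
    by (rule summable_comparison_test'[OF sm, of 0])
       (auto simp: a_def r_def abs_mult simp del: of_nat_Suc intro!: mult_right_mono power_mono norm_H_le)
  have abs': "(\<lambda>x. norm (f x)) summable_on Sigma {1..} B'" if "\<And>n. B' n \<subseteq> B n" for B'
    by (rule summable_on_subset_banach[OF abs]) (use that in auto)
  have T: "mzeta_term (pt3 s (cnj s) \<rho>) (idx3 x) = f x" for x
    by (cases x) (auto simp: mzeta_term_idx3 f_def)
  show R1: "pt3 s (cnj s) \<rho> \<in> mzeta_region"
    unfolding mzeta_region_def mem_Collect_eq
    using summable_on_reindex_bij_betw[OF bij_idx3, of "\<lambda>n. norm (mzeta_term (pt3 s (cnj s) \<rho>) n)"]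
      abs'[OF sub(1)] by (simp add: T B1_def)
  have i1: "zeta3 s (cnj s) \<rho> = infsum f (Sigma {1..} B1)"
    unfolding mzeta_eq_series[OF R1] mzeta_series_def
    using infsum_reindex_bij_betw[OF bij_idx3, of "mzeta_term (pt3 s (cnj s) \<rho>)"] by (simp add: T B1_def)
  \<comment> \<open>Triples with \<open>m' < m\<close> become increasing once the two inner indices
    are exchanged.\<close>
  define sw where "sw = (\<lambda>(n::nat, (m::nat, m'::nat)). (n, (m', m)))"
  have bsw: "bij_betw sw (Sigma {1..} B2) (SIGMA n:{1..}. {(a, b). 1 \<le> a \<and> a < b \<and> b < n})"
    by (rule bij_betwI[where g = sw]) (auto simp: sw_def B2_def)
  note b2 = bij_betw_trans[OF bsw bij_idx3]
  have T2: "mzeta_term (pt3 (cnj s) s \<rho>) ((idx3 \<circ> sw) x) = f x" for x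
    by (cases x) (auto simp: mzeta_term_idx3 f_def sw_def)
  have R2: "pt3 (cnj s) s \<rho> \<in> mzeta_region"
    unfolding mzeta_region_def mem_Collect_eq
    using summable_on_reindex_bij_betw[OF b2, of "\<lambda>n. norm (mzeta_term (pt3 (cnj s) s \<rho>) n)"]
      abs'[OF sub(2)] by (simp only: T2)
  have i2: "zeta3 (cnj s) s \<rho> = infsum f (Sigma {1..} B2)"
    unfolding mzeta_eq_series[OF R2] mzeta_series_def
    using infsum_reindex_bij_betw[OF b2, of "mzeta_term (pt3 (cnj s) s \<rho>)"] by (simp only: T2)
  \<comment> \<open>On the diagonal the exponents \<open>s\<close> and \<open>cnj s\<close> act on
    the same base and add up to \<open>2 * Re s\<close>.\<close>
  define dg where "dg = (\<lambda>(n::nat, (m::nat, m'::nat)). (n, m))"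
  have bdg: "bij_betw dg (Sigma {1..} B3) (SIGMA n:{1..}. {1..<n})"
    by (rule bij_betwI[where g = "\<lambda>(n, m). (n, (m, m))"]) (auto simp: dg_def B3_def)
  note b3 = bij_betw_trans[OF bdg bij_idx2]
  have T3: "mzeta_term (pt2 (of_real (2 * Re s)) \<rho>) ((idx2 \<circ> dg) x) = f x" if "x \<in> Sigma {1..} B3" for x
  proof -
    obtain n m where x: "x = (n, (m, m))" "m \<ge> 1" using \<open>x \<in> _\<close> by (auto simp: B3_def)
    have "- complex_of_real (2 * Re s) = - s + - cnj s" by (simp add: complex_eq_iff)
    then have "of_nat m powr (- of_real (2 * Re s)) = (of_nat m powr (- s) * of_nat m powr (- cnj s) :: complex)"
      using x by (simp only: powr_add)
    then show ?thesis using x by (simp add: f_def dg_def mzeta_term_idx2)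
  qed
  have n3: "(\<lambda>x. norm (mzeta_term (pt2 (of_real (2 * Re s)) \<rho>) ((idx2 \<circ> dg) x))) summable_on Sigma {1..} B3"
    using abs'[OF sub(3)] by (rule summable_on_cong[THEN iffD1, rotated]) (simp only: T3)
  show R3: "pt2 (of_real (2 * Re s)) \<rho> \<in> mzeta_region"
    unfolding mzeta_region_def mem_Collect_eq
    using summable_on_reindex_bij_betw[OF b3, of "\<lambda>n. norm (mzeta_term (pt2 (of_real (2 * Re s)) \<rho>) n)"] n3 by blast
  have "zeta2 (of_real (2 * Re s)) \<rho> = infsum (\<lambda>x. mzeta_term (pt2 (of_real (2 * Re s)) \<rho>) ((idx2 \<circ> dg) x)) (Sigma {1..} B3)"
    unfolding mzeta_eq_series[OF R3] mzeta_series_def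
    using infsum_reindex_bij_betw[OF b3, of "mzeta_term (pt2 (of_real (2 * Re s)) \<rho>)"] by simp
  also have "\<dots> = infsum f (Sigma {1..} B3)" by (rule infsum_cong) (rule T3)
  finally have i3: "zeta2 (of_real (2 * Re s)) \<rho> = infsum f (Sigma {1..} B3)" .
  have U: "Sigma {1..} B = Sigma {1..} B1 \<union> Sigma {1..} B2 \<union> Sigma {1..} B3"
    by (auto simp: B_def B1_def B2_def B3_def)
  note sm' = abs_summable_summable[OF abs'[OF sub(1)]] abs_summable_summable[OF abs'[OF sub(2)]]
     abs_summable_summable[OF abs'[OF sub(3)]]
  have d: "Sigma {1..} B1 \<inter> Sigma {1..} B2 = {}" "(Sigma {1..} B1 \<union> Sigma {1..} B2) \<inter> Sigma {1..} B3 = {}"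
    by (auto simp: B1_def B2_def B3_def)
  show "zeta22 s \<rho> = zeta3 s (cnj s) \<rho> + zeta3 (cnj s) s \<rho> + zeta2 (of_real (2 * Re s)) \<rho>"
    unfolding z i1 i2 i3 U
    using infsum_Un_disjoint[OF summable_on_Un_disjoint[OF sm'(1,2) d(1)] sm'(3) d(2)]
      infsum_Un_disjoint[OF sm'(1,2) d(1)] by simp
qed

section \<open>Continuation of the double zeta-function\<close>

lemma vec_ball_nth:
  assumes "q \<in> ball p e"
  shows "\<bar>Re (q $ i) - Re (p $ i)\<bar> < e"
proof -
  have "\<bar>Re (q $ i) - Re (p $ i)\<bar> \<le> norm ((q - p) $ i)" using abs_Re_le_cmod[of "(q - p) $ i"] by simp
  also have "\<dots> \<le> norm (q - p)" by (rule Finite_Cartesian_Product.norm_nth_le)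
  finally show ?thesis using assms by (simp add: dist_norm norm_minus_commute)
qed

lemma axis_1_nth [simp]: "axis 1 c $ (0::2) = 0" "axis 1 c $ (1::2) = c"
  by (simp_all add: axis_def)

definition halfspace2 :: "(complex ^ 2) set" where
  "halfspace2 = {q. Re (q $ 0 + q $ 1) > 2}"

text \<open>The Riemann zeta-function written on C^2. The exponent \<open>s1 + s2 - 1\<close> is the
  one that Abel summation of the double series produces; zeta(s1 + s2) is the same series at the
  point translated by \<open>axis 1 1\<close>.\<close>

interpretation Z: dirichlet_family "\<lambda>_ _. 1" "\<lambda>q. q $ 0 + q $ 1 - 1" halfspace2
proof
  show "open halfspace2" unfolding halfspace2_def by (intro open_Collect_less continuous_intros)
  show "locally_dominated (\<lambda>n q. 1 * of_nat (Suc n) powr - (q $ 0 + q $ 1 - 1)) halfspace2"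
    unfolding locally_dominated_def
  proof
    fix p :: "complex ^ 2" assume p: "p \<in> halfspace2"
    define P where "P = Re (p $ 0 + p $ 1)"
    define e where "e = (P - 2) / 4"
    have e: "e > 0" using p by (simp add: e_def P_def halfspace2_def)
    have Pe: "P = 2 + 4 * e" by (simp add: e_def field_simps)
    have "norm (1 * of_nat (Suc n) powr - (q $ 0 + q $ 1 - 1) :: complex) \<le> real (Suc n) powr (- (1 + 2 * e))"
      if "q \<in> ball p e" for n q
    proof -
      have "Re (- (q $ 0 + q $ 1 - 1)) \<le> - (1 + 2 * e)"
      proof -
        have "Re (q $ 0) > Re (p $ 0) - e" "Re (q $ 1) > Re (p $ 1) - e"
          using vec_ball_nth[OF that, of 0] vec_ball_nth[OF that, of 1] by linarith+
        then show ?thesis using Pe by (simp add: P_def)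
      qed
      then show ?thesis unfolding norm_mult norm_nat_powr by (simp add: powr_mono del: of_nat_Suc)
    qed
    moreover have "summable (\<lambda>n. real (Suc n) powr (- (1 + 2 * e)))"
      using e unfolding summable_Suc_powr by simp
    ultimately show "\<exists>e>0. \<exists>u. summable u \<and>
        (\<forall>n. \<forall>q\<in>ball p e. norm (1 * of_nat (Suc n) powr - (q $ 0 + q $ 1 - 1) :: complex) \<le> u n)"
      using e by blast
  qed
qed (auto simp: halfspace2_def intro!: mholo_on_const mholo_on_diff mholo_on_add mholo_on_nth)

text \<open>The coefficient \<open>H s1 n\<close> includes the diagonal index \<open>m = n\<close>,
  so \<open>D.dser\<close> is zeta2(s1, s2) + zeta(s1 + s2). With this choice the Abel sum needs no
  shift of index.\<close>

interpretation D: dirichlet_family "\<lambda>n q. H (q $ 0) n" "\<lambda>q. q $ 1" region2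
proof
  show "open region2" unfolding region2_def
    by (intro open_Collect_conj open_Collect_less continuous_intros)
  show "mholo_on (\<lambda>q :: complex ^ 2. H (q $ 0) n) UNIV" for n
    unfolding H_eq
    by (intro mholo_on_sum mholo_on_compose_holomorphic[of "\<lambda>z. of_nat m powr (- z)" UNIV for m] mholo_on_nth)
       (auto intro!: holomorphic_intros)
  show "locally_dominated (\<lambda>n q. H (q $ 0) (Suc n) * of_nat (Suc n) powr - (q $ 1)) region2"
    unfolding locally_dominated_def
  proof
    fix p :: "complex ^ 2" assume p: "p \<in> region2"
    define a r where "a = Re (p $ 0)" and "r = Re (p $ 1)"
    define \<beta> where "\<beta> = (max 0 (1 - a) + (r - 1)) / 2"
    have r: "r > 1" "a + r > 2" using p by (auto simp: region2_def a_def r_def)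
    have \<beta>: "\<beta> > max 0 (1 - a)" "\<beta> < r - 1" unfolding \<beta>_def using r by (auto simp: max_def)
    \<comment> \<open>Lowering both real parts by this \<open>e\<close> leaves
      \<open>\<beta>\<close> admissible for \<open>hsum_power_summable\<close>.\<close>
    define e where "e = min (a + \<beta> - 1) (r - 1 - \<beta>) / 2"
    have e: "e > 0" "e < a + \<beta> - 1" "e < r - 1 - \<beta>" using \<beta> by (auto simp: e_def)
    have "norm (H (q $ 0) (Suc n) * of_nat (Suc n) powr - (q $ 1)) \<le> hsum (a - e) (Suc n) ^ 1 * real (Suc n) powr (- (r - e))"
      if "q \<in> ball p e" for n q
    proof -
      have "norm (H (q $ 0) (Suc n)) \<le> hsum (a - e) (Suc n)"
        using vec_ball_nth[OF that, of 0] by (intro order_trans[OF norm_H_le hsum_antimono]) (simp add: a_def)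
      moreover have "real (Suc n) powr (Re (- (q $ 1))) \<le> real (Suc n) powr (- (r - e))"
        using vec_ball_nth[OF that, of 1] by (intro powr_mono) (auto simp: r_def)
      ultimately show ?thesis unfolding norm_mult norm_nat_powr power_one_right
        by (intro mult_mono) (auto simp: hsum_nonneg)
    qed
    moreover have "summable (\<lambda>n. hsum (a - e) (Suc n) ^ 1 * real (Suc n) powr (- (r - e)))"
      using e \<beta> by (intro hsum_power_summable[of \<beta>]) auto
    ultimately show "\<exists>e>0. \<exists>u. summable u \<and>
        (\<forall>n. \<forall>q\<in>ball p e. norm (H (q $ 0) (Suc n) * of_nat (Suc n) powr - (q $ 1)) \<le> u n)"
      using e by blast
  qed
qed (auto simp: region2_def intro!: mholo_on_nth)

lemma Z_shifted: "Z.shifted K = {q. Re (q $ 0 + q $ 1) > 2 - real K}"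
  unfolding Z.shifted_def by (auto simp: halfspace2_def)

lemma D_shifted: "D.shifted K = {q. Re (q $ 1) > 1 - real K \<and> Re (q $ 0 + q $ 1) > 2 - real K}"
  unfolding D.shifted_def by (auto simp: region2_def)

lemma D_shifted_subset_Z: "D.shifted K \<subseteq> Z.shifted K"
  unfolding D_shifted Z_shifted by auto

lemma convex_D_shifted: "convex (D.shifted K)"
proof -
  have *: "convex {q :: complex ^ 2. c < f q}" if "linear f" for f :: "complex ^ 2 \<Rightarrow> real" and c
  proof -
    have "{q. c < f q} = f -` {c<..}" by auto
    then show ?thesis using convex_linear_vimage[OF that, of "{c<..}"] by simp
  qed
  have "linear (\<lambda>q :: complex ^ 2. Re (q $ 1))" "linear (\<lambda>q :: complex ^ 2. Re (q $ 0 + q $ 1))"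
    by (auto intro!: linearI simp: algebra_simps)
  then have "convex ({q :: complex ^ 2. 1 - real K < Re (q $ 1)} \<inter> {q. 2 - real K < Re (q $ 0 + q $ 1)})"
    by (intro convex_Int *)
  then show ?thesis unfolding D_shifted by (simp add: Collect_conj_eq)
qed

lemma nat_powr_tendsto_0:
  assumes "Re z < 0"
  shows "(\<lambda>n. of_nat (Suc n) powr z :: complex) \<longlonglongrightarrow> 0"
proof (rule tendsto_norm_zero_cancel)
  have "filterlim (\<lambda>n. real (Suc n)) at_top sequentially"
    using filterlim_real_sequentially filterlim_sequentially_Suc by blast
  from tendsto_neg_powr[OF assms this]
  show "(\<lambda>n. norm (of_nat (Suc n) powr z :: complex)) \<longlonglongrightarrow> 0" by (simp add: norm_nat_powr del: of_nat_Suc)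
qed

text \<open>The differences telescope and only the first power, that of base 1, remains.\<close>

lemma Z_abel_ser:
  assumes "q \<in> halfspace2"
  shows "Z.abel_ser q = 1"
proof -
  have "(\<lambda>n. of_nat (Suc n) powr (1 - (q $ 0 + q $ 1 - 1)) :: complex) \<longlonglongrightarrow> 0"
    using assms by (intro nat_powr_tendsto_0) (simp add: halfspace2_def)
  moreover have "of_nat (Suc 0) powr z = (1 :: complex)" for z by simp
  ultimately show ?thesis using telescope_sums'[of "\<lambda>n. of_nat (Suc n) powr (1 - (q $ 0 + q $ 1 - 1)) :: complex" 0]
    unfolding Z.abel_ser_def by (simp add: sums_iff del: of_nat_Suc)
qed

text \<open>Summation by parts, with \<open>n powr (- s)\<close> as the increment of
  \<open>H s\<close>.\<close>

lemma H_abel_partial: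
  "(\<Sum>n<N. H s (Suc n) * (g (Suc n) - g (Suc (Suc n)))) = (\<Sum>n<N. of_nat (Suc n) powr (- s) * g (Suc n)) - H s N * g (Suc N)"
  by (induction N) (simp_all add: H_Suc algebra_simps del: of_nat_Suc, simp add: H_def)

text \<open>Summation by parts leaves the terms \<open>n powr (- s1) * n powr (1 - s2)\<close>,
  which are those of zeta(s1 + s2 - 1). The boundary term is of order
  \<open>N powr (\<beta> + 1 - r)\<close> and vanishes because
  \<open>\<beta> < r - 1\<close>.\<close>

lemma D_abel_ser:
  assumes q: "q \<in> region2"
  shows "D.abel_ser q = Z.dser q"
proof -
  define a r where "a = Re (q $ 0)" and "r = Re (q $ 1)"
  define \<beta> where "\<beta> = (max 0 (1 - a) + (r - 1)) / 2"
  have r: "r > 1" "a + r > 2" using q by (auto simp: region2_def a_def r_def)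
  have \<beta>: "\<beta> > max 0 (1 - a)" "\<beta> < r - 1" unfolding \<beta>_def using r by (auto simp: max_def)
  obtain C where C: "C \<ge> 0" "\<And>N. hsum a N \<le> C * real N powr \<beta>" using hsum_bound[of \<beta> a] \<beta> by auto
  define g where "g = (\<lambda>n::nat. of_nat n powr (1 - q $ 1) :: complex)"
  have "(\<lambda>N. H (q $ 0) N * g (Suc N)) \<longlonglongrightarrow> 0"
  proof (rule Lim_null_comparison[OF always_eventually])
    show "\<forall>N. norm (H (q $ 0) N * g (Suc N)) \<le> C * norm (of_nat (Suc N) powr (of_real (\<beta> + 1 - r)) :: complex)"
    proof
      fix N
      have "norm (H (q $ 0) N) \<le> C * real N powr \<beta>"
        using norm_H_le[of "q $ 0" N] C(2)[of N] by (simp add: a_def)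
      also have "\<dots> \<le> C * real (Suc N) powr \<beta>" using \<beta> C by (intro mult_left_mono powr_mono2) auto
      finally have "norm (H (q $ 0) N) * norm (g (Suc N)) \<le> C * real (Suc N) powr \<beta> * real (Suc N) powr (1 - r)"
        unfolding g_def norm_nat_powr by (intro mult_mono) (auto simp: r_def C)
      also have "\<dots> = C * real (Suc N) powr (\<beta> + 1 - r)" by (simp add: mult.assoc add_diff_eq flip: powr_add)
      finally show "norm (H (q $ 0) N * g (Suc N)) \<le> C * norm (of_nat (Suc N) powr (of_real (\<beta> + 1 - r)) :: complex)"
        by (simp add: norm_mult norm_nat_powr del: of_nat_Suc)
    qed
    show "(\<lambda>N. C * norm (of_nat (Suc N) powr (of_real (\<beta> + 1 - r)) :: complex)) \<longlonglongrightarrow> 0"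
      using \<beta> by (intro tendsto_mult_right_zero tendsto_norm_zero nat_powr_tendsto_0) simp
  qed
  moreover have "(\<lambda>n. of_nat (Suc n) powr (- (q $ 0)) * g (Suc n)) sums Z.dser q"
  proof -
    have "of_nat (Suc n) powr (- (q $ 0)) * g (Suc n) = 1 * of_nat (Suc n) powr (- (q $ 0 + q $ 1 - 1))" for n
      unfolding g_def powr_add[symmetric] by (simp del: of_nat_Suc add: algebra_simps)
    moreover have "q \<in> halfspace2" using r by (simp add: halfspace2_def a_def r_def)
    ultimately show ?thesis unfolding Z.dser_def
      using locally_dominated_summable[OF Z.dom] by (simp only: summable_sums)
  qed
  ultimately have "(\<lambda>N. (\<Sum>n<N. of_nat (Suc n) powr (- (q $ 0)) * g (Suc n)) - H (q $ 0) N * g (Suc N)) \<longlonglongrightarrow> Z.dser q - 0"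
    unfolding sums_def by (intro tendsto_diff)
  then have "(\<lambda>n. H (q $ 0) (Suc n) * (g (Suc n) - g (Suc (Suc n)))) sums Z.dser q"
    unfolding sums_def H_abel_partial by simp
  then show ?thesis unfolding D.abel_ser_def g_def by (simp add: sums_iff)
qed

lemma region2_subset: "region2 \<subseteq> halfspace2"
  by (auto simp: region2_def halfspace2_def)

text \<open>The diagonal terms \<open>m = n\<close> contained in \<open>D.dser\<close> form zeta(s1
  + s2) and have to be taken out.\<close>

lemma mzeta_series2_dser:
  assumes q: "q \<in> region2"
  shows "mzeta_series q = D.dser q - Z.dser (q + axis 1 1)"
proof -
  have q': "q + axis 1 1 \<in> halfspace2" using q by (auto simp: region2_def halfspace2_def)
  have "(\<lambda>n. H (q $ 0) (Suc n) * of_nat (Suc n) powr - (q $ 1) - 1 * of_nat (Suc n) powr - ((q + axis 1 1) $ 0 + (q + axis 1 1) $ 1 - 1))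
      sums (D.dser q - Z.dser (q + axis 1 1))"
    unfolding D.dser_def Z.dser_def
    by (intro sums_diff summable_sums locally_dominated_summable[OF D.dom q] locally_dominated_summable[OF Z.dom q'])
  also have "(\<lambda>n. H (q $ 0) (Suc n) * of_nat (Suc n) powr - (q $ 1) - 1 * of_nat (Suc n) powr - ((q + axis 1 1) $ 0 + (q + axis 1 1) $ 1 - 1))
     = (\<lambda>n. H (q $ 0) n * of_nat (Suc n) powr - (q $ 1))"
  proof
    fix n
    have "of_nat (Suc n) powr - ((q + axis 1 1) $ 0 + (q + axis 1 1) $ 1 - 1) =
       of_nat (Suc n) powr (- (q $ 0)) * (of_nat (Suc n) powr (- (q $ 1)) :: complex)"
      unfolding powr_add[symmetric] by (simp del: of_nat_Suc add: algebra_simps)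
    then show "H (q $ 0) (Suc n) * of_nat (Suc n) powr - (q $ 1) - 1 * of_nat (Suc n) powr - ((q + axis 1 1) $ 0 + (q + axis 1 1) $ 1 - 1)
       = H (q $ 0) n * of_nat (Suc n) powr - (q $ 1)"
      by (simp only: H_Suc) (simp add: algebra_simps del: of_nat_Suc)
  qed
  finally show ?thesis using mzeta_series2_eq q mzeta_region2_eq by (simp add: sums_iff del: of_nat_Suc)
qed

section \<open>Gluing the continuations and identifying \<open>mzeta\<close>\<close>

lemma nicely_on_cong:
  assumes "nicely_on f S" "open S" "\<And>q. q \<in> S \<Longrightarrow> f q = g q"
  shows "nicely_on g S"
proof -
  have T: "\<exists>e>0. ball p e \<subseteq> S \<and> thin_eq f g p e" if p: "p \<in> S" for p
  proof -
    obtain e where "e > 0" "ball p e \<subseteq> S" using p assms(2) open_contains_ball by blast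
    then show ?thesis using assms(3) thin_eq_refl[of e p f g] by blast
  qed
  show ?thesis
    unfolding nicely_on_def
  proof (intro conjI ballI)
    show "mmero_on g S"
      unfolding mmero_on_def
    proof
      fix p assume p: "p \<in> S"
      then obtain r where r: "r > 0" "ball p r \<subseteq> S" using assms(2) open_contains_ball by blast
      have "mmero_on f S" using assms(1) by (simp add: nicely_on_def)
      from mmero_onE[OF this p r(1)] obtain e a h where e: "e > 0" "e \<le> r" "mholo_on a (ball p e)" "mholo_on h (ball p e)"
         "\<exists>q\<in>ball p e. h q \<noteq> 0" "\<And>q. q \<in> ball p e \<Longrightarrow> h q \<noteq> 0 \<Longrightarrow> f q = a q / h q" by metis
      have "ball p e \<subseteq> S" using e(2) r(2) by auto
      then have "\<forall>q\<in>ball p e. h q \<noteq> 0 \<longrightarrow> g q = a q / h q" using e(6) assms(3) by (metis subsetD)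
      then show "\<exists>e>0. \<exists>a h. local_fraction g p e a h"
        using e by blast
    qed
    fix p assume p: "p \<in> S"
    obtain e where e: "e > 0" "ball p e \<subseteq> S" "thin_eq f g p e" using T[OF p] by blast
    from assms(1) p consider d where "d > 0" "mholo_on f (ball p d)" | "mpole f p" "f p = 0"
      unfolding nicely_on_def by blast
    then show "(\<exists>e>0. mholo_on g (ball p e)) \<or> mpole g p \<and> g p = 0"
    proof cases
      case 1
      have "mholo_on f (ball p (min d e))" by (rule mholo_on_subset[OF 1(2)]) auto
      then have "mholo_on g (ball p (min d e))"
        by (rule mholo_on_transform) (use e(2) in \<open>auto intro!: assms(3)\<close>)
      then show ?thesis using 1 e by (intro disjI1 exI[of _ "min d e"]) auto
    next
      case 2
      then show ?thesis using mpole_cong[OF e(3,1)] assms(3)[OF p] by simp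
    qed
  qed
qed

text \<open>The given \<open>F K\<close> need not agree at their singular points, but their normal
  forms do: all of them extend \<open>h\<close>, and the identity theorem on the convex set
  \<open>U K\<close> compares them there.\<close>

lemma nicely_on_glue:
  fixes U :: "nat \<Rightarrow> (complex ^ 'r) set"
  assumes U: "\<And>K. open (U K)" "\<And>K. convex (U K)" "\<And>K. U K \<subseteq> U (Suc K)" "(\<Union>K. U K) = UNIV"
    and F: "\<And>K. mmero_on (F K) (U K)"
    and h: "mholo_on h (U 0)" "\<And>K q. q \<in> U 0 \<Longrightarrow> F K q = h q" and ne: "U 0 \<noteq> {}"
  shows "\<exists>Z. nicely_on Z UNIV \<and> (\<forall>q\<in>U 0. Z q = h q)"
proof -
  define N where "N = (\<lambda>K. nice_rep (F K))"
  have mono: "U K \<subseteq> U L" if "K \<le> L" for K L using that U(3) lift_Suc_mono_le by blast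
  have N: "nicely_on (N K) (U K)" for K unfolding N_def by (rule nicely_on_nice_rep[OF F])
  have Nh: "N K q = h q" if q: "q \<in> U 0" for K q
  proof -
    obtain e where e: "e > 0" "ball q e \<subseteq> U 0" using q U(1) open_contains_ball by blast
    have "mholo_on h (ball q e)" using h(1) e(2) by (rule mholo_on_subset)
    moreover have "thin_eq (F K) h q e" using e(2) h(2) by (intro thin_eq_refl[OF e(1)]) blast
    moreover have "q \<in> ball q e" using e(1) by simp
    ultimately show ?thesis unfolding N_def by (rule nice_rep_eq)
  qed
  obtain p0 where p0: "p0 \<in> U 0" using ne by blast
  obtain e0 where e0: "e0 > 0" "ball p0 e0 \<subseteq> U 0" using p0 U(1) open_contains_ball by blast
  have step: "N K p = N L p" if KL: "K \<le> L" and p: "p \<in> U K" for K L p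
  proof (rule nicely_on_unique[OF N nicely_on_mono[OF N mono[OF KL]] p])
    show "\<exists>e>0. thin_eq (N K) (N L) p e"
    proof (rule mmero_on_identity[OF _ _ U(1,2) _ e0(1) _ p])
      show "mmero_on (N K) (U K)" "mmero_on (N L) (U K)"
        using N mmero_on_subset[OF _ mono[OF KL]] by (auto simp: nicely_on_def)
      show "p0 \<in> U K" using p0 mono[of 0 K] by auto
      show "N K q = N L q" if "q \<in> ball p0 e0" for q using that e0(2) Nh by auto
    qed
  qed
  \<comment> \<open>By \<open>step\<close> every \<open>K\<close> with \<open>q \<in> U K\<close>
    gives the same value; the least one is merely a definite choice.\<close>
  define Z where "Z = (\<lambda>q. N (LEAST K. q \<in> U K) q)"
  have Z: "Z q = N K q" if q: "q \<in> U K" for q K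
  proof -
    have "q \<in> U (LEAST K. q \<in> U K)" by (rule LeastI[of _ K]) (rule q)
    moreover have "(LEAST K. q \<in> U K) \<le> K" by (rule Least_le) (rule q)
    ultimately show ?thesis unfolding Z_def by (rule step[rotated])
  qed
  have nZ: "nicely_on Z (U K)" for K
    by (rule nicely_on_cong[OF N U(1)]) (simp add: Z)
  have "nicely_on Z UNIV"
    unfolding nicely_on_def mmero_on_def
  proof (intro conjI ballI)
    fix p
    obtain K where K: "p \<in> U K" using U(4) by blast
    show "\<exists>e>0. \<exists>g h. local_fraction Z p e g h"
      using nZ[of K] K unfolding nicely_on_def mmero_on_def by blast
    show "(\<exists>e>0. mholo_on Z (ball p e)) \<or> mpole Z p \<and> Z p = 0"
      using nZ[of K] K unfolding nicely_on_def by blast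
  qed
  moreover have "\<forall>q\<in>U 0. Z q = h q" using Z[of _ 0] Nh by simp
  ultimately show ?thesis by blast
qed

lemma Z_continuation: "\<exists>F. mmero_on F (Z.shifted K) \<and> (\<forall>q\<in>halfspace2. F q = Z.dser q)"
proof (rule Z.dser_continuation)
  show "\<exists>a. mmero_on a (Z.shifted K) \<and> (\<forall>q\<in>halfspace2. a q = Z.abel_ser q)" for K
    using mholo_imp_mmero_on[OF mholo_on_const[of 1] Z.open_shifted] Z_abel_ser by auto
qed (auto simp: halfspace2_def complex_eq_iff)

text \<open>The Abel series of the second family is the series of the first one, whose continuation
  is already available.\<close>

lemma D_continuation: "\<exists>F. mmero_on F (D.shifted K) \<and> (\<forall>q\<in>region2. F q = D.dser q)"
proof (rule D.dser_continuation)
  fix K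
  obtain F where F: "mmero_on F (Z.shifted K)" "\<forall>q\<in>halfspace2. F q = Z.dser q"
    using Z_continuation by blast
  have "\<forall>q\<in>region2. F q = D.abel_ser q"
    using F(2) D_abel_ser region2_subset by auto
  then show "\<exists>a. mmero_on a (D.shifted K) \<and> (\<forall>q\<in>region2. a q = D.abel_ser q)"
    using mmero_on_subset[OF F(1) D_shifted_subset_Z] by blast
qed (auto simp: region2_def)

lemma mzeta_series2_holo: "mholo_on mzeta_series region2"
proof -
  have "mholo_on (\<lambda>q. D.dser q - Z.dser (q + axis 1 1)) region2"
    by (intro mholo_on_diff D.dser_holo mholo_on_translate[OF Z.dser_holo])
       (auto simp: region2_def halfspace2_def)
  then show ?thesis by (rule mholo_on_transform[OF _ D.open_S]) (simp add: mzeta_series2_dser)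
qed

lemma pt2_mem_region2: "pt2 0 3 \<in> region2"
  by (simp add: region2_def)

lemma mzeta_continuation2_exists: "\<exists>Z. mzeta_continuation (Z :: complex ^ 2 \<Rightarrow> complex)"
proof -
  have "\<exists>F. mmero_on F (D.shifted K) \<and> (\<forall>q\<in>D.shifted 0. F q = mzeta_series q)" for K
  proof -
    obtain F1 where F1: "mmero_on F1 (D.shifted K)" "\<forall>q\<in>region2. F1 q = D.dser q"
      using D_continuation by blast
    obtain F2 where F2: "mmero_on F2 (Z.shifted K)" "\<forall>q\<in>halfspace2. F2 q = Z.dser q"
      using Z_continuation by blast
    have "mmero_on (\<lambda>q. F2 (q + axis 1 1)) (D.shifted K)"
      by (rule mmero_on_translate[OF F2(1)]) (auto simp: D_shifted Z_shifted)
    then have "mmero_on (\<lambda>q. F1 q + (-1) * F2 (q + axis 1 1)) (D.shifted K)"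
      by (intro mmero_on_add F1 mmero_on_mult mholo_imp_mmero_on[OF mholo_on_const] D.open_shifted)
    moreover have "F1 q + (-1) * F2 (q + axis 1 1) = mzeta_series q" if "q \<in> D.shifted 0" for q
    proof -
      have q: "q \<in> region2" using that by (simp add: D.shifted_0)
      then have "q + axis 1 1 \<in> halfspace2" by (auto simp: region2_def halfspace2_def)
      then show ?thesis using F1(2) F2(2) q by (simp add: mzeta_series2_dser)
    qed
    ultimately show ?thesis by blast
  qed
  then obtain F where F: "\<And>K. mmero_on (F K) (D.shifted K)" "\<And>K q. q \<in> D.shifted 0 \<Longrightarrow> F K q = mzeta_series q"
    by metis
  have "\<exists>Z. nicely_on Z UNIV \<and> (\<forall>q\<in>D.shifted 0. Z q = mzeta_series q)"
  proof (rule nicely_on_glue[OF D.open_shifted convex_D_shifted _ _ F(1) _ F(2)])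
    show "D.shifted K \<subseteq> D.shifted (Suc K)" for K by (auto simp: D_shifted)
    show "(\<Union>K. D.shifted K) = UNIV"
    proof (intro set_eqI iffI UNIV_I)
      fix q :: "complex ^ 2"
      obtain K :: nat where "max (1 - Re (q $ 1)) (2 - Re (q $ 0 + q $ 1)) < real K"
        using reals_Archimedean2 by blast
      then show "q \<in> (\<Union>K. D.shifted K)" by (intro UN_I[of K]) (auto simp: D_shifted)
    qed
    show "mholo_on mzeta_series (D.shifted 0)" using mzeta_series2_holo by (simp add: D.shifted_0)
    show "D.shifted 0 \<noteq> {}" using pt2_mem_region2 by (auto simp: D.shifted_0)
  qed
  then show ?thesis
    unfolding mzeta_continuation_def nicely_mmero_iff mzeta_region2_eq by (simp add: D.shifted_0)
qed

text \<open>Two continuations coincide near the point (0, 3), hence off thin sets everywhere by the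
  identity theorem, and the normal form then fixes all values. So the definite description inside
  \<open>mzeta\<close> denotes.\<close>

lemma mzeta_continuation2: "mzeta_continuation (mzeta :: complex ^ 2 \<Rightarrow> complex)"
proof -
  obtain Z :: "complex ^ 2 \<Rightarrow> complex" where Z: "mzeta_continuation Z" using mzeta_continuation2_exists by blast
  have "Z' = Z" if Z': "mzeta_continuation Z'" for Z'
  proof
    fix p
    obtain e0 where e0: "e0 > 0" "ball (pt2 0 3) e0 \<subseteq> region2"
      using D.open_S pt2_mem_region2 open_contains_ball by blast
    have "\<exists>e>0. thin_eq Z' Z p e"
      by (rule mmero_on_identity[of _ UNIV _ "pt2 0 3" e0])
         (use Z Z' e0 in \<open>auto simp: mzeta_continuation_def mzeta_region2_eq nicely_mmero_iff nicely_on_def\<close>)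
    then show "Z' p = Z p"
      using Z Z' nicely_on_unique[of Z' UNIV Z p] by (simp add: mzeta_continuation_def nicely_mmero_iff)
  qed
  then have "(THE Z. mzeta_continuation Z) = Z" using Z by (intro the_equality)
  then have "mzeta = Z" using Z by (auto simp: mzeta_def mzeta_continuation_def fun_eq_iff)
  then show ?thesis using Z by simp
qed

text \<open>Both functional equations of order 1, where no translated values occur, solved for the
  series: the first has Abel sum 1, the second has Abel sum \<open>Z.dser\<close>. The factor
  \<open>q $ 0 + q $ 1 - 1 - 1\<close> is \<open>v q - 1\<close> for the family
  \<open>Z\<close>.\<close>

definition zeta2_explicit :: "complex ^ 2 \<Rightarrow> complex" where
  "zeta2_explicit q = ((1 + Z.rem_ser 1 q) * inverse (q $ 0 + q $ 1 - 1 - 1) + D.rem_ser 1 q) * inverse (q $ 1 - 1)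
      - Z.dser (q + axis 1 1)"

text \<open>Both functions are meromorphic on a convex set and coincide near (0, 3). On the polar
  lines \<open>inverse 0 = 0\<close> gives the formula default values, hence agreement off a thin
  set only.\<close>

lemma zeta2_explicit_thin_eq:
  assumes p: "p \<in> D.shifted 1"
  shows "\<exists>e>0. thin_eq mzeta zeta2_explicit p e"
proof -
  have m1: "mholo_on (\<lambda>q. - Z.dser (q + axis 1 1)) (D.shifted 1)"
  proof -
    have "mholo_on (\<lambda>q. Z.dser (q + axis 1 1)) (D.shifted 1)"
      by (rule mholo_on_translate[OF Z.dser_holo]) (auto simp: D_shifted halfspace2_def)
    from mholo_on_diff[OF mholo_on_const[of 0] this] show ?thesis by simp
  qed
  have m2: "mmero_on (\<lambda>q. 1 + Z.rem_ser 1 q) (D.shifted 1)"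
    by (intro mmero_on_subset[OF _ D_shifted_subset_Z] mholo_imp_mmero_on mholo_on_add mholo_on_const
         Z.rem_ser_holo Z.open_shifted)
  have m3: "mmero_on (D.rem_ser 1) (D.shifted 1)"
    by (intro mholo_imp_mmero_on D.rem_ser_holo D.open_shifted)
  have "mmero_on (\<lambda>q. ((1 + Z.rem_ser 1 q) * inverse (q $ 0 + q $ 1 - 1 - 1) + D.rem_ser 1 q) * inverse (q $ 1 - 1)
      + - Z.dser (q + axis 1 1)) (D.shifted 1)"
    by (intro mmero_on_add mmero_on_mult m2 m3 mholo_imp_mmero_on[OF m1 D.open_shifted]
       mmero_on_subset[OF Z.mmero_inverse_v] mmero_on_subset[OF D.mmero_inverse_v]) auto
  then have E: "mmero_on zeta2_explicit (D.shifted 1)" by (simp add: zeta2_explicit_def[abs_def])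
  have M: "mmero_on mzeta (D.shifted 1)"
    using mzeta_continuation2 by (auto simp: mzeta_continuation_def nicely_mmero_iff nicely_on_def intro: mmero_on_subset)
  obtain e0 where e0: "e0 > 0" "ball (pt2 0 3) e0 \<subseteq> region2"
    using D.open_S pt2_mem_region2 open_contains_ball by blast
  show ?thesis
  proof (rule mmero_on_identity[OF M E D.open_shifted convex_D_shifted _ e0(1) _ p])
    show "pt2 0 3 \<in> D.shifted 1" by (simp add: D_shifted)
    fix q assume "q \<in> ball (pt2 0 3) e0"
    then have q: "q \<in> region2" using e0 by blast
    then have q': "q \<in> halfspace2" using region2_subset by blast
    have n1: "q $ 0 + q $ 1 - 1 - 1 \<noteq> 0" "q $ 1 - 1 \<noteq> 0"
      using q by (auto simp: region2_def complex_eq_iff)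
    have solve: "y = z * inverse x" if "x * y = z" "x \<noteq> 0" for x y z :: complex
      using that by (auto simp: field_simps)
    have "(q $ 0 + q $ 1 - 1 - 1) * Z.dser q = 1 + Z.rem_ser 1 q"
      using Z.functional_equation[OF q', of 1] Z_abel_ser[OF q'] by simp
    then have 1: "Z.dser q = (1 + Z.rem_ser 1 q) * inverse (q $ 0 + q $ 1 - 1 - 1)"
      using n1(1) by (rule solve)
    have "(q $ 1 - 1) * D.dser q = Z.dser q + D.rem_ser 1 q"
      using D.functional_equation[OF q, of 1] D_abel_ser[OF q] by simp
    then have "D.dser q = (Z.dser q + D.rem_ser 1 q) * inverse (q $ 1 - 1)"
      using n1(2) by (rule solve)
    then show "mzeta q = zeta2_explicit q"
      using q mzeta_series2_dser[OF q] mzeta_eq_series[of q] 1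
      by (simp add: zeta2_explicit_def mzeta_region2_eq)
  qed
qed

text \<open>Away from its two polar lines the explicit formula is holomorphic, and a normal form
  must then take its value.\<close>

lemma mzeta2_regular:
  assumes p: "p \<in> D.shifted 1" "p $ 1 \<noteq> 1" "p $ 0 + p $ 1 \<noteq> 2"
  shows "mzeta p = zeta2_explicit p" "isCont mzeta p" "\<not> mpole mzeta p"
proof -
  define W where "W = D.shifted 1 \<inter> {q. q $ 1 - 1 \<noteq> 0} \<inter> {q. q $ 0 + q $ 1 - 1 - 1 \<noteq> 0}"
  have "open W" unfolding W_def
    by (intro open_Int D.open_shifted open_Collect_neq continuous_intros)
  moreover have "p \<in> W" using p by (auto simp: W_def)
  ultimately obtain e where e: "e > 0" "ball p e \<subseteq> W" using open_contains_ball by blast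
  have m1: "mholo_on (\<lambda>q. Z.dser (q + axis 1 1)) (D.shifted 1)"
    by (rule mholo_on_translate[OF Z.dser_holo]) (auto simp: D_shifted halfspace2_def)
  have "mholo_on zeta2_explicit W"
    unfolding zeta2_explicit_def[abs_def]
    by (intro mholo_on_diff mholo_on_add mholo_on_mult mholo_on_inverse mholo_on_const mholo_on_nth
          mholo_on_subset[OF m1] mholo_on_subset[OF D.rem_ser_holo] mholo_on_subset[OF Z.rem_ser_holo])
       (use D_shifted_subset_Z[of 1] in \<open>auto simp: W_def\<close>)
  then have h: "mholo_on zeta2_explicit (ball p e)" using e(2) by (rule mholo_on_subset)
  have N: "nicely_on mzeta (UNIV :: (complex ^ 2) set)"
    using mzeta_continuation2 by (simp add: mzeta_continuation_def nicely_mmero_iff)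
  obtain d where d: "d > 0" "thin_eq mzeta zeta2_explicit p d" using zeta2_explicit_thin_eq[OF p(1)] by blast
  show "mzeta p = zeta2_explicit p" "isCont mzeta p" "\<not> mpole mzeta p"
    using nicely_on_mholo_eq[OF N h e(1) UNIV_I d(2,1)] by blast+
qed

text \<open>Makes the no-pole hypothesis usable: it keeps the path off the line s1 + s2 = 2.
  Multiplication by \<open>L\<close> clears both denominators of the explicit formula and gives a
  continuous \<open>E\<close> with \<open>E p = 1\<close>, whereas a holomorphic \<open>g\<close> in
  place of \<open>mzeta\<close> would force \<open>E p = L p * g p = 0\<close>.\<close>

lemma mzeta2_pole:
  assumes p: "p \<in> D.shifted 1" "p $ 1 \<noteq> 1" "p $ 0 + p $ 1 = 2"
  shows "mpole mzeta p"
proof (rule ccontr)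
  assume "\<not> mpole mzeta p"
  then obtain e g where e: "e > 0" "mholo_on g (ball p e)" "thin_eq mzeta g p e" unfolding mpole_iff by blast
  obtain d where d: "d > 0" "thin_eq mzeta zeta2_explicit p d" using zeta2_explicit_thin_eq[OF p(1)] by blast
  define L :: "complex ^ 2 \<Rightarrow> complex" where "L = (\<lambda>q. (q $ 0 + q $ 1 - 1 - 1) * (q $ 1 - 1))"
  define E where "E = (\<lambda>q. (1 + Z.rem_ser 1 q) + (q $ 0 + q $ 1 - 1 - 1) * D.rem_ser 1 q - L q * Z.dser (q + axis 1 1))"
  define m where "m = min d e"
  have m: "m > 0" "ball p m \<subseteq> ball p d" "ball p m \<subseteq> ball p e" using d e by (auto simp: m_def)
  have "thin_eq zeta2_explicit g p m"
    using thin_eq_trans[OF thin_eq_sym[OF thin_eq_subball[OF d(2) m(2,1)]] thin_eq_subball[OF e(3) m(3,1)]] .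
  then obtain h where h: "mholo_on h (ball p m)" "\<exists>q\<in>ball p m. h q \<noteq> 0"
     "\<forall>q\<in>ball p m. h q \<noteq> 0 \<longrightarrow> zeta2_explicit q = g q" unfolding thin_eq_def by blast
  have L: "mholo_on L S" for S
    unfolding L_def by (intro mholo_on_mult mholo_on_diff mholo_on_add mholo_on_nth mholo_on_const)
  have Ln: "\<exists>q\<in>ball p m. L q \<noteq> 0"
  proof -
    \<comment> \<open>A step below \<open>m\<close> stays in the ball, and one below
      \<open>norm (p $ 1 - 1)\<close> cannot make the second factor of \<open>L\<close>
      vanish.\<close>
    define c where "c = min (m / 2) (norm (p $ 1 - 1) / 2)"
    have c: "c > 0" "c < m" "c < norm (p $ 1 - 1)" using m p(2) by (auto simp: c_def min_def)
    define q where "q = p + axis 1 (complex_of_real c)"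
    have "norm (axis 1 (complex_of_real c) :: complex ^ 2) = c" using c
      by (simp add: norm_vec_def L2_set_def sum_2 axis_def)
    then have "q \<in> ball p m" using c by (simp add: q_def dist_norm)
    moreover have "p $ 1 + complex_of_real c - 1 \<noteq> 0"
    proof
      assume "p $ 1 + complex_of_real c - 1 = 0"
      then have "p $ 1 - 1 = - complex_of_real c" by (simp add: algebra_simps add_eq_0_iff)
      then have "norm (p $ 1 - 1) = c" using c by simp
      then show False using c by simp
    qed
    moreover have "L q = of_real c * (p $ 1 + complex_of_real c - 1)"
    proof -
      have "p $ 0 = 2 - p $ 1" using p(3) by (simp add: eq_diff_eq)
      then show ?thesis by (simp add: L_def q_def)
    qed
    ultimately show ?thesis using c by (intro bexI[of _ q]) auto
  qed
  have hL: "mholo_on (\<lambda>q. h q * L q) (ball p m)" "\<exists>q\<in>ball p m. h q * L q \<noteq> 0"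
    using mholo_on_mult[OF h(1) L] mholo_nonzero_mult[OF h(1,2) L Ln] by auto
  have "E q = L q * g q" if q: "q \<in> ball p m" "h q * L q \<noteq> 0" for q
  proof -
    have g: "zeta2_explicit q = g q" using h(3) q by auto
    have n: "q $ 0 + q $ 1 - 1 - 1 \<noteq> 0" "q $ 1 - 1 \<noteq> 0" using q(2) by (auto simp: L_def)
    define x y where "x = q $ 0 + q $ 1 - 1 - 1" and "y = q $ 1 - 1"
    have "x * y * (((1 + Z.rem_ser 1 q) * inverse x + D.rem_ser 1 q) * inverse y - Z.dser (q + axis 1 1))
      = (1 + Z.rem_ser 1 q) + x * D.rem_ser 1 q - x * y * Z.dser (q + axis 1 1)"
      using n unfolding x_def[symmetric] y_def[symmetric] by (simp add: field_simps)
    then show ?thesis unfolding g[symmetric] zeta2_explicit_def E_def L_def x_def y_def by simp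
  qed
  then have "thin_eq E (\<lambda>q. L q * g q) p m" unfolding thin_eq_def using hL by blast
  moreover have "isCont (\<lambda>q. L q * g q) p"
    using mholo_on_mult[OF L e(2)] e(1) by (intro mholo_on_imp_isCont) auto
  moreover have "isCont E p"
  proof (rule mholo_on_imp_isCont[of _ "D.shifted 1"])
    have m1: "mholo_on (\<lambda>q. Z.dser (q + axis 1 1)) (D.shifted 1)"
      by (rule mholo_on_translate[OF Z.dser_holo]) (auto simp: D_shifted halfspace2_def)
    show "mholo_on E (D.shifted 1)"
      unfolding E_def
      by (intro mholo_on_diff mholo_on_add mholo_on_mult mholo_on_const mholo_on_nth L m1
          D.rem_ser_holo mholo_on_subset[OF Z.rem_ser_holo D_shifted_subset_Z])
  qed (rule p)
  ultimately have "E p = L p * g p" using m(1) by (intro thin_eq_imp_eq) auto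
  moreover have "L p = 0" using p(3) by (simp add: L_def)
  \<comment> \<open>At exponent 1 the expanded function \<open>x powr (1 - 1)\<close> is constant,
    so all its Taylor remainders vanish and the numerator reduces to the Abel sum 1.\<close>
  moreover have "Z.rem_ser 1 p = 0"
  proof -
    have "powr_rem 1 (Suc n) 1 = 0" for n by (simp add: powr_rem_def del: of_nat_Suc)
    then show ?thesis unfolding Z.rem_ser_def using p(3) by simp
  qed
  ultimately show False using p(3) by (simp add: E_def)
qed

section \<open>Mean values of Dirichlet polynomials\<close>

lemma powr_rem_1: "powr_rem 1 n s = of_nat (Suc n) powr (1 - s) - of_nat n powr (1 - s) - (1 - s) * of_nat n powr (- s)"
  by (simp add: powr_rem_def)

text \<open>Taylor's formula with integral remainder. This form is chosen because, for fixed
  \<open>\<theta>\<close>, summing over \<open>n\<close> gives a Dirichlet polynomial with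
  frequencies \<open>ln (n + \<theta>)\<close>, to which a mean value estimate applies.\<close>

lemma powr_rem_1_integral:
  assumes "n \<ge> 1"
  shows "((\<lambda>\<theta>. s * (s - 1) * (of_real (1 - \<theta>) * of_real (real n + \<theta>) powr (- s - 1))) has_integral powr_rem 1 n s) {0..1}"
proof -
  \<comment> \<open>With \<open>f x = x powr (1 - s)\<close> this is
    \<open>f (n + z) + (1 - z) * f' (n + z)\<close>, whose derivative is
    \<open>(1 - z) * f'' (n + z)\<close>.\<close>
  define \<Phi> where "\<Phi> = (\<lambda>z. (of_nat n + z) powr (1 - s) + (1 - z) * ((1 - s) * (of_nat n + z) powr (- s)))"
  have "((\<lambda>x. \<Phi> (of_real x)) has_vector_derivative
      s * (s - 1) * (of_real (1 - x) * of_real (real n + x) powr (- s - 1))) (at x within {0..1})"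
    if x: "x \<in> {0..1}" for x
  proof -
    have nz: "of_nat n + complex_of_real x \<notin> \<real>\<^sub>\<le>\<^sub>0"
      using x assms by (auto simp: complex_nonpos_Reals_iff)
    have d: "((\<lambda>z. (of_nat n + z) powr r) has_field_derivative r * (of_nat n + of_real x) powr (r - 1)) (at (complex_of_real x))" for r
    proof -
      have "((\<lambda>z. of_nat n + z) has_field_derivative 1) (at (complex_of_real x))"
        by (auto intro!: derivative_eq_intros)
      from DERIV_chain2[where f = "\<lambda>z. z powr r", OF has_field_derivative_powr[OF nz] this]
      show ?thesis by simp
    qed
    have "(\<Phi> has_field_derivative ((1 - s) * (of_nat n + of_real x) powr (1 - s - 1) +
        ((1 - of_real x) * ((1 - s) * (- s * (of_nat n + of_real x) powr (- s - 1))) + (0 - 1) * ((1 - s) * (of_nat n + of_real x) powr (- s)))))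
        (at (complex_of_real x))"
      unfolding \<Phi>_def by (intro DERIV_add d DERIV_mult' DERIV_cmult DERIV_diff DERIV_const DERIV_ident)
    then have "(\<Phi> has_field_derivative (s * (s - 1) * (of_real (1 - x) * of_real (real n + x) powr (- s - 1)))) (at (complex_of_real x))"
      by (rule DERIV_cong) (simp add: algebra_simps)
    then show ?thesis
      by (intro has_vector_derivative_real_field)
  qed
  then have "((\<lambda>\<theta>. s * (s - 1) * (of_real (1 - \<theta>) * of_real (real n + \<theta>) powr (- s - 1))) has_integral \<Phi> (of_real 1) - \<Phi> (of_real 0)) {0..1}"
    by (intro fundamental_theorem_of_calculus) auto
  moreover have "\<Phi> (of_real 1) - \<Phi> (of_real 0) = powr_rem 1 n s"
    by (simp only: powr_rem_1) (simp add: \<Phi>_def algebra_simps)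
  ultimately show ?thesis by simp
qed

text \<open>In contrast to \<open>powr_rem_bound\<close> the dependence on \<open>s\<close> is
  explicit, since the growth in \<open>t\<close> along the path matters.\<close>

lemma powr_rem_1_bound:
  assumes "n \<ge> 1" "Re s \<ge> - 1"
  shows "norm (powr_rem 1 n s) \<le> norm s * norm (s - 1) * real n powr (- Re s - 1)"
proof -
  have "norm (powr_rem 1 n s) \<le> (norm s * norm (s - 1) * real n powr (- Re s - 1)) * measure lborel (cbox (0::real) 1)"
  proof (rule has_integral_bound)
    show "((\<lambda>\<theta>. s * (s - 1) * (of_real (1 - \<theta>) * of_real (real n + \<theta>) powr (- s - 1))) has_integral powr_rem 1 n s) (cbox 0 1)"
      using powr_rem_1_integral[OF assms(1), of s] by simp
    fix x :: real assume x: "x \<in> cbox 0 1"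
    then have "norm (of_real (real n + x) powr (- s - 1)) = (real n + x) powr (- Re s - 1)"
      using assms by (subst norm_powr_real_powr) auto
    also have "\<dots> \<le> real n powr (- Re s - 1)" using x assms by (intro powr_mono2') auto
    finally have "norm (of_real (1 - x) :: complex) * norm (of_real (real n + x) powr (- s - 1)) \<le> 1 * real n powr (- Re s - 1)"
      using x unfolding norm_of_real by (intro mult_mono) auto
    then show "norm (s * (s - 1) * (of_real (1 - x) * of_real (real n + x) powr (- s - 1))) \<le> norm s * norm (s - 1) * real n powr (- Re s - 1)"
      unfolding norm_mult mult.assoc by (intro mult_left_mono) auto
  qed auto
  then show ?thesis by simp
qed

lemma has_integral_exp_i:
  fixes \<mu> a b :: real
  assumes "\<mu> \<noteq> 0" "a \<le> b"
  shows "\<exists>K. ((\<lambda>t. exp (\<i> * of_real (t * \<mu>))) has_integral K) {a..b} \<and> norm K \<le> 2 / \<bar>\<mu>\<bar>"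
proof (intro exI conjI)
  define \<Phi> where "\<Phi> = (\<lambda>z. exp (\<i> * (z * of_real \<mu>)) / (\<i> * of_real \<mu>))"
  have "((\<lambda>x. \<Phi> (of_real x)) has_vector_derivative exp (\<i> * of_real (x * \<mu>))) (at x within {a..b})" for x
  proof -
    have "(\<Phi> has_field_derivative exp (\<i> * (of_real x * of_real \<mu>))) (at (of_real x))"
      unfolding \<Phi>_def using assms by (auto intro!: derivative_eq_intros simp: mult_ac)
    then show ?thesis using has_vector_derivative_real_field by simp
  qed
  then show "((\<lambda>t. exp (\<i> * of_real (t * \<mu>))) has_integral (\<Phi> (of_real b) - \<Phi> (of_real a))) {a..b}"
    using assms by (intro fundamental_theorem_of_calculus) auto
  have *: "norm (\<Phi> (of_real x)) = 1 / \<bar>\<mu>\<bar>" for x :: real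
    using norm_exp_i_times[of "x * \<mu>"] by (simp add: \<Phi>_def norm_divide norm_mult)
  have "norm (\<Phi> (of_real b) - \<Phi> (of_real a)) \<le> 1 / \<bar>\<mu>\<bar> + 1 / \<bar>\<mu>\<bar>"
    using norm_triangle_ineq4[of "\<Phi> (of_real b)" "\<Phi> (of_real a)"] unfolding * .
  then show "norm (\<Phi> (of_real b) - \<Phi> (of_real a)) \<le> 2 / \<bar>\<mu>\<bar>" by simp
qed

text \<open>After expanding the square, the diagonal gives the main term and every off-diagonal
  exponential is integrated on its own, with the bound
  \<open>2 / \<bar>l m - l n\<bar>\<close>.\<close>

lemma mean_square_exp_sum:
  fixes c :: "'i \<Rightarrow> complex" and l :: "'i \<Rightarrow> real" and a b :: real
  assumes fin: "finite I" and inj: "inj_on l I" and ab: "a \<le> b"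
  shows "norm (integral {a..b} (\<lambda>t. (norm (\<Sum>n\<in>I. c n * exp (\<i> * of_real (t * l n))))\<^sup>2) - (b - a) * (\<Sum>n\<in>I. (norm (c n))\<^sup>2))
     \<le> (\<Sum>m\<in>I. \<Sum>n\<in>I - {m}. norm (c m) * norm (c n) * (2 / \<bar>l m - l n\<bar>))"
proof -
  have ex: "\<exists>K. ((\<lambda>t. exp (\<i> * of_real (t * (l m - l n)))) has_integral K) {a..b} \<and>
      (if m = n then K = of_real (b - a) else norm K \<le> 2 / \<bar>l m - l n\<bar>)" if "m \<in> I" "n \<in> I" for m n
  proof (cases "m = n")
    case True
    then show ?thesis using has_integral_const_real[of "1::complex" a b] ab
      by (auto simp: scaleR_conv_of_real)
  next
    case False
    then have "l m - l n \<noteq> 0" using inj that by (auto dest: inj_onD)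
    from has_integral_exp_i[OF this ab] show ?thesis using False by auto
  qed
  then obtain K where K: "\<And>m n. m \<in> I \<Longrightarrow> n \<in> I \<Longrightarrow> ((\<lambda>t. exp (\<i> * of_real (t * (l m - l n)))) has_integral K m n) {a..b}"
    "\<And>m. m \<in> I \<Longrightarrow> K m m = of_real (b - a)"
    "\<And>m n. m \<in> I \<Longrightarrow> n \<in> I \<Longrightarrow> m \<noteq> n \<Longrightarrow> norm (K m n) \<le> 2 / \<bar>l m - l n\<bar>"
    by metis
  define F where "F = (\<lambda>t::real. \<Sum>n\<in>I. c n * exp (\<i> * of_real (t * l n)))"
  have sq: "of_real ((norm (F t))\<^sup>2) = (\<Sum>m\<in>I. \<Sum>n\<in>I. c m * cnj (c n) * exp (\<i> * of_real (t * (l m - l n))))" for t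
  proof -
    have "of_real ((norm (F t))\<^sup>2) = F t * cnj (F t)" by (metis complex_norm_square)
    also have "\<dots> = (\<Sum>m\<in>I. \<Sum>n\<in>I. (c m * exp (\<i> * of_real (t * l m))) * cnj (c n * exp (\<i> * of_real (t * l n))))"
      by (simp add: F_def sum_product)
    also have "\<dots> = (\<Sum>m\<in>I. \<Sum>n\<in>I. c m * cnj (c n) * exp (\<i> * of_real (t * (l m - l n))))"
    proof (intro sum.cong refl)
      fix m n
      have "exp (\<i> * of_real (t * (l m - l n))) = exp (\<i> * of_real (t * l m)) * exp (- (\<i> * of_real (t * l n)))"
        unfolding exp_add[symmetric] by (simp add: algebra_simps)
      then show "(c m * exp (\<i> * of_real (t * l m))) * cnj (c n * exp (\<i> * of_real (t * l n)))
          = c m * cnj (c n) * exp (\<i> * of_real (t * (l m - l n)))"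
        by (simp add: exp_cnj)
    qed
    finally show ?thesis .
  qed
  define J where "J = (\<Sum>m\<in>I. \<Sum>n\<in>I. c m * cnj (c n) * K m n)"
  have "((\<lambda>t. of_real ((norm (F t))\<^sup>2) :: complex) has_integral J) {a..b}"
    unfolding sq J_def by (intro has_integral_sum fin has_integral_mult_right K)
  then have ir: "((\<lambda>t. (norm (F t))\<^sup>2) has_integral Re J) {a..b}" "J = of_real (Re J)"
  proof -
    assume h: "((\<lambda>t. of_real ((norm (F t))\<^sup>2) :: complex) has_integral J) {a..b}"
    from has_integral_linear[OF h bounded_linear_Re] show "((\<lambda>t. (norm (F t))\<^sup>2) has_integral Re J) {a..b}"
      by (simp add: o_def)
    from has_integral_linear[OF h bounded_linear_Im] have "((\<lambda>t. 0) has_integral Im J) {a..b}"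
      by (simp add: o_def)
    then have "Im J = 0" using has_integral_is_0 has_integral_unique by (metis has_integral_0)
    then show "J = of_real (Re J)" by (simp add: complex_eq_iff)
  qed
  have "J = (\<Sum>m\<in>I. c m * cnj (c m) * K m m + (\<Sum>n\<in>I - {m}. c m * cnj (c n) * K m n))"
    unfolding J_def by (intro sum.cong refl sum.remove fin)
  also have "\<dots> = of_real ((b - a) * (\<Sum>n\<in>I. (norm (c n))\<^sup>2)) + (\<Sum>m\<in>I. \<Sum>n\<in>I - {m}. c m * cnj (c n) * K m n)"
  proof -
    have "(\<Sum>m\<in>I. c m * cnj (c m) * K m m) = (\<Sum>m\<in>I. of_real ((b - a) * (norm (c m))\<^sup>2))"
      by (intro sum.cong refl) (simp only: K(2) complex_norm_square of_real_mult mult.commute)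
    then show ?thesis by (simp add: sum.distrib sum_distrib_left)
  qed
  finally have "J - of_real ((b - a) * (\<Sum>n\<in>I. (norm (c n))\<^sup>2)) = (\<Sum>m\<in>I. \<Sum>n\<in>I - {m}. c m * cnj (c n) * K m n)" by simp
  moreover have "norm (\<Sum>m\<in>I. \<Sum>n\<in>I - {m}. c m * cnj (c n) * K m n) \<le> (\<Sum>m\<in>I. \<Sum>n\<in>I - {m}. norm (c m) * norm (c n) * (2 / \<bar>l m - l n\<bar>))"
  proof (intro sum_norm_le)
    fix m n assume "m \<in> I" "n \<in> I - {m}"
    then have "norm (K m n) \<le> 2 / \<bar>l m - l n\<bar>" by (intro K(3)) auto
    then have "norm (c m) * norm (c n) * norm (K m n) \<le> norm (c m) * norm (c n) * (2 / \<bar>l m - l n\<bar>)"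
      by (intro mult_left_mono) auto
    then show "norm (c m * cnj (c n) * K m n) \<le> norm (c m) * norm (c n) * (2 / \<bar>l m - l n\<bar>)"
      by (simp only: norm_mult complex_mod_cnj)
  qed
  moreover have "J - of_real ((b - a) * (\<Sum>n\<in>I. (norm (c n))\<^sup>2)) = of_real (Re J - (b - a) * (\<Sum>n\<in>I. (norm (c n))\<^sup>2))"
    using ir(2) by simp
  ultimately have "norm (complex_of_real (Re J - (b - a) * (\<Sum>n\<in>I. (norm (c n))\<^sup>2))) \<le> (\<Sum>m\<in>I. \<Sum>n\<in>I - {m}. norm (c m) * norm (c n) * (2 / \<bar>l m - l n\<bar>))"
    by simp
  then have "norm (Re J - (b - a) * (\<Sum>n\<in>I. (norm (c n))\<^sup>2)) \<le> (\<Sum>m\<in>I. \<Sum>n\<in>I - {m}. norm (c m) * norm (c n) * (2 / \<bar>l m - l n\<bar>))"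
    by (simp only: norm_of_real real_norm_def)
  moreover have "integral {a..b} (\<lambda>t. (norm (F t))\<^sup>2) = Re J" using ir(1) by (rule integral_unique)
  ultimately show ?thesis by (simp add: F_def)
qed

lemma ln_diff_lower:
  fixes x y :: real
  assumes "0 < x" "x < y"
  shows "(y - x) / y \<le> ln y - ln x"
proof -
  have "ln (x / y) \<le> x / y - 1" using assms by (intro ln_le_minus_one) auto
  then show ?thesis using assms by (simp add: ln_div field_simps)
qed

text \<open>The zeta value at \<open>1 + \<eta>\<close>.\<close>

definition pzeta :: "real \<Rightarrow> real" where
  "pzeta \<eta> = (\<Sum>n. real (Suc n) powr (- 1 - \<eta>))"

text \<open>The injection \<open>f\<close> makes room for the differences \<open>n - m\<close> with
  \<open>m\<close> fixed.\<close>

lemma sum_le_pzeta: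
  assumes "\<eta> > 0" "finite A" "inj_on f A" "\<And>n. n \<in> A \<Longrightarrow> f n \<ge> (1::nat)"
  shows "(\<Sum>n\<in>A. real (f n) powr (- 1 - \<eta>)) \<le> pzeta \<eta>"
proof -
  have sm: "summable (\<lambda>n. real (Suc n) powr (- 1 - \<eta>))" unfolding summable_Suc_powr using assms by simp
  have "(\<Sum>n\<in>A. real (f n) powr (- 1 - \<eta>)) = (\<Sum>k\<in>(\<lambda>n. f n - 1) ` A. real (Suc k) powr (- 1 - \<eta>))"
  proof (subst sum.reindex)
    show "inj_on (\<lambda>n. f n - 1) A"
    proof (rule inj_onI)
      fix x y assume "x \<in> A" "y \<in> A" "f x - 1 = f y - 1"
      moreover from this have "f x = f y" using assms(4)[of x] assms(4)[of y] by linarith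
      ultimately show "x = y" using assms(3) by (auto dest: inj_onD)
    qed
    show "(\<Sum>n\<in>A. real (f n) powr (- 1 - \<eta>)) = sum ((\<lambda>k. real (Suc k) powr (- 1 - \<eta>)) \<circ> (\<lambda>n. f n - 1)) A"
    proof (intro sum.cong refl)
      fix n assume "n \<in> A"
      then have "Suc (f n - 1) = f n" using assms(4)[of n] by simp
      then show "real (f n) powr (- 1 - \<eta>) = ((\<lambda>k. real (Suc k) powr (- 1 - \<eta>)) \<circ> (\<lambda>n. f n - 1)) n"
        by (simp only: o_def)
    qed
  qed
  also have "\<dots> \<le> pzeta \<eta>" unfolding pzeta_def by (rule sum_le_suminf[OF sm]) (use assms in auto)
  finally show ?thesis .
qed

lemma pzeta_nonneg: "\<eta> > 0 \<Longrightarrow> pzeta \<eta> \<ge> 0"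
  using sum_le_pzeta[of \<eta> "{}" id] by simp

text \<open>The right-hand side is to be summable over \<open>m\<close> and \<open>n - m\<close>
  independently. A factor \<open>n powr (- \<eta>)\<close> is given away to the difference; the
  remaining power of \<open>n\<close> is traded for a power of \<open>m\<close> at the cost of
  \<open>W\<close>, a bound for \<open>x powr (2 * (1 - \<alpha> + \<eta>))\<close> at both
  indices.\<close>

lemma offdiagonal_bound:
  fixes \<alpha> \<eta> W :: real
  assumes mn: "0 < m" "m < n" and \<eta>: "\<eta> \<ge> 0"
    and W: "real m powr (2 - 2 * \<alpha> + 2 * \<eta>) \<le> W" "real n powr (2 - 2 * \<alpha> + 2 * \<eta>) \<le> W"
  shows "real m powr (- \<alpha>) * real n powr (- \<alpha>) * (real n / real (n - m))
     \<le> W * (real m powr (- 1 - \<eta>) * real (n - m) powr (- 1 - \<eta>))"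
proof -
  define x y k \<omega> where "x = real m" and "y = real n" and "k = real (n - m)" and "\<omega> = 2 - 2 * \<alpha> + 2 * \<eta>"
  have pos: "0 < x" "x \<le> y" "0 < y" "0 < k" "k \<le> y" using mn by (auto simp: x_def y_def k_def)
  \<comment> \<open>For a nonpositive exponent \<open>y\<close> may be replaced by the smaller
    \<open>x\<close>. A positive exponent is written as twice itself minus itself: the double goes
    into \<open>W\<close>, and the negative part may be moved to \<open>x\<close>.\<close>
  have y: "y powr (1 - \<alpha> + \<eta>) * x powr (- \<alpha>) \<le> W * x powr (- 1 - \<eta>)"
  proof (cases "1 - \<alpha> + \<eta> \<le> 0")
    case True
    have "y powr (1 - \<alpha> + \<eta>) * x powr (- \<alpha>) \<le> x powr (1 - \<alpha> + \<eta>) * x powr (- \<alpha>)"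
      using pos True by (intro mult_right_mono powr_mono2') auto
    also have "\<dots> = x powr \<omega> * x powr (- 1 - \<eta>)"
      unfolding powr_add[symmetric] \<omega>_def by (intro arg_cong[where f = "\<lambda>a. x powr a"]) simp
    also have "\<dots> \<le> W * x powr (- 1 - \<eta>)"
      using W by (intro mult_right_mono) (auto simp: x_def \<omega>_def)
    finally show ?thesis .
  next
    case False
    have "y powr (1 - \<alpha> + \<eta>) = y powr \<omega> * y powr (\<alpha> - 1 - \<eta>)"
      unfolding powr_add[symmetric] \<omega>_def by (intro arg_cong[where f = "\<lambda>a. y powr a"]) simp
    also have "\<dots> \<le> W * x powr (\<alpha> - 1 - \<eta>)"
      using pos False W(2) by (intro mult_mono powr_mono2') (auto simp: y_def \<omega>_def intro: order_trans[OF powr_ge_zero])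
    finally have "y powr (1 - \<alpha> + \<eta>) * x powr (- \<alpha>) \<le> W * x powr (\<alpha> - 1 - \<eta>) * x powr (- \<alpha>)"
      by (rule mult_right_mono) simp
    also have "\<dots> = W * x powr (- 1 - \<eta>)"
      unfolding mult.assoc powr_add[symmetric] by (intro arg_cong[where f = "\<lambda>a. W * x powr a"]) simp
    finally show ?thesis .
  qed
  have "x powr (- \<alpha>) * y powr (- \<alpha>) * (y / k) = (y powr (1 - \<alpha> + \<eta>) * x powr (- \<alpha>)) * (y powr (- \<eta>) * k powr (- 1))"
  proof -
    have "y powr (1 - \<alpha> + \<eta>) * y powr (- \<eta>) = y powr (- \<alpha>) * y"
      using pos by (simp add: powr_diff powr_minus powr_add divide_inverse)
    then show ?thesis using pos by (simp add: powr_minus divide_inverse mult_ac)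
  qed
  also have "\<dots> \<le> (W * x powr (- 1 - \<eta>)) * (k powr (- \<eta>) * k powr (- 1))"
  proof (rule mult_mono[OF y mult_right_mono])
    show "y powr (- \<eta>) \<le> k powr (- \<eta>)" using pos \<eta> by (intro powr_mono2') auto
    show "0 \<le> W * x powr (- 1 - \<eta>)" using y by (rule order_trans[rotated]) simp
  qed auto
  also have "k powr (- \<eta>) * k powr (- 1) = k powr (- 1 - \<eta>)"
    unfolding powr_add[symmetric] by (intro arg_cong[where f = "\<lambda>a. k powr a"]) simp
  finally show ?thesis by (simp only: x_def y_def k_def mult.assoc)
qed

text \<open>The shift \<open>\<theta>\<close> covers both applications: \<open>\<theta> = 0\<close>
  for the main sum, and all of the unit interval, uniformly, for the remainder kernel. The constant
  8 is 4 for each pair \<open>m < n\<close>, doubled by symmetry.\<close>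

lemma mean_square_dirichlet:
  fixes c :: "nat \<Rightarrow> complex" and T \<theta> K W \<alpha> \<eta> :: real
  assumes T: "T \<ge> 2" and \<theta>: "0 \<le> \<theta>" "\<theta> \<le> 1" and A: "A \<ge> 1" and \<eta>: "\<eta> > 0" and K: "K \<ge> 0"
    and c: "\<And>n. A \<le> n \<Longrightarrow> norm (c n) \<le> K * real n powr (- \<alpha>)"
    and W: "W \<ge> 0" "\<And>n. A \<le> n \<Longrightarrow> n < B \<Longrightarrow> real n powr (2 - 2 * \<alpha> + 2 * \<eta>) \<le> W"
  shows "\<bar>integral {2..T} (\<lambda>t. (norm (\<Sum>n\<in>{A..<B}. c n * exp (\<i> * of_real (t * (- ln (real n + \<theta>))))))\<^sup>2)
        - (T - 2) * (\<Sum>n\<in>{A..<B}. (norm (c n))\<^sup>2)\<bar> \<le> 8 * (K\<^sup>2 * W) * (pzeta \<eta>)\<^sup>2"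
proof -
  define l where "l = (\<lambda>n::nat. - ln (real n + \<theta>))"
  define I where "I = {A..<B}"
  define g where "g = (\<lambda>m n. norm (c m) * norm (c n) * (2 / \<bar>l m - l n\<bar>))"
  \<comment> \<open>The logarithms differ by at least \<open>(n - m) / (n + \<theta>)\<close>, and
    \<open>n + \<theta> \<le> 2 * n\<close> turns the factor 2 into 4.\<close>
  have l: "2 / \<bar>l m - l n\<bar> \<le> 4 * (real n / real (n - m))" if "A \<le> m" "m < n" for m n
  proof -
    have "(real n + \<theta> - (real m + \<theta>)) / (real n + \<theta>) \<le> ln (real n + \<theta>) - ln (real m + \<theta>)"
      using that A \<theta> by (intro ln_diff_lower) auto
    then have 1: "real (n - m) / (real n + \<theta>) \<le> \<bar>l m - l n\<bar>" using that by (simp add: l_def of_nat_diff)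
    have "real n + \<theta> \<le> 2 * real n" using that A \<theta> by linarith
    then have "real (n - m) / (2 * real n) \<le> real (n - m) / (real n + \<theta>)"
      using that A \<theta> by (intro divide_left_mono mult_pos_pos) auto
    with 1 have 2: "real (n - m) / (2 * real n) \<le> \<bar>l m - l n\<bar>" by linarith
    have 3: "real (n - m) / (2 * real n) > 0" using that by auto
    have "2 / \<bar>l m - l n\<bar> \<le> 2 / (real (n - m) / (2 * real n))"
    proof (rule divide_left_mono[OF 2])
      show "0 < \<bar>l m - l n\<bar> * (real (n - m) / (2 * real n))"
        using 2 3 by (intro mult_pos_pos) linarith+
    qed simp
    then show ?thesis by simp
  qed
  have inj: "inj_on l I"
  proof (rule linorder_inj_onI')
    fix m n assume "m \<in> I" "n \<in> I" "m < n"
    then have "ln (real m + \<theta>) < ln (real n + \<theta>)" using A \<theta> by (simp add: I_def)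
    then show "l m \<noteq> l n" by (simp add: l_def)
  qed
  have g4: "g m n \<le> 4 * (K\<^sup>2 * W * (real m powr (- 1 - \<eta>) * real (n - m) powr (- 1 - \<eta>)))" if "m \<in> I" "n \<in> I" "m < n" for m n
  proof -
    have "g m n \<le> (K * real m powr (- \<alpha>)) * (K * real n powr (- \<alpha>)) * (4 * (real n / real (n - m)))"
      unfolding g_def using that K by (intro mult_mono c l) (auto simp: I_def)
    also have "\<dots> = 4 * K\<^sup>2 * (real m powr (- \<alpha>) * real n powr (- \<alpha>) * (real n / real (n - m)))"
      by (simp add: power2_eq_square)
    also have "\<dots> \<le> 4 * K\<^sup>2 * (W * (real m powr (- 1 - \<eta>) * real (n - m) powr (- 1 - \<eta>)))"
      using that A \<eta> W(2) by (intro mult_left_mono offdiagonal_bound) (auto simp: I_def)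
    finally show ?thesis by (simp only: mult.assoc)
  qed
  have gsym: "g m n = g n m" for m n by (simp add: g_def abs_minus_commute mult.commute)
  have half: "(\<Sum>m\<in>I. \<Sum>n\<in>{n\<in>I. m < n}. g m n) \<le> 4 * (K\<^sup>2 * W) * (pzeta \<eta>)\<^sup>2"
  proof -
    have "(\<Sum>m\<in>I. \<Sum>n\<in>{n\<in>I. m < n}. g m n) \<le> (\<Sum>m\<in>I. \<Sum>n\<in>{n\<in>I. m < n}. 4 * (K\<^sup>2 * W * (real m powr (- 1 - \<eta>) * real (n - m) powr (- 1 - \<eta>))))"
      by (intro sum_mono g4) auto
    also have "\<dots> = (\<Sum>m\<in>I. 4 * (K\<^sup>2 * W) * real m powr (- 1 - \<eta>) * (\<Sum>n\<in>{n\<in>I. m < n}. real (n - m) powr (- 1 - \<eta>)))"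
      by (simp add: sum_distrib_left mult_ac)
    also have "\<dots> \<le> (\<Sum>m\<in>I. 4 * (K\<^sup>2 * W) * real m powr (- 1 - \<eta>) * pzeta \<eta>)"
      by (intro sum_mono mult_left_mono sum_le_pzeta \<eta>) (auto simp: I_def W(1) inj_on_def)
    also have "\<dots> = 4 * (K\<^sup>2 * W) * pzeta \<eta> * (\<Sum>m\<in>I. real (id m) powr (- 1 - \<eta>))"
      by (simp add: sum_distrib_left mult_ac)
    also have "\<dots> \<le> 4 * (K\<^sup>2 * W) * pzeta \<eta> * pzeta \<eta>"
      using A by (intro mult_left_mono sum_le_pzeta \<eta> mult_nonneg_nonneg) (auto simp: I_def W(1) pzeta_nonneg[OF \<eta>])
    finally show ?thesis by (simp add: power2_eq_square)
  qed
  have "(\<Sum>m\<in>I. \<Sum>n\<in>I - {m}. g m n) = (\<Sum>m\<in>I. (\<Sum>n\<in>{n\<in>I. m < n}. g m n) + (\<Sum>n\<in>{n\<in>I. n < m}. g m n))"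
  proof (intro sum.cong refl)
    fix m
    have "I - {m} = {n\<in>I. m < n} \<union> {n\<in>I. n < m}" by auto
    moreover have "finite {n\<in>I. m < n}" "finite {n\<in>I. n < m}" by (simp_all add: I_def)
    moreover have "{n\<in>I. m < n} \<inter> {n\<in>I. n < m} = {}" by auto
    ultimately show "(\<Sum>n\<in>I - {m}. g m n) = (\<Sum>n\<in>{n\<in>I. m < n}. g m n) + (\<Sum>n\<in>{n\<in>I. n < m}. g m n)"
      by (simp only: sum.union_disjoint)
  qed
  also have "\<dots> = (\<Sum>m\<in>I. \<Sum>n\<in>{n\<in>I. m < n}. g m n) + (\<Sum>m\<in>I. \<Sum>n\<in>{n\<in>I. n < m}. g m n)"
    by (rule sum.distrib)
  also have "(\<Sum>m\<in>I. \<Sum>n\<in>{n\<in>I. n < m}. g m n) = (\<Sum>m\<in>I. \<Sum>n\<in>{n\<in>I. m < n}. g m n)"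
    by (subst sum.swap_restrict) (simp_all add: I_def gsym)
  finally have "(\<Sum>m\<in>I. \<Sum>n\<in>I - {m}. g m n) \<le> 8 * (K\<^sup>2 * W) * (pzeta \<eta>)\<^sup>2" using half by (simp add: mult_ac)
  moreover have "norm (integral {2..T} (\<lambda>t. (norm (\<Sum>n\<in>I. c n * exp (\<i> * of_real (t * l n))))\<^sup>2) - (T - 2) * (\<Sum>n\<in>I. (norm (c n))\<^sup>2))
     \<le> (\<Sum>m\<in>I. \<Sum>n\<in>I - {m}. g m n)"
    unfolding g_def by (rule mean_square_exp_sum) (use T inj in \<open>auto simp: I_def\<close>)
  ultimately show ?thesis by (simp add: I_def l_def)
qed

text \<open>Nonnegativity of the variance of \<open>norm (g x)\<close> on the unit interval.\<close>

lemma square_integral_le: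
  fixes g :: "real \<Rightarrow> complex"
  assumes "continuous_on {0..1} g"
  shows "(norm (integral {0..1} g))\<^sup>2 \<le> integral {0..1} (\<lambda>x. (norm (g x))\<^sup>2)"
proof -
  define h where "h = (\<lambda>x. norm (g x))"
  have ch: "continuous_on {0..1} h" unfolding h_def by (intro continuous_on_norm assms)
  define k where "k = integral {0..1} h"
  have i: "h integrable_on {0..1}" "(\<lambda>x. (h x)\<^sup>2) integrable_on {0..1}" "(\<lambda>x. (h x - k)\<^sup>2) integrable_on {0..1}"
    by (intro integrable_continuous_real continuous_intros ch)+
  have "0 \<le> integral {0..1} (\<lambda>x. (h x - k)\<^sup>2)" by (intro integral_nonneg i) auto
  also have "(\<lambda>x. (h x - k)\<^sup>2) = (\<lambda>x. (h x)\<^sup>2 - 2 * k * h x + k\<^sup>2)"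
    by (simp add: fun_eq_iff power2_diff mult_ac)
  also have "integral {0..1} \<dots> = integral {0..1} (\<lambda>x. (h x)\<^sup>2) - 2 * k * k + k\<^sup>2"
    by (subst integral_add integral_diff, (intro integrable_diff integrable_on_mult_right i integrable_const_ivl)+)+ (simp add: k_def)
  finally have "k\<^sup>2 \<le> integral {0..1} (\<lambda>x. (h x)\<^sup>2)" by (simp add: power2_eq_square)
  moreover have "norm (integral {0..1} g) \<le> k"
    unfolding k_def h_def by (intro integral_norm_bound_integral integrable_continuous_real assms continuous_on_norm) auto
  ultimately show ?thesis unfolding h_def
    by (meson norm_ge_zero order_trans power_mono)
qed

section \<open>Mean square of the double zeta-function\<close>

lemma suminf_tail_tendsto_0:
  fixes f :: "nat \<Rightarrow> real"
  assumes "summable f"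
  shows "(\<lambda>k. \<Sum>n. f (n + k)) \<longlonglongrightarrow> 0"
proof -
  have "(\<lambda>k. suminf f - (\<Sum>i<k. f i)) \<longlonglongrightarrow> suminf f - suminf f"
    by (intro tendsto_diff tendsto_const summable_LIMSEQ assms)
  then show ?thesis by (simp add: suminf_minus_initial_segment[OF assms])
qed

lemma of_real_powr_exp:
  assumes "x > 0"
  shows "of_real x powr (of_real r + \<i> * of_real t) = of_real (x powr r) * exp (\<i> * of_real (t * ln x))"
proof -
  have "of_real x powr (of_real r + \<i> * of_real t) = exp ((of_real r + \<i> * of_real t) * of_real (ln x))"
    using assms by (simp add: powr_def Ln_of_real)
  also have "\<dots> = exp (of_real (r * ln x)) * exp (\<i> * of_real (t * ln x))"
    unfolding exp_add[symmetric] by (simp add: algebra_simps)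
  also have "exp (of_real (r * ln x)) = (of_real (x powr r) :: complex)"
    using assms by (simp add: powr_def flip: exp_of_real)
  finally show ?thesis .
qed

lemma sum_square_le: "(x + y)\<^sup>2 \<le> 2 * x\<^sup>2 + 2 * y\<^sup>2" for x y :: real
  using zero_le_power2[of "x - y"] unfolding power2_diff power2_sum by linarith

lemma powr_times_self: "x > 0 \<Longrightarrow> x powr a * x = x powr (a + 1)" for x a :: real
  by (simp add: powr_add)

text \<open>The cross term \<open>2 * norm x * norm y\<close> is split by the weighted inequality
  between arithmetic and geometric mean; the weight \<open>\<kappa>\<close> stays free until the
  limit is taken.\<close>

lemma square_perturb:
  fixes x y :: complex
  assumes "\<kappa> > 0"
  shows "\<bar>(norm (x + y))\<^sup>2 - (norm x)\<^sup>2\<bar> \<le> \<kappa> * (norm x)\<^sup>2 + (1 + 1 / \<kappa>) * (norm y)\<^sup>2"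
proof -
  have a: "norm (x + y) \<le> norm x + norm y" "norm x \<le> norm (x + y) + norm y"
    using norm_triangle_ineq[of x y] norm_triangle_ineq[of "x + y" "- y"] by auto
  have k: "2 * norm x * norm y \<le> \<kappa> * (norm x)\<^sup>2 + (1 / \<kappa>) * (norm y)\<^sup>2"
  proof -
    have "0 \<le> (\<kappa> * norm x - norm y)\<^sup>2 / \<kappa>" using assms by simp
    also have "\<dots> = \<kappa> * (norm x)\<^sup>2 - 2 * norm x * norm y + (1 / \<kappa>) * (norm y)\<^sup>2"
      using assms by (simp add: power2_eq_square field_simps)
    finally show ?thesis by simp
  qed
  have "(norm (x + y))\<^sup>2 \<le> (norm x + norm y)\<^sup>2" using a by (intro power_mono) auto
  then have 1: "(norm (x + y))\<^sup>2 - (norm x)\<^sup>2 \<le> 2 * norm x * norm y + (norm y)\<^sup>2"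
    by (simp add: power2_eq_square algebra_simps)
  have 2: "(norm x)\<^sup>2 - (norm (x + y))\<^sup>2 \<le> 2 * norm x * norm y + (norm y)\<^sup>2"
  proof -
    have "(norm x)\<^sup>2 - (norm (x + y))\<^sup>2 = (norm x - norm (x + y)) * (norm x + norm (x + y))"
      by (simp add: power2_eq_square algebra_simps)
    also have "\<dots> \<le> norm y * (norm x + norm (x + y))" using a by (intro mult_right_mono) auto
    also have "\<dots> \<le> norm y * (norm x + (norm x + norm y))" using a by (intro mult_left_mono) auto
    finally show ?thesis by (simp add: power2_eq_square algebra_simps)
  qed
  show ?thesis using 1 2 k by (simp add: abs_le_iff algebra_simps)
qed

text \<open>With \<open>\<kappa>\<close> fixed, \<open>e\<close> tends to 0 and absorbs the large
  factor \<open>1 + 1 / \<kappa>\<close>; what remains is about \<open>\<kappa> * l\<close>, which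
  is arbitrarily small.\<close>

lemma tendsto_of_perturbation:
  fixes a e z :: "real \<Rightarrow> real"
  assumes a: "(a \<longlongrightarrow> l) F" and e: "(e \<longlongrightarrow> 0) F"
    and b: "\<And>\<kappa>. \<kappa> > 0 \<Longrightarrow> \<forall>\<^sub>F T in F. \<bar>z T - a T\<bar> \<le> \<kappa> * a T + (1 + 1 / \<kappa>) * e T"
  shows "(z \<longlongrightarrow> l) F"
proof (rule tendstoI)
  fix \<epsilon> :: real assume \<epsilon>: "\<epsilon> > 0"
  \<comment> \<open>Makes \<open>\<kappa> * l\<close> at most a third of \<open>\<epsilon>\<close>;
    the summand 1 covers \<open>l = 0\<close>.\<close>
  define \<kappa> where "\<kappa> = \<epsilon> / 3 / (\<bar>l\<bar> + 1)"
  have \<kappa>: "\<kappa> > 0" using \<epsilon> by (simp add: \<kappa>_def)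
  have "((\<lambda>T. \<kappa> * a T + (1 + 1 / \<kappa>) * e T + \<bar>a T - l\<bar>) \<longlongrightarrow> \<kappa> * l + (1 + 1 / \<kappa>) * 0 + \<bar>l - l\<bar>) F"
    by (intro tendsto_intros a e)
  moreover have "\<kappa> * l + (1 + 1 / \<kappa>) * 0 + \<bar>l - l\<bar> < \<epsilon>"
  proof -
    have "\<kappa> * l \<le> \<kappa> * (\<bar>l\<bar> + 1)" using \<kappa> by (intro mult_left_mono) auto
    also have "\<dots> = \<epsilon> / 3" unfolding \<kappa>_def by (rule nonzero_eq_divide_eq[THEN iffD1, OF _ refl]) linarith
    finally show ?thesis using \<epsilon> by simp
  qed
  ultimately have "\<forall>\<^sub>F T in F. \<kappa> * a T + (1 + 1 / \<kappa>) * e T + \<bar>a T - l\<bar> < \<epsilon>"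
    by (rule order_tendstoD(2))
  with b[OF \<kappa>] show "\<forall>\<^sub>F T in F. dist (z T) l < \<epsilon>"
    by eventually_elim (simp add: dist_real_def)
qed

text \<open>\<open>\<beta>\<close> is a growth exponent of \<open>H s1\<close> that leaves room
  below \<open>\<sigma> - 1 / 2\<close>, and \<open>c\<close> separates the path from the polar line
  s1 + s2 = 2.\<close>

locale mean_square =
  fixes s1 :: complex and \<sigma> \<beta> C c :: real
  assumes \<sigma>: "\<sigma> > 1 / 2" and s1\<sigma>: "Re s1 + \<sigma> > 3 / 2"
    and \<beta>: "\<beta> \<ge> 0" "\<beta> > 1 - Re s1" "\<beta> < \<sigma> - 1 / 2"
    and C: "C \<ge> 0" "\<And>N. hsum (Re s1) N \<le> C * real N powr \<beta>"
    and c: "c > 0" "\<And>t. t \<ge> 2 \<Longrightarrow> c \<le> norm (s1 + (of_real \<sigma> + \<i> * of_real t) - 1 - 1)"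
begin

text \<open>The room in the exponents: \<open>H s1 n * n powr (- \<sigma>)\<close> is of order
  \<open>n powr (- 1 / 2 - \<delta>)\<close>. The cap at 1 keeps the exponent
  \<open>1 - \<delta>\<close> nonnegative. Its half \<open>\<eta>\<close> makes the off-diagonal
  sums converge.\<close>

definition \<delta> :: real where "\<delta> = min (\<sigma> - 1 / 2 - \<beta>) 1"
definition \<eta> :: real where "\<eta> = \<delta> / 2"

lemma \<delta>: "\<delta> > 0" "\<delta> \<le> 1" "\<beta> - \<sigma> \<le> - 1 / 2 - \<delta>" and \<eta>: "\<eta> > 0" "\<eta> \<le> 1 / 2" "\<delta> = 2 * \<eta>"
  using \<beta> by (auto simp: \<delta>_def \<eta>_def)

definition S :: "real \<Rightarrow> complex" where "S t = of_real \<sigma> + \<i> * of_real t"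
definition U :: "real \<Rightarrow> complex" where "U t = s1 + S t - 1"

text \<open>The first \<open>M\<close> terms of the double series: the outer index is
  \<open>Suc n\<close>, so its coefficient is \<open>H s1 n\<close>.\<close>

definition main_sum :: "nat \<Rightarrow> real \<Rightarrow> complex" where
  "main_sum M t = (\<Sum>n<M. H s1 n * of_nat (Suc n) powr (- S t))"

text \<open>The upper end \<open>L\<close> is finite so that the estimate for finite sums applies;
  it will be chosen in terms of \<open>T\<close>. The divisor \<open>S t - 1\<close> comes from the
  functional equation and cancels against the same factor in the integral remainder.\<close>

definition tail_sum :: "nat \<Rightarrow> nat \<Rightarrow> real \<Rightarrow> complex" where
  "tail_sum M L t = (\<Sum>n\<in>{M..<L}. H s1 (Suc n) * powr_rem 1 (Suc n) (S t)) / (S t - 1)"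

text \<open>\<open>T\<close> times a bound for the diagonal plus the off-diagonal bound, uniform in
  \<open>\<theta>\<close> and in the upper end of the sum.\<close>

definition tail_bound :: "nat \<Rightarrow> real \<Rightarrow> real" where
  "tail_bound A T = T * (C\<^sup>2 * real A powr (- 2 - \<delta>) * pzeta \<delta>) + 8 * (C\<^sup>2 * real A powr (- 1 - \<eta>)) * (pzeta \<eta>)\<^sup>2"

text \<open>Bounds what lies beyond \<open>M\<close> both in zeta(s1 + s) and in the remainder
  series of the first family.\<close>

definition tau :: "nat \<Rightarrow> real" where
  "tau M = (\<Sum>n. real (Suc (n + M)) powr (- (Re s1 + \<sigma>)))"

definition tau' :: "nat \<Rightarrow> real" where
  "tau' L = (\<Sum>n. real (Suc (n + L)) powr (\<beta> - \<sigma> - 1))"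

lemma S_simps [simp]: "Re (S t) = \<sigma>" "Im (S t) = t"
  by (simp_all add: S_def)

lemma norm_H: "norm (H s1 N) \<le> C * real N powr \<beta>"
  using norm_H_le[of s1 N] C(2)[of N] by linarith

lemma tau_summable: "summable (\<lambda>n. real (Suc n) powr (- (Re s1 + \<sigma>)))"
  unfolding summable_Suc_powr using s1\<sigma> by simp

lemma tau'_summable: "summable (\<lambda>n. real (Suc n) powr (\<beta> - \<sigma> - 1))"
  unfolding summable_Suc_powr using \<beta> by simp

lemma tau_tendsto: "tau \<longlonglongrightarrow> 0"
  unfolding tau_def[abs_def] using suminf_tail_tendsto_0[OF tau_summable] by simp

lemma tau'_tendsto: "tau' \<longlonglongrightarrow> 0"
  unfolding tau'_def[abs_def] using suminf_tail_tendsto_0[OF tau'_summable] by simp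

lemma tau_nonneg: "tau M \<ge> 0"
  unfolding tau_def by (intro suminf_nonneg summable_ignore_initial_segment[OF tau_summable]) simp

text \<open>The two powers telescope; only the linear Taylor term survives as a sum.\<close>

lemma rem_sum_partial:
  "(\<Sum>n<M. powr_rem 1 (Suc n) u) = of_nat (Suc M) powr (1 - u) - 1 + (u - 1) * (\<Sum>n<M. of_nat (Suc n) powr (- u))"
proof (induction M)
  case (Suc M)
  then show ?case unfolding powr_rem_1 by (simp add: algebra_simps del: of_nat_Suc)
qed simp

text \<open>Summation by parts as for the full Abel series, with the boundary term at
  \<open>M\<close> kept.\<close>

lemma H_rem_sum_partial:
  "(\<Sum>n<M. H s1 (Suc n) * powr_rem 1 (Suc n) s) = H s1 M * of_nat (Suc M) powr (1 - s)
     - (\<Sum>n<M. of_nat (Suc n) powr (- (s1 + s - 1))) + (s - 1) * (\<Sum>n<M. H s1 (Suc n) * of_nat (Suc n) powr (- s))"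
proof -
  have 1: "(\<Sum>n<M. H s1 (Suc n) * powr_rem 1 (Suc n) s) =
     (\<Sum>n<M. (s - 1) * (H s1 (Suc n) * of_nat (Suc n) powr (- s)) - H s1 (Suc n) * (of_nat (Suc n) powr (1 - s) - of_nat (Suc (Suc n)) powr (1 - s)))"
    unfolding powr_rem_1 by (intro sum.cong refl) (simp add: algebra_simps del: of_nat_Suc)
  have 2: "of_nat (Suc n) powr (- s1) * of_nat (Suc n) powr (1 - s) = (of_nat (Suc n) powr (- (s1 + s - 1)) :: complex)" for n
    unfolding powr_add[symmetric] by (simp add: algebra_simps del: of_nat_Suc)
  show ?thesis
    unfolding 1 sum_subtractf H_abel_partial[of s1 "\<lambda>n. of_nat n powr (1 - s)"] 2
    by (simp add: sum_distrib_left del: of_nat_Suc)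
qed

text \<open>In the explicit formula the remainder sums up to \<open>M\<close> are evaluated in
  closed form and give back the partial sum of the double series. Four errors remain: the boundary
  terms at \<open>M\<close> (\<open>R1\<close>), the first remainder series beyond \<open>M\<close>
  (\<open>R2\<close>), the second one beyond \<open>L\<close> (\<open>R3\<close>), and zeta(s1 + s)
  beyond \<open>M\<close> (\<open>ZS\<close>).\<close>

lemma remainder_bound:
  assumes t: "t \<ge> 2" and MleL: "M \<le> L"
  shows "norm (mzeta (pt2 s1 (S t)) - main_sum M t - tail_sum M L t)
     \<le> (1 / c + C) * real (Suc M) powr (1 / 2 - \<delta>) / t + (norm s1 + 2) * tau M + (\<sigma> + t) * C * tau' L"
proof -
  define s u q where "s = S t" and "u = U t" and "q = pt2 s1 s"
  have us: "u = s1 + s - 1" by (simp add: u_def U_def s_def)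
  have q01: "q $ 0 = s1" "q $ 1 = s" by (simp_all add: q_def)
  have qD: "q \<in> D.shifted 1" using \<sigma> s1\<sigma> by (simp add: D_shifted q01 s_def)
  have qZ: "q \<in> Z.shifted 1" using qD D_shifted_subset_Z by blast
  have ns1: "norm (s - 1) \<ge> t" using abs_Im_le_cmod[of "s - 1"] t by (simp add: s_def)
  have nu1: "norm (u - 1) \<ge> c" using c(2)[OF t] by (simp add: us s_def S_def)
  have s1n: "s - 1 \<noteq> 0" "u - 1 \<noteq> 0" using ns1 nu1 t c by auto
  have u2: "u - 1 = s1 + s - 1 - 1" by (simp add: us)
  have zeq: "mzeta q = ((1 + Z.rem_ser 1 q) * inverse (u - 1) + D.rem_ser 1 q) * inverse (s - 1) - Z.dser (q + axis 1 1)"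
    using mzeta2_regular(1)[OF qD] s1n by (auto simp: zeta2_explicit_def q01 us)
  have sZ: "summable (\<lambda>n. powr_rem 1 (Suc n) u)"
    using locally_dominated_summable[OF Z.rem_dom qZ] by (simp add: q01 us)
  have sD: "summable (\<lambda>n. H s1 (Suc n) * powr_rem 1 (Suc n) s)"
    using locally_dominated_summable[OF D.rem_dom qD] by (simp add: q01)
  have q'Z: "q + axis 1 1 \<in> halfspace2" using s1\<sigma> by (simp add: halfspace2_def q01 s_def)
  have sS: "summable (\<lambda>n. of_nat (Suc n) powr (- (s1 + s)) :: complex)"
    using locally_dominated_summable[OF Z.dom q'Z] by (simp add: q01 del: of_nat_Suc)
  define ZR where "ZR = (\<Sum>n. powr_rem 1 (Suc (n + M)) u)"
  define DR where "DR = (\<Sum>n. H s1 (Suc (n + L)) * powr_rem 1 (Suc (n + L)) s)"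
  define ZS where "ZS = (\<Sum>n. of_nat (Suc (n + M)) powr (- (s1 + s)) :: complex)"
  have e1: "Z.rem_ser 1 q = ZR + (\<Sum>n<M. powr_rem 1 (Suc n) u)"
    unfolding Z.rem_ser_def ZR_def using suminf_split_initial_segment[OF sZ, of M] by (simp add: q01 us)
  have e2: "D.rem_ser 1 q = DR + (\<Sum>n<L. H s1 (Suc n) * powr_rem 1 (Suc n) s)"
    unfolding D.rem_ser_def DR_def using suminf_split_initial_segment[OF sD, of L] by (simp add: q01)
  have e3: "Z.dser (q + axis 1 1) = ZS + (\<Sum>n<M. of_nat (Suc n) powr (- (s1 + s)))"
    unfolding Z.dser_def ZS_def using suminf_split_initial_segment[OF sS, of M] by (simp add: q01 del: of_nat_Suc)
  have e4: "(\<Sum>n<L. H s1 (Suc n) * powr_rem 1 (Suc n) s) = (\<Sum>n<M. H s1 (Suc n) * powr_rem 1 (Suc n) s) + (s - 1) * tail_sum M L t"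
  proof -
    have "(\<Sum>n<L. H s1 (Suc n) * powr_rem 1 (Suc n) s) = (\<Sum>n<M. H s1 (Suc n) * powr_rem 1 (Suc n) s) + (\<Sum>n\<in>{M..<L}. H s1 (Suc n) * powr_rem 1 (Suc n) s)"
      unfolding lessThan_atLeast0 by (rule sum.atLeastLessThan_concat[symmetric]) (use MleL in auto)
    then show ?thesis using s1n by (simp add: tail_sum_def s_def)
  qed
  have e5: "(\<Sum>n<M. H s1 (Suc n) * of_nat (Suc n) powr (- s)) = main_sum M t + (\<Sum>n<M. of_nat (Suc n) powr (- (s1 + s)))"
  proof -
    have "H s1 (Suc n) * of_nat (Suc n) powr (- s) = H s1 n * of_nat (Suc n) powr (- s) + of_nat (Suc n) powr (- (s1 + s))" for n
    proof -
      have "of_nat (Suc n) powr (- s1) * of_nat (Suc n) powr (- s) = (of_nat (Suc n) powr (- (s1 + s)) :: complex)"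
        unfolding powr_add[symmetric] by (simp add: algebra_simps del: of_nat_Suc)
      then show ?thesis unfolding H_Suc ring_distribs by simp
    qed
    then show ?thesis by (simp only: main_sum_def s_def sum.distrib)
  qed
  \<comment> \<open>This partial sum of zeta(s1 + s - 1) enters through both remainder sums and
    cancels in the end.\<close>
  define X where "X = (\<Sum>n<M. of_nat (Suc n) powr (- u) :: complex)"
  have e6: "(\<Sum>n<M. powr_rem 1 (Suc n) u) = of_nat (Suc M) powr (1 - u) - 1 + (u - 1) * X"
    unfolding X_def by (rule rem_sum_partial)
  have e7: "(\<Sum>n<M. H s1 (Suc n) * powr_rem 1 (Suc n) s) = H s1 M * of_nat (Suc M) powr (1 - s) - X
       + (s - 1) * (main_sum M t + (\<Sum>n<M. of_nat (Suc n) powr (- (s1 + s))))"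
    unfolding H_rem_sum_partial e5 X_def us ..
  define R1 where "R1 = (of_nat (Suc M) powr (1 - u) * inverse (u - 1) + H s1 M * of_nat (Suc M) powr (1 - s)) * inverse (s - 1)"
  define R2 where "R2 = ZR * inverse (u - 1) * inverse (s - 1)"
  define R3 where "R3 = DR * inverse (s - 1)"
  have "mzeta q = main_sum M t + tail_sum M L t + (R1 + R2 + R3 - ZS)"
  proof -
    have alg: "((1 + (z + (p - 1 + x * w))) * inverse x + (d + (q - w + y * (a + v) + y * e))) * inverse y - (b + v)
       = a + e + ((p * inverse x + q) * inverse y + z * inverse x * inverse y + d * inverse y - b)"
      if "x \<noteq> 0" "y \<noteq> 0" for x y z p w d q a v e b :: complex
      using that by (simp add: field_simps)
    have "mzeta q = ((1 + (ZR + (of_nat (Suc M) powr (1 - u) - 1 + (u - 1) * X))) * inverse (u - 1)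
       + (DR + (H s1 M * of_nat (Suc M) powr (1 - s) - X
       + (s - 1) * (main_sum M t + (\<Sum>n<M. of_nat (Suc n) powr (- (s1 + s)))) + (s - 1) * tail_sum M L t))) * inverse (s - 1)
       - (ZS + (\<Sum>n<M. of_nat (Suc n) powr (- (s1 + s))))"
      unfolding zeq e1 e2 e3 e4 e6 e7 by simp
    also have "\<dots> = main_sum M t + tail_sum M L t + (R1 + R2 + R3 - ZS)"
      unfolding R1_def R2_def R3_def by (rule alg[OF s1n(2,1)])
    finally show ?thesis .
  qed
  then have "norm (mzeta q - main_sum M t - tail_sum M L t) = norm (R1 + R2 + R3 - ZS)"
    by (simp only: diff_diff_eq add_diff_cancel_left')
  also have "\<dots> \<le> norm R1 + norm R2 + norm R3 + norm ZS"
    by (rule order_trans[OF norm_triangle_ineq4 add_right_mono[OF norm_triangle_le[OF add_right_mono[OF norm_triangle_ineq]]]])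
  also have "norm R1 \<le> (1 / c + C) * real (Suc M) powr (1 / 2 - \<delta>) / t"
  proof -
    \<comment> \<open>Since \<open>\<beta> > 1 - Re s1\<close>, the exponent
      \<open>1 - Re u = 2 - Re s1 - \<sigma>\<close> lies below
      \<open>1 + \<beta> - \<sigma>\<close>, which is at most
      \<open>1 / 2 - \<delta>\<close>.\<close>
    have "norm (of_nat (Suc M) powr (1 - u) :: complex) \<le> real (Suc M) powr (1 / 2 - \<delta>)"
      unfolding norm_nat_powr using \<delta>(3) \<beta>(2) by (intro powr_mono) (auto simp: us s_def)
    moreover have "norm (inverse (u - 1)) \<le> 1 / c"
      using nu1 c(1) by (simp add: norm_inverse divide_inverse le_imp_inverse_le)
    ultimately have a: "norm (of_nat (Suc M) powr (1 - u) * inverse (u - 1)) \<le> real (Suc M) powr (1 / 2 - \<delta>) * (1 / c)"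
      unfolding norm_mult by (intro mult_mono) auto
    have "norm (H s1 M) \<le> C * real (Suc M) powr \<beta>"
      using norm_H[of M] C(1) \<beta>(1) by (elim order_trans) (auto intro!: mult_left_mono powr_mono2)
    then have "norm (H s1 M) * norm (of_nat (Suc M) powr (1 - s) :: complex) \<le> C * real (Suc M) powr \<beta> * real (Suc M) powr (1 - \<sigma>)"
      unfolding norm_nat_powr by (intro mult_mono) (auto simp: s_def C)
    also have "\<dots> = C * real (Suc M) powr (\<beta> + (1 - \<sigma>))" by (simp only: mult.assoc powr_add)
    also have "\<dots> \<le> C * real (Suc M) powr (1 / 2 - \<delta>)" using \<delta>(3) C(1) by (intro mult_left_mono powr_mono) auto
    finally have b: "norm (H s1 M * of_nat (Suc M) powr (1 - s)) \<le> C * real (Suc M) powr (1 / 2 - \<delta>)"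
      by (simp add: norm_mult)
    have "norm (inverse (s - 1)) \<le> 1 / t" using ns1 t by (simp add: norm_inverse divide_inverse le_imp_inverse_le)
    then have "norm R1 \<le> (real (Suc M) powr (1 / 2 - \<delta>) * (1 / c) + C * real (Suc M) powr (1 / 2 - \<delta>)) * (1 / t)"
      unfolding R1_def norm_mult[of _ "inverse (s - 1)"] using c(1) C(1)
      by (intro mult_mono order_trans[OF norm_triangle_ineq add_mono[OF a b]]) auto
    then show ?thesis by (simp add: algebra_simps add_divide_distrib)
  qed
  also have "norm R2 \<le> (norm s1 + 1) * tau M"
  proof -
    have "norm ZR \<le> norm u * norm (u - 1) * tau M"
    proof -
      have sm: "summable (\<lambda>n. norm u * norm (u - 1) * real (Suc (n + M)) powr (- (Re s1 + \<sigma>)))"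
        using summable_ignore_initial_segment[OF tau_summable, of M] by (intro summable_mult) simp
      have "norm (powr_rem 1 (Suc (n + M)) u) \<le> norm u * norm (u - 1) * real (Suc (n + M)) powr (- (Re s1 + \<sigma>))" for n
        using powr_rem_1_bound[of "Suc (n + M)" u] s1\<sigma> by (simp add: us s_def algebra_simps del: of_nat_Suc)
      then have "norm ZR \<le> (\<Sum>n. norm u * norm (u - 1) * real (Suc (n + M)) powr (- (Re s1 + \<sigma>)))"
        unfolding ZR_def by (intro norm_suminf_le sm)
      also have "\<dots> = norm u * norm (u - 1) * tau M"
        unfolding tau_def using summable_ignore_initial_segment[OF tau_summable, of M]
        by (intro suminf_mult) simp
      finally show ?thesis .
    qed
    \<comment> \<open>The remainder carries the factor \<open>u * (u - 1)\<close>. The part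
      \<open>u - 1\<close> cancels, and comparing \<open>u\<close> with \<open>s - 1\<close> removes
      all growth in \<open>t\<close>.\<close>
    moreover have "norm u \<le> (norm s1 + 1) * norm (s - 1)"
    proof -
      have "norm u \<le> norm s1 + norm (s - 1)" using norm_triangle_ineq[of s1 "s - 1"] by (simp add: us algebra_simps)
      also have "norm s1 \<le> norm s1 * norm (s - 1)" using ns1 t by (simp add: mult_le_cancel_left1)
      finally show ?thesis by (simp add: algebra_simps)
    qed
    ultimately have "norm ZR \<le> ((norm s1 + 1) * norm (s - 1)) * norm (u - 1) * tau M"
      using tau_nonneg by (elim order_trans) (intro mult_right_mono, auto)
    then have "norm R2 \<le> ((norm s1 + 1) * norm (s - 1)) * norm (u - 1) * tau M * norm (inverse (u - 1)) * norm (inverse (s - 1))"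
      unfolding R2_def norm_mult by (intro mult_right_mono) auto
    also have "\<dots> = (norm s1 + 1) * tau M" using s1n by (simp add: norm_inverse norm_divide field_simps)
    finally show ?thesis .
  qed
  also have "norm R3 \<le> (\<sigma> + t) * C * tau' L"
  proof -
    have sm: "summable (\<lambda>n. norm s * norm (s - 1) * C * real (Suc (n + L)) powr (\<beta> - \<sigma> - 1))"
      using summable_ignore_initial_segment[OF tau'_summable, of L] by (intro summable_mult) simp
    have "norm (H s1 (Suc (n + L)) * powr_rem 1 (Suc (n + L)) s) \<le> norm s * norm (s - 1) * C * real (Suc (n + L)) powr (\<beta> - \<sigma> - 1)" for n
    proof -
      have "norm (H s1 (Suc (n + L))) * norm (powr_rem 1 (Suc (n + L)) s)
          \<le> (C * real (Suc (n + L)) powr \<beta>) * (norm s * norm (s - 1) * real (Suc (n + L)) powr (- \<sigma> - 1))"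
        using powr_rem_1_bound[of "Suc (n + L)" s] \<sigma> norm_H[of "Suc (n + L)"] C(1)
        by (intro mult_mono) (auto simp: s_def simp del: of_nat_Suc)
      also have "\<dots> = norm s * norm (s - 1) * C * (real (Suc (n + L)) powr \<beta> * real (Suc (n + L)) powr (- \<sigma> - 1))"
        by (simp only: mult_ac)
      also have "real (Suc (n + L)) powr \<beta> * real (Suc (n + L)) powr (- \<sigma> - 1) = real (Suc (n + L)) powr (\<beta> - \<sigma> - 1)"
        unfolding powr_add[symmetric] by (intro arg_cong[where f = "\<lambda>x. real (Suc (n + L)) powr x"]) simp
      finally show ?thesis by (simp add: norm_mult)
    qed
    then have "norm DR \<le> (\<Sum>n. norm s * norm (s - 1) * C * real (Suc (n + L)) powr (\<beta> - \<sigma> - 1))"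
      unfolding DR_def by (intro norm_suminf_le sm)
    also have "\<dots> = norm s * norm (s - 1) * C * tau' L"
      unfolding tau'_def using summable_ignore_initial_segment[OF tau'_summable, of L]
      by (intro suminf_mult) simp
    finally have "norm R3 \<le> norm s * norm (s - 1) * C * tau' L * norm (inverse (s - 1))"
      unfolding R3_def norm_mult by (intro mult_right_mono) auto
    also have "\<dots> = norm s * (C * tau' L)" using s1n by (simp add: norm_inverse norm_divide field_simps)
    \<comment> \<open>This error does grow with \<open>t\<close>, but it will be made small by
      taking \<open>L\<close> large for given \<open>T\<close>.\<close>
    also have "\<dots> \<le> (\<sigma> + t) * (C * tau' L)"
    proof (intro mult_right_mono mult_nonneg_nonneg C(1))
      show "norm s \<le> \<sigma> + t" using cmod_le[of s] \<sigma> t by (simp add: s_def)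
      show "tau' L \<ge> 0" unfolding tau'_def using summable_ignore_initial_segment[OF tau'_summable, of L]
        by (intro suminf_nonneg) auto
    qed
    finally show ?thesis by (simp add: mult.assoc)
  qed
  also have "norm ZS \<le> tau M"
  proof -
    have "norm ZS \<le> (\<Sum>n. real (Suc (n + M)) powr (- (Re s1 + \<sigma>)))"
      unfolding ZS_def
    proof (rule norm_suminf_le)
      show "summable (\<lambda>n. real (Suc (n + M)) powr (- (Re s1 + \<sigma>)))"
        using summable_ignore_initial_segment[OF tau_summable, of M] by simp
    qed (simp add: norm_nat_powr s_def del: of_nat_Suc)
    then show ?thesis by (simp add: tau_def)
  qed
  finally show ?thesis by (simp add: q_def s_def algebra_simps)
qed

text \<open>The estimate for Dirichlet polynomials with \<open>\<theta> = 0\<close> and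
  \<open>\<alpha> = 1 / 2 + \<delta>\<close>. Because \<open>\<delta> = 2 * \<eta>\<close>, the
  exponent \<open>2 - 2 * \<alpha> + 2 * \<eta>\<close> equals \<open>1 - \<delta>\<close>, so the
  error is o(T) when \<open>M\<close> is of size \<open>T\<close>.\<close>

lemma main_sum_mean_square:
  assumes T: "T \<ge> 2"
  shows "\<bar>integral {2..T} (\<lambda>t. (norm (main_sum M t))\<^sup>2) - (T - 2) * (\<Sum>n<M. (norm (H s1 n))\<^sup>2 * real (Suc n) powr (- (2 * \<sigma>)))\<bar>
     \<le> 8 * (C\<^sup>2 * real (Suc M) powr (1 - \<delta>)) * (pzeta \<eta>)\<^sup>2"
proof -
  define d where "d = (\<lambda>n. H s1 (n - 1) * of_real (real n powr (- \<sigma>)))"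
  have nd: "norm (d n) \<le> C * real n powr (- (1 / 2 + \<delta>))" if "n \<ge> 1" for n
  proof -
    have "norm (H s1 (n - 1)) \<le> C * real n powr \<beta>"
      using norm_H[of "n - 1"] C(1) \<beta>(1) by (elim order_trans) (auto intro!: mult_left_mono powr_mono2)
    then have "norm (d n) \<le> C * real n powr \<beta> * real n powr (- \<sigma>)"
      unfolding d_def norm_mult by (intro mult_mono) (auto simp: C)
    also have "\<dots> = C * real n powr (\<beta> - \<sigma>)" by (simp add: mult.assoc flip: powr_add)
    also have "\<dots> \<le> C * real n powr (- (1 / 2 + \<delta>))" using \<delta>(3) C(1) that by (intro mult_left_mono powr_mono) auto
    finally show ?thesis .
  qed
  have 1: "main_sum M t = (\<Sum>n\<in>{1..<Suc M}. d n * exp (\<i> * of_real (t * (- ln (real n + 0)))))" for t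
  proof -
    have "main_sum M t = (\<Sum>n<M. d (Suc n) * exp (\<i> * of_real (t * (- ln (real (Suc n) + 0)))))"
      unfolding main_sum_def
    proof (intro sum.cong refl)
      fix n
      have "of_nat (Suc n) powr (- S t) = complex_of_real (real (Suc n)) powr (of_real (- \<sigma>) + \<i> * of_real (- t))"
        by (simp add: S_def)
      also have "\<dots> = of_real (real (Suc n) powr (- \<sigma>)) * exp (\<i> * of_real (- t * ln (real (Suc n))))"
        by (rule of_real_powr_exp) simp
      finally show "H s1 n * of_nat (Suc n) powr (- S t) = d (Suc n) * exp (\<i> * of_real (t * (- ln (real (Suc n) + 0))))"
        by (simp add: d_def mult_ac del: of_nat_Suc)
    qed
    also have "\<dots> = (\<Sum>n\<in>{1..<Suc M}. d n * exp (\<i> * of_real (t * (- ln (real n + 0)))))"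
      unfolding lessThan_atLeast0 One_nat_def by (rule sum.shift_bounds_Suc_ivl[symmetric])
    finally show ?thesis .
  qed
  have 2: "(\<Sum>n<M. (norm (H s1 n))\<^sup>2 * real (Suc n) powr (- (2 * \<sigma>))) = (\<Sum>n\<in>{1..<Suc M}. (norm (d n))\<^sup>2)"
  proof -
    have "(\<Sum>n<M. (norm (H s1 n))\<^sup>2 * real (Suc n) powr (- (2 * \<sigma>))) = (\<Sum>n<M. (norm (d (Suc n)))\<^sup>2)"
    proof (intro sum.cong refl)
      fix n
      have "real (Suc n) powr (- (2 * \<sigma>)) = (real (Suc n) powr (- \<sigma>))\<^sup>2"
        by (simp add: power2_eq_square flip: powr_add del: of_nat_Suc)
      then show "(norm (H s1 n))\<^sup>2 * real (Suc n) powr (- (2 * \<sigma>)) = (norm (d (Suc n)))\<^sup>2"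
        by (simp add: d_def norm_mult power_mult_distrib del: of_nat_Suc)
    qed
    also have "\<dots> = (\<Sum>n\<in>{1..<Suc M}. (norm (d n))\<^sup>2)"
      unfolding lessThan_atLeast0 One_nat_def by (rule sum.shift_bounds_Suc_ivl[symmetric])
    finally show ?thesis .
  qed
  show ?thesis
    unfolding 1 2
  proof (rule mean_square_dirichlet[OF T _ _ _ \<eta>(1) C(1) nd])
    fix n :: nat assume "1 \<le> n" "n < Suc M"
    then have "real n powr (1 - \<delta>) \<le> real (Suc M) powr (1 - \<delta>)" using \<delta> by (intro powr_mono2) auto
    then show "real n powr (2 - 2 * (1 / 2 + \<delta>) + 2 * \<eta>) \<le> real (Suc M) powr (1 - \<delta>)" by (simp add: \<eta>(3))
  qed auto
qed

text \<open>The kernel has an additional \<open>n powr (- 1)\<close>, so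
  \<open>\<alpha> = 3 / 2 + \<delta>\<close> and both parts of the bound decay in \<open>A\<close>.
  With \<open>A\<close> of size \<open>T\<close> this decay outweighs the square of the factor
  \<open>S t\<close> in front of the kernel enough to give o(T).\<close>

lemma tail_kernel_mean_square:
  assumes T: "T \<ge> 2" and \<theta>: "0 \<le> \<theta>" "\<theta> \<le> 1" and A: "A \<ge> 1"
  shows "integral {2..T} (\<lambda>t. (norm (\<Sum>n\<in>{A..<B}. H s1 n * of_real (real n + \<theta>) powr (- S t - 1)))\<^sup>2)
     \<le> tail_bound A T"
proof -
  define d where "d = (\<lambda>n. H s1 n * of_real ((real n + \<theta>) powr (- \<sigma> - 1)))"
  have nd: "norm (d n) \<le> C * real n powr (- (3 / 2 + \<delta>))" if "n \<ge> 1" for n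
  proof -
    have "(real n + \<theta>) powr (- \<sigma> - 1) \<le> real n powr (- \<sigma> - 1)"
      using that \<theta> \<sigma> by (intro powr_mono2') auto
    then have "norm (d n) \<le> C * real n powr \<beta> * real n powr (- \<sigma> - 1)"
      unfolding d_def norm_mult using norm_H[of n] by (intro mult_mono) (auto simp: C)
    also have "\<dots> = C * real n powr (\<beta> - \<sigma> - 1)" by (simp add: mult.assoc add_diff_eq flip: powr_add)
    also have "\<dots> \<le> C * real n powr (- (3 / 2 + \<delta>))" using \<delta>(3) C(1) that by (intro mult_left_mono powr_mono) auto
    finally show ?thesis .
  qed
  have 1: "(\<Sum>n\<in>{A..<B}. H s1 n * of_real (real n + \<theta>) powr (- S t - 1)) =
      (\<Sum>n\<in>{A..<B}. d n * exp (\<i> * of_real (t * (- ln (real n + \<theta>)))))" for t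
  proof (intro sum.cong refl)
    fix n assume "n \<in> {A..<B}"
    then have "real n + \<theta> > 0" using A \<theta> by auto
    from of_real_powr_exp[OF this, of "- \<sigma> - 1" "- t"]
    have "of_real (real n + \<theta>) powr (- S t - 1) = of_real ((real n + \<theta>) powr (- \<sigma> - 1)) * exp (\<i> * of_real (t * (- ln (real n + \<theta>))))"
      by (simp add: S_def algebra_simps)
    then show "H s1 n * of_real (real n + \<theta>) powr (- S t - 1) = d n * exp (\<i> * of_real (t * (- ln (real n + \<theta>))))"
      by (simp add: d_def)
  qed
  have "\<bar>integral {2..T} (\<lambda>t. (norm (\<Sum>n\<in>{A..<B}. d n * exp (\<i> * of_real (t * (- ln (real n + \<theta>))))))\<^sup>2)
        - (T - 2) * (\<Sum>n\<in>{A..<B}. (norm (d n))\<^sup>2)\<bar> \<le> 8 * (C\<^sup>2 * real A powr (- 1 - \<eta>)) * (pzeta \<eta>)\<^sup>2"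
  proof (rule mean_square_dirichlet[OF T \<theta> A \<eta>(1) C(1) nd])
    fix n :: nat assume n: "A \<le> n" "n < B"
    have "real n powr (2 - 2 * (3 / 2 + \<delta>) + 2 * \<eta>) \<le> real n powr (- 1 - \<eta>)"
      using n A \<eta> by (intro powr_mono) auto
    also have "\<dots> \<le> real A powr (- 1 - \<eta>)" using n A \<eta> by (intro powr_mono2') auto
    finally show "real n powr (2 - 2 * (3 / 2 + \<delta>) + 2 * \<eta>) \<le> real A powr (- 1 - \<eta>)" .
  qed (use A in auto)
  moreover have "(\<Sum>n\<in>{A..<B}. (norm (d n))\<^sup>2) \<le> C\<^sup>2 * real A powr (- 2 - \<delta>) * pzeta \<delta>"
  proof -
    \<comment> \<open>The exponent \<open>- 3 - 2 * \<delta>\<close> is split: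
      \<open>- 2 - \<delta>\<close> is evaluated at the smallest index \<open>A\<close>, and
      \<open>- 1 - \<delta>\<close> is summed.\<close>
    have "(\<Sum>n\<in>{A..<B}. (norm (d n))\<^sup>2) \<le> (\<Sum>n\<in>{A..<B}. C\<^sup>2 * real A powr (- 2 - \<delta>) * real (id n) powr (- 1 - \<delta>))"
    proof (intro sum_mono)
      fix n assume n: "n \<in> {A..<B}"
      then have n1: "n \<ge> 1" using A by auto
      have "(norm (d n))\<^sup>2 \<le> (C * real n powr (- (3 / 2 + \<delta>)))\<^sup>2" by (intro power_mono nd n1) auto
      also have "\<dots> = C\<^sup>2 * (real n powr (- 2 - \<delta>) * real n powr (- 1 - \<delta>))"
        by (simp add: power_mult_distrib power2_eq_square[of "real n powr _"] flip: powr_add)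
      also have "\<dots> \<le> C\<^sup>2 * (real A powr (- 2 - \<delta>) * real n powr (- 1 - \<delta>))"
        using n A \<delta> by (intro mult_left_mono mult_right_mono powr_mono2') auto
      finally show "(norm (d n))\<^sup>2 \<le> C\<^sup>2 * real A powr (- 2 - \<delta>) * real (id n) powr (- 1 - \<delta>)" by simp
    qed
    also have "\<dots> \<le> C\<^sup>2 * real A powr (- 2 - \<delta>) * pzeta \<delta>"
      unfolding sum_distrib_left[symmetric] using A \<delta>(1) by (intro mult_left_mono sum_le_pzeta) auto
    finally show ?thesis .
  qed
  moreover from this have "(T - 2) * (\<Sum>n\<in>{A..<B}. (norm (d n))\<^sup>2) \<le> T * (C\<^sup>2 * real A powr (- 2 - \<delta>) * pzeta \<delta>)"
    using T by (intro mult_mono) (auto intro!: sum_nonneg)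
  ultimately show ?thesis unfolding 1 tail_bound_def by linarith
qed

section \<open>Continuity along the path and mean square of the errors\<close>

lemma continuous_S: "continuous_on A S"
  unfolding S_def[abs_def] by (intro continuous_intros)

lemma S_neq_1: "t \<ge> 2 \<Longrightarrow> S t - 1 \<noteq> 0"
  by (auto simp: complex_eq_iff)

lemma continuous_main_sum: "continuous_on A (main_sum M)"
proof -
  have "continuous_on A (\<lambda>t. of_nat (Suc n) powr (- S t) :: complex)" for n
    by (intro continuous_on_powr_complex continuous_intros continuous_S) (auto simp del: of_nat_Suc)
  then show ?thesis unfolding main_sum_def[abs_def] by (intro continuous_on_sum continuous_on_mult continuous_on_const)
qed

lemma continuous_tail_sum: "continuous_on {2..T} (tail_sum M L)"
proof -
  have "continuous_on UNIV (powr_rem 1 n)" for n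
    by (rule holomorphic_on_imp_continuous_on[OF holomorphic_powr_rem])
  then have "continuous_on A (\<lambda>t. powr_rem 1 n (S t))" for n A
    by (rule continuous_on_compose2[OF _ continuous_S]) auto
  then show ?thesis unfolding tail_sum_def[abs_def]
    using S_neq_1 by (intro continuous_intros continuous_S) auto
qed

lemma regular_point:
  assumes t: "t \<ge> 2"
  shows "isCont mzeta (pt2 s1 (S t))"
proof (rule mzeta2_regular(2))
  show "pt2 s1 (S t) \<in> D.shifted 1" using \<sigma> s1\<sigma> by (simp add: D_shifted)
  show "pt2 s1 (S t) $ 1 \<noteq> 1" using S_neq_1[OF t] by simp
  show "pt2 s1 (S t) $ 0 + pt2 s1 (S t) $ 1 \<noteq> 2"
    using c(2)[OF t] c(1) by (auto simp: S_def)
qed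

lemma continuous_mzeta_path: "continuous_on {2..T} (\<lambda>t. mzeta (pt2 s1 (S t)))"
proof (intro continuous_at_imp_continuous_on ballI)
  fix t assume t: "t \<in> {2..T}"
  have "isCont S t" using continuous_S[of UNIV] by (simp add: continuous_on_eq_continuous_at)
  then have "isCont (\<lambda>t. pt2 s1 (S t)) t"
    unfolding pt2_def continuous_within
    by (intro tendsto_vec_lambda) auto
  moreover have "isCont mzeta (pt2 s1 (S t))" using regular_point t by simp
  ultimately show "isCont (\<lambda>t. mzeta (pt2 s1 (S t))) t" by (rule isCont_o2)
qed

text \<open>By the integral remainder the tail is \<open>S t\<close> times an integral over
  \<open>\<theta>\<close> of Dirichlet polynomials. Cauchy--Schwarz moves the square inside, the
  order of integration is exchanged, and for each \<open>\<theta>\<close> the estimate for the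
  kernel applies.\<close>

lemma tail_sum_mean_square:
  assumes T: "T \<ge> 2" and TA: "T \<le> real (Suc M)"
  shows "integral {2..T} (\<lambda>t. (norm (tail_sum M L t))\<^sup>2)
     \<le> (\<sigma> + T)\<^sup>2 * tail_bound (Suc M) T"
proof -
  define F where "F = (\<lambda>t \<theta>. \<Sum>n\<in>{Suc M..<Suc L}. H s1 n * of_real (real n + \<theta>) powr (- S t - 1))"
  have contF: "continuous_on ({2..T} \<times> {0..1}) (\<lambda>(t, \<theta>). F t \<theta>)"
  proof -
    have "continuous_on ({2..T} \<times> {0..1}) (\<lambda>x. of_real (real n + snd x) powr (- S (fst x) - 1))" if "n \<in> {Suc M..<Suc L}" for n
      unfolding S_def
      by (intro continuous_on_powr_complex continuous_intros) (use that in \<open>auto simp: complex_eq_iff\<close>)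
    then show ?thesis unfolding F_def split_def by (intro continuous_on_sum continuous_on_mult continuous_on_const)
  qed
  have contF1: "continuous_on {0..1} (F t)" if "t \<in> {2..T}" for t
  proof -
    have "continuous_on {0..1} (\<lambda>\<theta>::real. (t, \<theta>))" by (intro continuous_intros)
    moreover have "(\<lambda>\<theta>. (t, \<theta>)) ` {0..1} \<subseteq> {2..T} \<times> {0..1}" using that by auto
    ultimately show ?thesis using continuous_on_compose2[OF contF, of "{0..1}" "\<lambda>\<theta>. (t, \<theta>)"] by simp
  qed
  have pointwise: "(norm (tail_sum M L t))\<^sup>2 \<le> (\<sigma> + T)\<^sup>2 * integral {0..1} (\<lambda>\<theta>. (norm (F t \<theta>))\<^sup>2)" if t: "t \<in> {2..T}" for t
  proof -
    define G where "G = (\<lambda>\<theta>::real. of_real (1 - \<theta>) * F t \<theta>)"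
    have cG: "continuous_on {0..1} G" unfolding G_def by (intro continuous_intros contF1 t)
    have "((\<lambda>\<theta>. \<Sum>n\<in>{Suc M..<Suc L}. H s1 n * (S t * (S t - 1) * (of_real (1 - \<theta>) * of_real (real n + \<theta>) powr (- S t - 1))))
        has_integral (\<Sum>n\<in>{Suc M..<Suc L}. H s1 n * powr_rem 1 n (S t))) {0..1}"
      by (intro has_integral_sum has_integral_mult_right powr_rem_1_integral) auto
    also have "(\<lambda>\<theta>. \<Sum>n\<in>{Suc M..<Suc L}. H s1 n * (S t * (S t - 1) * (of_real (1 - \<theta>) * of_real (real n + \<theta>) powr (- S t - 1))))
        = (\<lambda>\<theta>. S t * (S t - 1) * G \<theta>)"
      unfolding G_def F_def sum_distrib_left by (intro ext sum.cong refl) (simp only: mult_ac)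
    finally have "integral {0..1} (\<lambda>\<theta>. S t * (S t - 1) * G \<theta>) = (\<Sum>n\<in>{Suc M..<Suc L}. H s1 n * powr_rem 1 n (S t))"
      by (rule integral_unique)
    moreover have "integral {0..1} (\<lambda>\<theta>. S t * (S t - 1) * G \<theta>) = S t * (S t - 1) * integral {0..1} G"
      by (rule integral_mult_right)
    moreover have "(\<Sum>n\<in>{Suc M..<Suc L}. H s1 n * powr_rem 1 n (S t)) = (\<Sum>n\<in>{M..<L}. H s1 (Suc n) * powr_rem 1 (Suc n) (S t))"
      by (rule sum.shift_bounds_Suc_ivl)
    ultimately have "(\<Sum>n\<in>{M..<L}. H s1 (Suc n) * powr_rem 1 (Suc n) (S t)) = S t * (S t - 1) * integral {0..1} G"
      by (simp only:)
    then have ts: "tail_sum M L t = S t * integral {0..1} G"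
      unfolding tail_sum_def using S_neq_1[of t] t by simp
    have "norm (S t) \<le> \<sigma> + T" using cmod_le[of "S t"] \<sigma> t by simp
    then have "(norm (S t))\<^sup>2 \<le> (\<sigma> + T)\<^sup>2" by (intro power_mono) auto
    moreover have "(norm (integral {0..1} G))\<^sup>2 \<le> integral {0..1} (\<lambda>\<theta>. (norm (G \<theta>))\<^sup>2)"
      by (rule square_integral_le[OF cG])
    moreover have "integral {0..1} (\<lambda>\<theta>. (norm (G \<theta>))\<^sup>2) \<le> integral {0..1} (\<lambda>\<theta>. (norm (F t \<theta>))\<^sup>2)"
    proof (intro integral_le integrable_continuous_real continuous_intros cG contF1 t)
      fix \<theta> :: real assume "\<theta> \<in> {0..1}"
      then have "norm (G \<theta>) \<le> 1 * norm (F t \<theta>)"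
        unfolding G_def norm_mult norm_of_real by (intro mult_right_mono) auto
      then show "(norm (G \<theta>))\<^sup>2 \<le> (norm (F t \<theta>))\<^sup>2" by (intro power_mono) auto
    qed
    ultimately show ?thesis unfolding ts norm_mult power_mult_distrib
      by (intro mult_mono) auto
  qed
  have contF2: "continuous_on (cbox (2, 0) (T, 1)) (\<lambda>(t, \<theta>). (norm (F t \<theta>))\<^sup>2)"
  proof -
    have "cbox (2, 0) (T, 1) = {2..T} \<times> {0..1::real}" by (simp add: cbox_Pair_eq)
    then show ?thesis using contF by (auto simp: split_def intro!: continuous_intros)
  qed
  have contI: "continuous_on {2..T} (\<lambda>t. integral {0..1} (\<lambda>\<theta>. (norm (F t \<theta>))\<^sup>2))"
    using integral_continuous_on_param[of "{2..T}" 0 1 "\<lambda>t \<theta>. (norm (F t \<theta>))\<^sup>2"] contF2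
    by (simp add: cbox_Pair_eq)
  have contI': "continuous_on {0..1} (\<lambda>\<theta>. integral {2..T} (\<lambda>t. (norm (F t \<theta>))\<^sup>2))"
  proof -
    have "continuous_on ({0..1} \<times> cbox 2 T) (\<lambda>(\<theta>, t). (norm (F t \<theta>))\<^sup>2)"
    proof -
      have "continuous_on ({0..1} \<times> {2..T}) (\<lambda>x::real \<times> real. (snd x, fst x))" by (intro continuous_intros)
      moreover have "(\<lambda>x. (snd x, fst x)) ` ({0..1} \<times> {2..T}) \<subseteq> cbox (2, 0) (T, 1::real)" by (auto simp: cbox_Pair_eq)
      ultimately show ?thesis
        using continuous_on_compose2[OF contF2, of "{0..1} \<times> {2..T}" "\<lambda>x. (snd x, fst x)"] by (simp add: split_def)
    qed
    from integral_continuous_on_param[OF this] show ?thesis by simp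
  qed
  have "integral {2..T} (\<lambda>t. (norm (tail_sum M L t))\<^sup>2) \<le> integral {2..T} (\<lambda>t. (\<sigma> + T)\<^sup>2 * integral {0..1} (\<lambda>\<theta>. (norm (F t \<theta>))\<^sup>2))"
    by (intro integral_le integrable_continuous_real continuous_intros continuous_tail_sum contI pointwise)
  also have "\<dots> = (\<sigma> + T)\<^sup>2 * integral {2..T} (\<lambda>t. integral {0..1} (\<lambda>\<theta>. (norm (F t \<theta>))\<^sup>2))"
    by (rule integral_mult_right)
  also have "integral {2..T} (\<lambda>t. integral {0..1} (\<lambda>\<theta>. (norm (F t \<theta>))\<^sup>2)) = integral {0..1} (\<lambda>\<theta>. integral {2..T} (\<lambda>t. (norm (F t \<theta>))\<^sup>2))"
    using integral_swap_continuous[OF contF2] by simp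
  also have "\<dots> \<le> integral {0..1} (\<lambda>\<theta>::real. tail_bound (Suc M) T)"
  proof (intro integral_le integrable_continuous_real continuous_intros contI')
    fix \<theta> :: real assume "\<theta> \<in> {0..1}"
    then show "integral {2..T} (\<lambda>t. (norm (F t \<theta>))\<^sup>2) \<le> tail_bound (Suc M) T"
      unfolding F_def by (intro tail_kernel_mean_square T) auto
  qed
  finally show ?thesis by (simp add: mult_left_mono)
qed

lemma integral_inverse_square: "T \<ge> 2 \<Longrightarrow> integral {2..T} (\<lambda>t. 1 / t\<^sup>2) \<le> (1 :: real)"
proof -
  assume T: "T \<ge> 2"
  have "((\<lambda>t. 1 / t\<^sup>2) has_integral (- 1 / T - (- 1 / 2))) {2..T}"
    using T by (intro fundamental_theorem_of_calculus)
      (auto intro!: derivative_eq_intros simp: power2_eq_square simp flip: has_real_derivative_iff_has_vector_derivative)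
  then have "integral {2..T} (\<lambda>t. 1 / t\<^sup>2) = 1 / 2 - 1 / T" by (simp add: integral_unique)
  also have "\<dots> \<le> 1" using T by (simp add: field_simps)
  finally show ?thesis .
qed

text \<open>With \<open>M + 1\<close> between \<open>T\<close> and \<open>2 * T\<close>, the tail
  gives \<open>T\<^sup>2 * T powr (- 1 - \<eta>)\<close>. The boundary terms have a factor
  \<open>1 / t\<close>, which is square integrable, and so contribute only the square of
  \<open>X\<close>. The errors uniform in \<open>t\<close> are multiplied by the length of the
  interval.\<close>

lemma error_mean_square:
  assumes T: "T \<ge> 2" and M: "M = nat \<lfloor>T\<rfloor>"
  shows "integral {2..T} (\<lambda>t. (norm (mzeta (pt2 s1 (S t)) - main_sum M t))\<^sup>2)
    \<le> (2 * (\<sigma> + 1)\<^sup>2 * C\<^sup>2 * (pzeta \<delta> + 8 * (pzeta \<eta>)\<^sup>2) + 8 * (1 / c + C)\<^sup>2) * T powr (1 - \<eta>)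
       + 4 * ((norm s1 + 2) * tau M + 1 / T)\<^sup>2 * T"
proof -
  define K1 where "K1 = 1 / c + C"
  define X where "X = real (Suc M) powr (1 / 2 - \<delta>)"
  define \<epsilon> where "\<epsilon> = (norm s1 + 2) * tau M + 1 / T"
  have MT: "T \<le> real (Suc M)" "real (Suc M) \<le> 2 * T" using T unfolding M by linarith+
  \<comment> \<open>For fixed \<open>T\<close> the end \<open>L\<close> can be pushed so far out
    that the second remainder series is below \<open>1 / T\<close> on the whole interval.\<close>
  have "(\<lambda>L. (\<sigma> + T) * C * tau' L) \<longlonglongrightarrow> 0" by (intro tendsto_mult_right_zero tau'_tendsto)
  then have "\<forall>\<^sub>F L in sequentially. (\<sigma> + T) * C * tau' L < 1 / T" using T by (intro order_tendstoD(2)) auto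
  moreover have "\<forall>\<^sub>F L in sequentially. M \<le> L" by (rule eventually_ge_at_top)
  ultimately have "\<forall>\<^sub>F L in sequentially. (\<sigma> + T) * C * tau' L < 1 / T \<and> M \<le> L" by eventually_elim auto
  then obtain L where L: "(\<sigma> + T) * C * tau' L < 1 / T" "M \<le> L"
    using eventually_happens'[OF sequentially_bot] by blast
  have tau'L: "tau' L \<ge> 0" unfolding tau'_def
    by (intro suminf_nonneg summable_ignore_initial_segment[OF tau'_summable]) simp
  have K10: "K1 \<ge> 0" using c C by (simp add: K1_def)
  have pw: "(norm (mzeta (pt2 s1 (S t)) - main_sum M t))\<^sup>2 \<le> 2 * (norm (tail_sum M L t))\<^sup>2 + (4 * (K1 * X)\<^sup>2 * (1 / t\<^sup>2) + 4 * \<epsilon>\<^sup>2)"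
    if t: "t \<in> {2..T}" for t
  proof -
    define r where "r = mzeta (pt2 s1 (S t)) - main_sum M t - tail_sum M L t"
    have "norm r \<le> K1 * X / t + (norm s1 + 2) * tau M + (\<sigma> + t) * C * tau' L"
      unfolding r_def K1_def X_def using t L by (intro remainder_bound) auto
    also have "(\<sigma> + t) * C * tau' L \<le> (\<sigma> + T) * C * tau' L"
      using t C tau'L by (intro mult_right_mono) auto
    also have "\<dots> \<le> 1 / T" using L by simp
    finally have "norm r \<le> K1 * X / t + \<epsilon>" by (simp add: \<epsilon>_def)
    then have "(norm r)\<^sup>2 \<le> (K1 * X / t + \<epsilon>)\<^sup>2" by (intro power_mono) auto
    also have "\<dots> \<le> 2 * (K1 * X / t)\<^sup>2 + 2 * \<epsilon>\<^sup>2" by (rule sum_square_le)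
    finally have 1: "(norm r)\<^sup>2 \<le> 2 * (K1 * X / t)\<^sup>2 + 2 * \<epsilon>\<^sup>2" .
    have "norm (mzeta (pt2 s1 (S t)) - main_sum M t) \<le> norm (tail_sum M L t) + norm r"
      unfolding r_def using norm_triangle_ineq[of "tail_sum M L t" "mzeta (pt2 s1 (S t)) - main_sum M t - tail_sum M L t"] by simp
    then have "(norm (mzeta (pt2 s1 (S t)) - main_sum M t))\<^sup>2 \<le> (norm (tail_sum M L t) + norm r)\<^sup>2" by (intro power_mono) auto
    also have "\<dots> \<le> 2 * (norm (tail_sum M L t))\<^sup>2 + 2 * (norm r)\<^sup>2" by (rule sum_square_le)
    finally show ?thesis using 1 by (simp add: power_divide)
  qed
  have c1: "continuous_on {2..T} (\<lambda>t. 1 / t\<^sup>2 :: real)" using T by (intro continuous_intros) auto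
  have "integral {2..T} (\<lambda>t. (norm (mzeta (pt2 s1 (S t)) - main_sum M t))\<^sup>2) \<le>
     integral {2..T} (\<lambda>t. 2 * (norm (tail_sum M L t))\<^sup>2 + (4 * (K1 * X)\<^sup>2 * (1 / t\<^sup>2) + 4 * \<epsilon>\<^sup>2))"
    by (intro integral_le integrable_continuous_real continuous_on_add continuous_on_diff continuous_on_power continuous_on_mult
        continuous_on_norm continuous_on_const continuous_tail_sum c1 pw continuous_main_sum continuous_mzeta_path)
  also have "\<dots> = 2 * integral {2..T} (\<lambda>t. (norm (tail_sum M L t))\<^sup>2) + (4 * (K1 * X)\<^sup>2 * integral {2..T} (\<lambda>t. 1 / t\<^sup>2) + 4 * \<epsilon>\<^sup>2 * (T - 2))"
  proof -
    have i: "(\<lambda>t. (norm (tail_sum M L t))\<^sup>2) integrable_on {2..T}" "(\<lambda>t. 1 / t\<^sup>2 :: real) integrable_on {2..T}"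
      by (intro integrable_continuous_real continuous_on_power continuous_on_norm continuous_tail_sum c1)+
    have "((\<lambda>t. 2 * (norm (tail_sum M L t))\<^sup>2 + (4 * (K1 * X)\<^sup>2 * (1 / t\<^sup>2) + 4 * \<epsilon>\<^sup>2)) has_integral
       (2 * integral {2..T} (\<lambda>t. (norm (tail_sum M L t))\<^sup>2) + (4 * (K1 * X)\<^sup>2 * integral {2..T} (\<lambda>t. 1 / t\<^sup>2) + (T - 2) *\<^sub>R (4 * \<epsilon>\<^sup>2)))) {2..T}"
      using has_integral_const_real[of "4 * \<epsilon>\<^sup>2" 2 T] T
      by (intro has_integral_add has_integral_mult_right integrable_integral i) auto
    from integral_unique[OF this] show ?thesis by (simp add: mult.commute)
  qed
  also have "\<dots> \<le> 2 * ((\<sigma> + 1)\<^sup>2 * C\<^sup>2 * (pzeta \<delta> + 8 * (pzeta \<eta>)\<^sup>2) * T powr (1 - \<eta>)) + (8 * K1\<^sup>2 * T powr (1 - \<eta>) + 4 * \<epsilon>\<^sup>2 * T)"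
  proof (intro add_mono mult_left_mono)
    have pz: "pzeta \<delta> \<ge> 0" "pzeta \<eta> \<ge> 0" using pzeta_nonneg \<delta>(1) \<eta>(1) by auto
    have "T * real (Suc M) powr (- 2 - \<delta>) \<le> T * T powr (- 2 - \<delta>)"
      using T MT \<delta> by (intro mult_left_mono powr_mono2') auto
    also have "\<dots> = T powr (- 1 - \<delta>)" using powr_times_self[of T "- 2 - \<delta>"] T by (simp add: mult.commute)
    also have "\<dots> \<le> T powr (- 1 - \<eta>)" using T \<eta> by (intro powr_mono) auto
    finally have a: "T * real (Suc M) powr (- 2 - \<delta>) \<le> T powr (- 1 - \<eta>)" .
    have b: "real (Suc M) powr (- 1 - \<eta>) \<le> T powr (- 1 - \<eta>)" using T MT \<eta> by (intro powr_mono2') auto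
    have "tail_bound (Suc M) T
       = C\<^sup>2 * ((T * real (Suc M) powr (- 2 - \<delta>)) * pzeta \<delta> + 8 * (real (Suc M) powr (- 1 - \<eta>) * (pzeta \<eta>)\<^sup>2))"
      by (simp add: tail_bound_def algebra_simps)
    also have "\<dots> \<le> C\<^sup>2 * (T powr (- 1 - \<eta>) * pzeta \<delta> + 8 * (T powr (- 1 - \<eta>) * (pzeta \<eta>)\<^sup>2))"
      using pz by (intro mult_left_mono add_mono mult_right_mono a b) auto
    finally have Q: "tail_bound (Suc M) T
       \<le> C\<^sup>2 * (T powr (- 1 - \<eta>) * pzeta \<delta> + 8 * (T powr (- 1 - \<eta>) * (pzeta \<eta>)\<^sup>2))" .
    have "\<sigma> + T \<le> (\<sigma> + 1) * T"
    proof -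
      have "\<sigma> * 1 \<le> \<sigma> * T" using \<sigma> T by (intro mult_left_mono) auto
      then show ?thesis by (simp add: algebra_simps)
    qed
    then have sT: "(\<sigma> + T)\<^sup>2 \<le> (\<sigma> + 1)\<^sup>2 * T\<^sup>2" using \<sigma> T power_mono[of "\<sigma> + T" "(\<sigma> + 1) * T" 2]
      by (simp add: power_mult_distrib)
    have "integral {2..T} (\<lambda>t. (norm (tail_sum M L t))\<^sup>2)
      \<le> ((\<sigma> + 1)\<^sup>2 * T\<^sup>2) * (C\<^sup>2 * (T powr (- 1 - \<eta>) * pzeta \<delta> + 8 * (T powr (- 1 - \<eta>) * (pzeta \<eta>)\<^sup>2)))"
      by (rule order_trans[OF tail_sum_mean_square[OF T MT(1)]]) (intro mult_mono sT Q, use pz T in \<open>auto simp: tail_bound_def\<close>)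
    also have "\<dots> = (\<sigma> + 1)\<^sup>2 * C\<^sup>2 * (pzeta \<delta> + 8 * (pzeta \<eta>)\<^sup>2) * (T\<^sup>2 * T powr (- 1 - \<eta>))"
      by (simp add: algebra_simps)
    also have "T\<^sup>2 * T powr (- 1 - \<eta>) = T powr (1 - \<eta>)"
    proof -
      have "T\<^sup>2 = T powr 2" using T by (simp add: powr_numeral)
      then show ?thesis by (simp flip: powr_add)
    qed
    finally show "integral {2..T} (\<lambda>t. (norm (tail_sum M L t))\<^sup>2)
      \<le> (\<sigma> + 1)\<^sup>2 * C\<^sup>2 * (pzeta \<delta> + 8 * (pzeta \<eta>)\<^sup>2) * T powr (1 - \<eta>)" .
    have "X\<^sup>2 = real (Suc M) powr (1 - 2 * \<delta>)"
      unfolding X_def power2_eq_square powr_add[symmetric] by (intro arg_cong[where f = "\<lambda>x. real (Suc M) powr x"]) simp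
    also have "\<dots> \<le> real (Suc M) powr (1 - \<eta>)" using \<eta> by (intro powr_mono) auto
    also have "\<dots> \<le> (2 * T) powr (1 - \<eta>)" using MT T \<eta> by (intro powr_mono2) auto
    also have "\<dots> = 2 powr (1 - \<eta>) * T powr (1 - \<eta>)" using T by (simp add: powr_mult)
    also have "\<dots> \<le> 2 powr 1 * T powr (1 - \<eta>)" using \<eta> by (intro mult_right_mono powr_mono) auto
    finally have X2: "X\<^sup>2 \<le> 2 * T powr (1 - \<eta>)" by simp
    have "4 * (K1 * X)\<^sup>2 * integral {2..T} (\<lambda>t. 1 / t\<^sup>2) \<le> 4 * (K1 * X)\<^sup>2 * 1"
      by (intro mult_left_mono integral_inverse_square T) auto
    also have "\<dots> = 4 * K1\<^sup>2 * X\<^sup>2" by (simp add: power_mult_distrib)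
    also have "\<dots> \<le> 4 * K1\<^sup>2 * (2 * T powr (1 - \<eta>))" using X2 by (intro mult_left_mono) auto
    finally show "4 * (K1 * X)\<^sup>2 * integral {2..T} (\<lambda>t. 1 / t\<^sup>2) \<le> 8 * K1\<^sup>2 * T powr (1 - \<eta>)" by simp
  qed auto
  finally show ?thesis by (simp add: K1_def \<epsilon>_def algebra_simps)
qed

text \<open>The average of the squared main sums carries the limit, that of the squared difference
  tends to 0, and \<open>tendsto_of_perturbation\<close> combines the two. The cut \<open>M\<close>
  moves with \<open>T\<close>, so both averages involve a different polynomial for different
  \<open>M\<close>.\<close>

theorem mean_square_limit:
  "((\<lambda>T. integral {2..T} (\<lambda>t. (norm (mzeta (pt2 s1 (S t))))\<^sup>2) / T) \<longlongrightarrow>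
      (\<Sum>n. (norm (H s1 n))\<^sup>2 * real (Suc n) powr (- (2 * \<sigma>)))) at_top"
proof -
  define z0 where "z0 = (\<Sum>n. (norm (H s1 n))\<^sup>2 * real (Suc n) powr (- (2 * \<sigma>)))"
  define sM where "sM = (\<lambda>M. \<Sum>n<M. (norm (H s1 n))\<^sup>2 * real (Suc n) powr (- (2 * \<sigma>)))"
  define M where "M = (\<lambda>T::real. nat \<lfloor>T\<rfloor>)"
  have Mlim: "filterlim M at_top at_top"
    unfolding M_def by (rule filterlim_compose[OF filterlim_nat_sequentially filterlim_floor_sequentially])
  have "summable (\<lambda>n. (norm (H s1 n))\<^sup>2 * real (Suc n) powr (- Re (of_real (2 * \<sigma>))))"
    using \<sigma> s1\<sigma> by (intro zeta22_decomposition(5)) auto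
  then have sm: "summable (\<lambda>n. (norm (H s1 n))\<^sup>2 * real (Suc n) powr (- (2 * \<sigma>)))" by simp
  have "sM \<longlonglongrightarrow> z0" unfolding sM_def[abs_def] z0_def by (rule summable_LIMSEQ[OF sm])
  then have sMlim: "((\<lambda>T. sM (M T)) \<longlongrightarrow> z0) at_top" by (rule filterlim_compose[OF _ Mlim])
  have taulim: "((\<lambda>T. tau (M T)) \<longlongrightarrow> 0) at_top" by (rule filterlim_compose[OF tau_tendsto Mlim])
  have inv: "((\<lambda>T::real. 1 / T) \<longlongrightarrow> 0) at_top" by (intro tendsto_divide_0[OF tendsto_const] filterlim_at_top_imp_at_infinity filterlim_ident)
  have pw: "((\<lambda>T::real. T powr (- \<eta>)) \<longlongrightarrow> 0) at_top" using \<eta> by (intro tendsto_neg_powr filterlim_ident) auto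
  define a where "a = (\<lambda>T. integral {2..T} (\<lambda>t. (norm (main_sum (M T) t))\<^sup>2) / T)"
  define e where "e = (\<lambda>T. integral {2..T} (\<lambda>t. (norm (mzeta (pt2 s1 (S t)) - main_sum (M T) t))\<^sup>2) / T)"
  have ev2: "\<forall>\<^sub>F T in at_top. (2::real) \<le> T" by (rule eventually_ge_at_top)
  \<comment> \<open>The factor \<open>1 - 2 * (1 / T)\<close> is \<open>(T - 2) / T\<close>: the
    interval of integration begins at 2.\<close>
  have "((\<lambda>T. a T - (1 - 2 * (1 / T)) * sM (M T)) \<longlongrightarrow> 0) at_top"
  proof (rule Lim_null_comparison)
    show "\<forall>\<^sub>F T in at_top. norm (a T - (1 - 2 * (1 / T)) * sM (M T)) \<le> 16 * C\<^sup>2 * (pzeta \<eta>)\<^sup>2 * T powr (- \<eta>)"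
      using ev2
    proof eventually_elim
      case (elim T)
      have MT: "real (Suc (M T)) \<le> 2 * T" using elim unfolding M_def by linarith
      have "a T - (1 - 2 * (1 / T)) * sM (M T) = (integral {2..T} (\<lambda>t. (norm (main_sum (M T) t))\<^sup>2) - (T - 2) * sM (M T)) / T"
        using elim by (simp add: a_def field_simps)
      then have "norm (a T - (1 - 2 * (1 / T)) * sM (M T)) = \<bar>integral {2..T} (\<lambda>t. (norm (main_sum (M T) t))\<^sup>2) - (T - 2) * sM (M T)\<bar> / T"
        using elim by simp
      also have "\<dots> \<le> 8 * (C\<^sup>2 * real (Suc (M T)) powr (1 - \<delta>)) * (pzeta \<eta>)\<^sup>2 / T"
        unfolding sM_def using elim by (intro divide_right_mono main_sum_mean_square) auto
      also have "\<dots> \<le> 8 * (C\<^sup>2 * (2 * T powr (1 - \<eta>))) * (pzeta \<eta>)\<^sup>2 / T"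
      proof (intro divide_right_mono mult_right_mono mult_left_mono)
        have "real (Suc (M T)) powr (1 - \<delta>) \<le> (2 * T) powr (1 - \<delta>)" using MT \<delta> by (intro powr_mono2) auto
        also have "\<dots> = 2 powr (1 - \<delta>) * T powr (1 - \<delta>)" using elim by (simp add: powr_mult)
        also have "\<dots> \<le> 2 powr 1 * T powr (1 - \<eta>)" using \<delta> \<eta> elim by (intro mult_mono powr_mono) auto
        finally show "real (Suc (M T)) powr (1 - \<delta>) \<le> 2 * T powr (1 - \<eta>)" by simp
      qed (use elim in auto)
      also have "\<dots> = 16 * C\<^sup>2 * (pzeta \<eta>)\<^sup>2 * (T powr (1 - \<eta>) / T)" by simp
      also have "T powr (1 - \<eta>) / T = T powr (- \<eta>)" using elim by (simp add: powr_diff powr_minus_divide)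
      finally show ?case .
    qed
    show "((\<lambda>T. 16 * C\<^sup>2 * (pzeta \<eta>)\<^sup>2 * T powr (- \<eta>)) \<longlongrightarrow> 0) at_top"
      by (intro tendsto_mult_right_zero pw)
  qed
  moreover have "((\<lambda>T. (1 - 2 * (1 / T)) * sM (M T)) \<longlongrightarrow> (1 - 2 * 0) * z0) at_top"
    by (intro tendsto_intros inv sMlim)
  ultimately have "((\<lambda>T. (a T - (1 - 2 * (1 / T)) * sM (M T)) + (1 - 2 * (1 / T)) * sM (M T)) \<longlongrightarrow> 0 + (1 - 2 * 0) * z0) at_top"
    by (rule tendsto_add)
  then have alim: "(a \<longlongrightarrow> z0) at_top" by simp
  define K where "K = 2 * (\<sigma> + 1)\<^sup>2 * C\<^sup>2 * (pzeta \<delta> + 8 * (pzeta \<eta>)\<^sup>2) + 8 * (1 / c + C)\<^sup>2"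
  have elim: "(e \<longlongrightarrow> 0) at_top"
  proof (rule Lim_null_comparison)
    show "\<forall>\<^sub>F T in at_top. norm (e T) \<le> K * T powr (- \<eta>) + 4 * ((norm s1 + 2) * tau (M T) + 1 / T)\<^sup>2"
      using ev2
    proof eventually_elim
      case (elim T)
      have "integral {2..T} (\<lambda>t. (norm (mzeta (pt2 s1 (S t)) - main_sum (M T) t))\<^sup>2)
         \<le> K * T powr (1 - \<eta>) + 4 * ((norm s1 + 2) * tau (M T) + 1 / T)\<^sup>2 * T"
        unfolding K_def by (rule error_mean_square[OF elim]) (simp add: M_def)
      then have "e T \<le> (K * T powr (1 - \<eta>) + 4 * ((norm s1 + 2) * tau (M T) + 1 / T)\<^sup>2 * T) / T"
        unfolding e_def using elim by (intro divide_right_mono) auto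
      also have "\<dots> = K * (T powr (1 - \<eta>) / T) + 4 * ((norm s1 + 2) * tau (M T) + 1 / T)\<^sup>2"
        using elim by (simp add: add_divide_distrib)
      also have "T powr (1 - \<eta>) / T = T powr (- \<eta>)" using elim by (simp add: powr_diff powr_minus_divide)
      finally have "e T \<le> K * T powr (- \<eta>) + 4 * ((norm s1 + 2) * tau (M T) + 1 / T)\<^sup>2" .
      moreover have "e T \<ge> 0" unfolding e_def using elim
        by (intro divide_nonneg_nonneg integral_nonneg integrable_continuous_real continuous_intros continuous_mzeta_path continuous_main_sum) auto
      ultimately show ?case by simp
    qed
    have "((\<lambda>T. K * T powr (- \<eta>) + 4 * ((norm s1 + 2) * tau (M T) + 1 / T)\<^sup>2) \<longlongrightarrow> K * 0 + 4 * ((norm s1 + 2) * 0 + 0)\<^sup>2) at_top"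
      by (intro tendsto_intros pw taulim inv)
    then show "((\<lambda>T. K * T powr (- \<eta>) + 4 * ((norm s1 + 2) * tau (M T) + 1 / T)\<^sup>2) \<longlongrightarrow> 0) at_top" by simp
  qed
  show ?thesis
    unfolding z0_def[symmetric]
  proof (rule tendsto_of_perturbation[OF alim elim])
    fix \<kappa> :: real assume \<kappa>: "\<kappa> > 0"
    show "\<forall>\<^sub>F T in at_top. \<bar>integral {2..T} (\<lambda>t. (norm (mzeta (pt2 s1 (S t))))\<^sup>2) / T - a T\<bar> \<le> \<kappa> * a T + (1 + 1 / \<kappa>) * e T"
      using ev2
    proof eventually_elim
      case (elim T)
      define z where "z = (\<lambda>t. mzeta (pt2 s1 (S t)))"
      define A where "A = main_sum (M T)"
      have i: "(\<lambda>t. (norm (z t))\<^sup>2) integrable_on {2..T}" "(\<lambda>t. (norm (A t))\<^sup>2) integrable_on {2..T}"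
         "(\<lambda>t. (norm (z t - A t))\<^sup>2) integrable_on {2..T}"
        unfolding z_def A_def
        by (intro integrable_continuous_real continuous_intros continuous_mzeta_path continuous_main_sum)+
      have "norm (integral {2..T} (\<lambda>t. (norm (z t))\<^sup>2 - (norm (A t))\<^sup>2)) \<le> integral {2..T} (\<lambda>t. \<kappa> * (norm (A t))\<^sup>2 + (1 + 1 / \<kappa>) * (norm (z t - A t))\<^sup>2)"
      proof (intro integral_norm_bound_integral integrable_diff integrable_add integrable_on_mult_right i)
        fix t
        show "norm ((norm (z t))\<^sup>2 - (norm (A t))\<^sup>2) \<le> \<kappa> * (norm (A t))\<^sup>2 + (1 + 1 / \<kappa>) * (norm (z t - A t))\<^sup>2"
          using square_perturb[OF \<kappa>, of "A t" "z t - A t"] by simp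
      qed
      also have "integral {2..T} (\<lambda>t. \<kappa> * (norm (A t))\<^sup>2 + (1 + 1 / \<kappa>) * (norm (z t - A t))\<^sup>2)
         = \<kappa> * integral {2..T} (\<lambda>t. (norm (A t))\<^sup>2) + (1 + 1 / \<kappa>) * integral {2..T} (\<lambda>t. (norm (z t - A t))\<^sup>2)"
        by (subst integral_add) (intro integrable_on_mult_right i | simp only: integral_mult_right)+
      also have "integral {2..T} (\<lambda>t. (norm (z t))\<^sup>2 - (norm (A t))\<^sup>2) = integral {2..T} (\<lambda>t. (norm (z t))\<^sup>2) - integral {2..T} (\<lambda>t. (norm (A t))\<^sup>2)"
        by (rule integral_diff[OF i(1,2)])
      finally have "\<bar>integral {2..T} (\<lambda>t. (norm (z t))\<^sup>2) - integral {2..T} (\<lambda>t. (norm (A t))\<^sup>2)\<bar> / T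
         \<le> (\<kappa> * integral {2..T} (\<lambda>t. (norm (A t))\<^sup>2) + (1 + 1 / \<kappa>) * integral {2..T} (\<lambda>t. (norm (z t - A t))\<^sup>2)) / T"
        using elim by (intro divide_right_mono) auto
      then show ?case using elim unfolding a_def e_def z_def A_def
        by (simp add: add_divide_distrib diff_divide_distrib[symmetric])
    qed
  qed
qed

end

lemma mean_square_asymptotic:
  fixes s1 :: complex and \<sigma>2 :: real
  assumes \<sigma>: "\<sigma>2 > 1 / 2" "Re s1 + \<sigma>2 > 3 / 2"
    and reg: "\<forall>t::real. t \<ge> 2 \<longrightarrow> \<not> mpole mzeta (pt2 s1 (of_real \<sigma>2 + \<i> * of_real t))"
  shows "(\<lambda>T::real. complex_of_real (integral {2..T} (\<lambda>t. (cmod (zeta2 s1 (of_real \<sigma>2 + \<i> * of_real t)))\<^sup>2))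
            - zeta22 s1 (of_real (2 * \<sigma>2)) * of_real T) \<in> o[at_top](\<lambda>T. of_real T)"
proof -
  \<comment> \<open>Midpoint of the interval from \<open>max 0 (1 - Re s1)\<close> to
    \<open>\<sigma>2 - 1 / 2\<close>, nonempty by the two inequalities on the real parts.\<close>
  define \<beta> where "\<beta> = (max 0 (1 - Re s1) + (\<sigma>2 - 1 / 2)) / 2"
  have \<beta>: "\<beta> > max 0 (1 - Re s1)" "\<beta> < \<sigma>2 - 1 / 2" unfolding \<beta>_def using \<sigma> by (auto simp: max_def)
  obtain C where C: "C \<ge> 0" "\<And>N. hsum (Re s1) N \<le> C * real N powr \<beta>"
    using hsum_bound[of \<beta> "Re s1"] \<beta> by auto
  \<comment> \<open>The real part of s1 + s2 - 2 is constant along the path; if it is nonzero, its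
    modulus serves as \<open>c\<close>. Otherwise the vertical line meets s1 + s2 = 2 at height
    \<open>- Im s1\<close>. There \<open>mzeta2_pole\<close> gives a pole, so the hypothesis puts
    this height below 2, and the imaginary part provides \<open>c\<close>.\<close>
  have "\<exists>c>0. \<forall>t\<ge>2. c \<le> norm (s1 + (of_real \<sigma>2 + \<i> * of_real t) - 1 - 1)"
  proof (cases "Re s1 + \<sigma>2 = 2")
    case False
    have "\<bar>Re s1 + \<sigma>2 - 2\<bar> \<le> norm (s1 + (of_real \<sigma>2 + \<i> * of_real t) - 1 - 1)" for t
      using abs_Re_le_cmod[of "s1 + (of_real \<sigma>2 + \<i> * of_real t) - 1 - 1"] by simp
    then show ?thesis using False by (intro exI[of _ "\<bar>Re s1 + \<sigma>2 - 2\<bar>"]) auto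
  next
    case True
    have "Im s1 > - 2"
    proof (rule ccontr)
      assume "\<not> Im s1 > - 2"
      then have t: "- Im s1 \<ge> 2" by simp
      define p where "p = pt2 s1 (of_real \<sigma>2 + \<i> * of_real (- Im s1))"
      have "mpole mzeta p"
      proof (rule mzeta2_pole)
        show "p \<in> D.shifted 1" using \<sigma> by (simp add: p_def D_shifted)
        show "p $ 1 \<noteq> 1" using t by (auto simp: p_def complex_eq_iff)
        show "p $ 0 + p $ 1 = 2" using True by (simp add: p_def complex_eq_iff)
      qed
      then show False using reg t unfolding p_def by blast
    qed
    moreover have "2 + Im s1 \<le> norm (s1 + (of_real \<sigma>2 + \<i> * of_real t) - 1 - 1)" if "t \<ge> 2" for t
      using abs_Im_le_cmod[of "s1 + (of_real \<sigma>2 + \<i> * of_real t) - 1 - 1"] that by simp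
    ultimately show ?thesis by (intro exI[of _ "2 + Im s1"]) auto
  qed
  then obtain c where c: "c > 0" "\<And>t. t \<ge> 2 \<Longrightarrow> c \<le> norm (s1 + (of_real \<sigma>2 + \<i> * of_real t) - 1 - 1)" by blast
  interpret mean_square s1 \<sigma>2 \<beta> C c
    by standard (use \<sigma> \<beta> C c in auto)
  define z0 where "z0 = (\<Sum>n. (norm (H s1 n))\<^sup>2 * real (Suc n) powr (- (2 * \<sigma>2)))"
  have \<rho>: "Re (complex_of_real (2 * \<sigma>2)) > 1" "2 * Re s1 + Re (complex_of_real (2 * \<sigma>2)) > 3"
    unfolding Re_complex_of_real using assms(1,2) by linarith+
  have z: "zeta22 s1 (of_real (2 * \<sigma>2)) = of_real z0"
  proof -
    have "zeta22 s1 (of_real (2 * \<sigma>2)) = (\<Sum>n. of_real ((norm (H s1 n))\<^sup>2) * of_nat (Suc n) powr (- of_real (2 * \<sigma>2)))"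
      by (rule zeta22_decomposition(6)[OF \<rho>])
    also have "\<dots> = (\<Sum>n. of_real ((norm (H s1 n))\<^sup>2 * real (Suc n) powr (- (2 * \<sigma>2))))"
    proof (intro suminf_cong)
      fix n
      have "of_nat (Suc n) powr (- of_real (2 * \<sigma>2)) = (of_real (real (Suc n) powr (- (2 * \<sigma>2))) :: complex)"
        using powr_of_real[of "real (Suc n)" "- (2 * \<sigma>2)"] by (simp del: of_nat_Suc)
      then show "of_real ((norm (H s1 n))\<^sup>2) * of_nat (Suc n) powr (- of_real (2 * \<sigma>2)) =
          (of_real ((norm (H s1 n))\<^sup>2 * real (Suc n) powr (- (2 * \<sigma>2))) :: complex)"
        by (simp only: of_real_mult)
    qed
    also have "\<dots> = of_real z0"
      unfolding z0_def using zeta22_decomposition(5)[OF \<rho>] by (intro suminf_of_real[symmetric]) simp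
    finally show ?thesis .
  qed
  define J where "J = (\<lambda>T. integral {2..T} (\<lambda>t. (cmod (zeta2 s1 (of_real \<sigma>2 + \<i> * of_real t)))\<^sup>2))"
  have lim: "((\<lambda>T. J T / T) \<longlongrightarrow> z0) at_top"
    using mean_square_limit unfolding J_def z0_def S_def .
  have "((\<lambda>T. complex_of_real (J T / T - z0)) \<longlongrightarrow> complex_of_real (z0 - z0)) at_top"
    by (intro tendsto_of_real tendsto_diff lim tendsto_const)
  moreover have "\<forall>\<^sub>F T in at_top. complex_of_real (J T / T - z0) = (complex_of_real (J T) - of_real z0 * of_real T) / of_real T"
    using eventually_gt_at_top[of 0] by eventually_elim (simp add: field_simps)
  ultimately have "((\<lambda>T. (complex_of_real (J T) - of_real z0 * of_real T) / of_real T) \<longlongrightarrow> 0) at_top"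
    using Lim_transform_eventually by fastforce
  moreover have "\<forall>\<^sub>F T in at_top. complex_of_real T \<noteq> 0"
    using eventually_gt_at_top[of 0] by eventually_elim simp
  ultimately have "(\<lambda>T. complex_of_real (J T) - of_real z0 * of_real T) \<in> o[at_top](\<lambda>T. of_real T)"
    by (intro smalloI_tendsto)
  then show ?thesis unfolding z J_def .
qed

lemma zeta22_decomposition_nat:
  fixes k l :: nat
  assumes kl: "k \<ge> 1" "l \<ge> 2"
  shows "zeta22 (of_nat k) (of_nat l) = 2 * zeta3 (of_nat k) (of_nat k) (of_nat l) + zeta2 (of_nat (2 * k)) (of_nat l)"
    and "pt3 (of_nat k) (of_nat k) (of_nat l) \<in> mzeta_region" and "pt2 (of_nat (2 * k)) (of_nat l) \<in> mzeta_region"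
proof -
  have c: "Re (of_nat l :: complex) > 1" "2 * Re (of_nat k :: complex) + Re (of_nat l :: complex) > 3" using kl by auto
  have e: "complex_of_real (2 * Re (of_nat k)) = of_nat (2 * k)" "cnj (of_nat k) = of_nat k" by simp_all
  note dec = zeta22_decomposition[OF c, unfolded e]
  show "zeta22 (of_nat k) (of_nat l) = 2 * zeta3 (of_nat k) (of_nat k) (of_nat l) + zeta2 (of_nat (2 * k)) (of_nat l)"
    using dec(2) by simp
  show "pt3 (of_nat k) (of_nat k) (of_nat l) \<in> mzeta_region" "pt2 (of_nat (2 * k)) (of_nat l) \<in> mzeta_region"
    by (fact dec(3), fact dec(4))
qed

theorem theorem1p1:
  shows
    "(\<forall>s1 \<rho> :: complex. Re \<rho> > 1 \<longrightarrow> 2 * Re s1 + Re \<rho> > 3 \<longrightarrow>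
        (\<lambda>n. norm (zeta22_term s1 \<rho> n)) summable_on {1..} \<and>
        zeta22 s1 \<rho> =
          zeta3 s1 (cnj s1) \<rho> + zeta3 (cnj s1) s1 \<rho> + zeta2 (of_real (2 * Re s1)) \<rho>)
   \<and> (\<forall>(s1 :: complex) (\<sigma>2 :: real).
        (Re (of_real (2 * \<sigma>2)) > 1 \<and> 2 * Re s1 + Re (of_real (2 * \<sigma>2)) > 3
           \<longleftrightarrow> \<sigma>2 > 1 / 2 \<and> Re s1 + \<sigma>2 > 3 / 2) \<and>
        (\<sigma>2 > 1 / 2 \<longrightarrow> Re s1 + \<sigma>2 > 3 / 2 \<longrightarrow>
         (\<forall>t::real. t \<ge> 2 \<longrightarrow> \<not> mpole mzeta (pt2 s1 (of_real \<sigma>2 + \<i> * of_real t))) \<longrightarrow>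
         (\<lambda>T::real.
            complex_of_real
              (integral {2..T} (\<lambda>t. (cmod (zeta2 s1 (of_real \<sigma>2 + \<i> * of_real t)))\<^sup>2))
            - (zeta3 s1 (cnj s1) (of_real (2 * \<sigma>2)) + zeta3 (cnj s1) s1 (of_real (2 * \<sigma>2))
               + zeta2 (of_real (2 * Re s1)) (of_real (2 * \<sigma>2))) * of_real T)
         \<in> o[at_top](\<lambda>T. of_real T)))
   \<and> (\<forall>k l :: nat. k \<ge> 1 \<longrightarrow> l \<ge> 2 \<longrightarrow>
        zeta22 (of_nat k) (of_nat l) =
          2 * zeta3 (of_nat k) (of_nat k) (of_nat l) + zeta2 (of_nat (2 * k)) (of_nat l) \<and>
        (\<lambda>T::real.
            complex_of_real
              (integral {2..T}
                 (\<lambda>t. (cmod (zeta2 (of_nat k) (of_real (real l / 2) + \<i> * of_real t)))\<^sup>2))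
            - (2 * zeta3 (of_nat k) (of_nat k) (of_nat l)
               + zeta2 (of_nat (2 * k)) (of_nat l)) * of_real T)
         \<in> o[at_top](\<lambda>T. of_real T) \<and>
        pt3 (of_nat k) (of_nat k) (of_nat l) \<in> mzeta_region \<and>
        pt2 (of_nat (2 * k)) (of_nat l) \<in> mzeta_region)"
proof (intro conjI allI impI, goal_cases)
  case (1 s1 \<rho>)
  then show ?case by (rule zeta22_decomposition(1))
next
  case (2 s1 \<rho>)
  then show ?case by (rule zeta22_decomposition(2))
next
  case (3 s1 \<sigma>2)
  show ?case by auto
next
  case (4 s1 \<sigma>2)
  have "zeta22 s1 (of_real (2 * \<sigma>2)) = zeta3 s1 (cnj s1) (of_real (2 * \<sigma>2)) + zeta3 (cnj s1) s1 (of_real (2 * \<sigma>2))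
               + zeta2 (of_real (2 * Re s1)) (of_real (2 * \<sigma>2))"
    using 4 by (intro zeta22_decomposition(2)) auto
  then show ?case using mean_square_asymptotic[OF 4] by simp
next
  case (5 k l)
  then show ?case using zeta22_decomposition_nat(1) by simp
next
  case (6 k l)
  define p where "p = (\<lambda>t. pt2 (of_nat k) (of_real (real l / 2) + \<i> * of_real t))"
  \<comment> \<open>For \<open>t \<ge> 2\<close> the imaginary parts of s2 and s1 + s2 are nonzero,
    so neither polar line is met.\<close>
  have "\<not> mpole mzeta (p t)" if "t \<ge> 2" for t
    using 6 that by (intro mzeta2_regular(3)) (auto simp: p_def D_shifted complex_eq_iff)
  then have "(\<lambda>T::real. complex_of_real (integral {2..T} (\<lambda>t. (cmod (mzeta (p t)))\<^sup>2))
            - zeta22 (of_nat k) (of_real (2 * (real l / 2))) * of_real T) \<in> o[at_top](\<lambda>T. of_real T)"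
    using 6 unfolding p_def by (intro mean_square_asymptotic) auto
  then show ?case using zeta22_decomposition_nat(1)[OF 6] by (simp add: p_def)
next
  case (7 k l)
  then show ?case by (rule zeta22_decomposition_nat(2))
next
  case (8 k l)
  then show ?case by (rule zeta22_decomposition_nat(3))
qed

end
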